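(* Let $X$ be an irreducible continuous-time Markov process on a finite set $\mathcal{X}$ with kernel $p$, reversible with respect to the probability measure $\mu$, and let $\mathcal{R}\subset\mathcal{X}$ be such that the restricted processes $X_{\mathcal{R}}$ and $X_{\mathcal{X}\setminus\mathcal{R}}$ are irreducible. The function $\lambda\in[0,+\infty]\mapsto\mu^*_{\mathcal{R},\lambda}\in\ell^2(\mu^*_{\mathcal{R}})$ is a continuous interpolation between the restricted ensemble $\mu_{\mathcal{R}}$ (its value at $\lambda=0$) and the quasi-stationary distribution $\mu^*_{\mathcal{R}}$ (its value at $\lambda=+\infty$). In particular, for any $\lambda_0\in[0,+\infty]$ and $y\in\mathcal{R}$, $$\lim_{\lambda\to\lambda_0}\mu^*_{\mathcal{R},\lambda}(y)=\mu^*_{\mathcal{R},\lambda_0}(y),$$ and for all $x\in\mathcal{R}$, $$\lim_{\lambda\to\lambda_0}\lim_{t\to\infty}\mathbb{P}_x(X\circ\ell_{\mathcal{R}}^{-1}(t)=y\mid\tau_{\mathcal{X}\setminus\mathcal{R},\lambda}>t)=\lim_{t\to\infty}\lim_{\lambda\to\lambda_0}\mathbb{P}_x(X\circ\ell_{\mathcal{R}}^{-1}(t)=y\mid\tau_{\mathcal{X}\setminus\mathcal{R},\lambda}>t).$$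
   Context: $X$ has generator $\mathcal{L}f(x)=\sum_{y\in\mathcal{X}}p(x,y)(f(y)-f(x))$, $p\ge0$, $\sum_yp(x,y)=1$, $\mu(x)p(x,y)=\mu(y)p(y,x)$; it is seen as updated according to the transition matrix $p$ at each ring of a rate-1 Poisson clock. $\mathcal{R}$ is a nonempty proper subset; $\mu_{\mathcal{R}}=\mu(\cdot\mid\mathcal{R})$. The restricted process $X_{\mathcal{R}}$ has kernel $p(x,y)$ for $x\ne y$ in $\mathcal{R}$ and $p(x,x)+\sum_{y\notin\mathcal{R}}p(x,y)$ on the diagonal (similarly for $\mathcal{X}\setminus\mathcal{R}$). $\mu^*_{\mathcal{R}}$ is the unique probability measure on $\mathcal{R}$ that is a left eigenvector of $(p(x,y))_{x,y\in\mathcal{R}}$ for its spectral radius. For $A\subset\mathcal{X}$, $\ell_A(t)=\int_0^t\mathbf{1}_A(X(s))ds$ and $\ell_A^{-1}(t)=\inf\{s\ge0:\ell_A(s)>t\}$. $\sigma_\lambda$ is exponential with mean $1/\lambda$, independent of $X$ ($\sigma_0=+\infty$, $\sigma_{+\infty}=0$). $\tau$ is the first clock ring and $\tau^+_{\mathcal{R}}$ the first time $\ge\tau$ at which $X$ is in $\mathcal{R}$. For $x,y\in\mathcal{R}$, $p^*_{\mathcal{R},\lambda}(x,y)=\mathbb{P}_x(X(\tau^+_{\mathcal{R}})=y,\ \ell_{\mathcal{X}\setminus\mathcal{R}}(\tau^+_{\mathcal{R}})\le\sigma_\lambda)$, and $\mu^*_{\mathcal{R},\lambda}$ is the unique probability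 measure on $\mathcal{R}$ that is a left eigenvector of $p^*_{\mathcal{R},\lambda}$ for its spectral radius. $\tau_{\mathcal{X}\setminus\mathcal{R},\lambda}=\ell_{\mathcal{R}}(\ell^{-1}_{\mathcal{X}\setminus\mathcal{R}}(\sigma_\lambda))$ (so it is $+\infty$ for $\lambda=0$ and the hitting time of $\mathcal{X}\setminus\mathcal{R}$ for $\lambda=+\infty$). *)

theory Defs
  imports "HOL-Probability.Probability"
begin

definition irreducible_on :: "'a set \<Rightarrow> ('a \<Rightarrow> 'a \<Rightarrow> real) \<Rightarrow> bool" where
  "irreducible_on A K \<longleftrightarrow>
     (\<forall>x\<in>A. \<forall>y\<in>A. (x, y) \<in> {(u, v). u \<in> A \<and> v \<in> A \<and> K u v > 0}\<^sup>*)"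

definition reversible :: "('a \<Rightarrow> 'a pmf) \<Rightarrow> 'a pmf \<Rightarrow> bool" where
  "reversible p \<mu> \<longleftrightarrow> (\<forall>x y. pmf \<mu> x * pmf (p x) y = pmf \<mu> y * pmf (p y) x)"

definition restricted_kernel :: "('a::finite \<Rightarrow> 'a pmf) \<Rightarrow> 'a set \<Rightarrow> 'a \<Rightarrow> 'a \<Rightarrow> real" where
  "restricted_kernel p A x y =
     (if x = y then pmf (p x) x + (\<Sum>z\<in>-A. pmf (p x) z) else pmf (p x) y)"

text \<open>Complex eigenvalues and spectral radius of the matrix \<open>(K x y)\<close> with \<open>x, y \<in> A\<close>;
  only the values of \<open>v\<close> on \<open>A\<close> matter.\<close>

definition kernel_spectrum :: "'a set \<Rightarrow> ('a \<Rightarrow> 'a \<Rightarrow> real) \<Rightarrow> complex set" where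
  "kernel_spectrum A K =
     {z. \<exists>v. (\<exists>x\<in>A. v x \<noteq> 0) \<and> (\<forall>x\<in>A. (\<Sum>y\<in>A. complex_of_real (K x y) * v y) = z * v x)}"

definition kernel_spectral_radius :: "'a set \<Rightarrow> ('a \<Rightarrow> 'a \<Rightarrow> real) \<Rightarrow> real" where
  "kernel_spectral_radius A K = (SUP z\<in>kernel_spectrum A K. cmod z)"

definition perron_measure :: "'a set \<Rightarrow> ('a \<Rightarrow> 'a \<Rightarrow> real) \<Rightarrow> 'a pmf" where
  "perron_measure A K =
     (THE \<nu>. set_pmf \<nu> \<subseteq> A \<and>
        (\<forall>y\<in>A. (\<Sum>x\<in>A. pmf \<nu> x * K x y) = kernel_spectral_radius A K * pmf \<nu> y))"

definition quasi_stationary :: "('a \<Rightarrow> 'a pmf) \<Rightarrow> 'a set \<Rightarrow> 'a pmf" where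
  "quasi_stationary p R = perron_measure R (\<lambda>x y. pmf (p x) y)"

definition l2_norm :: "'a pmf \<Rightarrow> ('a \<Rightarrow> real) \<Rightarrow> real" where
  "l2_norm \<nu> f = sqrt (measure_pmf.expectation \<nu> (\<lambda>x. (f x)\<^sup>2))"

text \<open>
  Random times take values in \<open>[0, \<infinity>]\<close>, hence the type \<open>ennreal\<close>; a path is evaluated at such a time
  through \<open>enn2real\<close>, which is meaningful when the time is finite.
\<close>

definition local_time :: "'a set \<Rightarrow> (real \<Rightarrow> 'a) \<Rightarrow> ennreal \<Rightarrow> ennreal" where
  "local_time A \<xi> t = (\<integral>\<^sup>+ s. indicator A (\<xi> s) * indicator {s. 0 \<le> s \<and> ennreal s \<le> t} s \<partial>lborel)"

definition inv_local_time :: "'a set \<Rightarrow> (real \<Rightarrow> 'a) \<Rightarrow> ennreal \<Rightarrow> ennreal" where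
  "inv_local_time A \<xi> t = Inf {ennreal s | s. 0 \<le> s \<and> local_time A \<xi> (ennreal s) > t}"

definition first_time_from :: "real \<Rightarrow> 'a set \<Rightarrow> (real \<Rightarrow> 'a) \<Rightarrow> ennreal" where
  "first_time_from r A \<xi> = Inf {ennreal s | s. r \<le> s \<and> \<xi> s \<in> A}"

text \<open>
  \<open>s k\<close> is the waiting time between the \<open>k\<close>-th and the \<open>(k+1)\<close>-st ring of the clock, so that
  \<open>\<Sum>k\<le>n. s k\<close> is the time of the \<open>(n+1)\<close>-st ring, and \<open>z n\<close> is the state after \<open>n\<close> updates.
  The first alternative has full probability; the second one only serves to make the path well
  behaved for every realisation of the clock.
\<close>

definition clock_path :: "(nat \<Rightarrow> real) \<Rightarrow> (nat \<Rightarrow> 'a) \<Rightarrow> real \<Rightarrow> 'a" where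
  "clock_path s z t =
     (if (\<forall>n. 0 < s n) \<and> filterlim (\<lambda>n. \<Sum>k\<le>n. s k) at_top sequentially
      then z (card {n. (\<Sum>k\<le>n. s k) \<le> t})
      else z 0)"

text \<open>The library's \<open>prob_space.indep_var\<close> requires both variables to have the same value type.\<close>

definition independent_rv ::
    "'w measure \<Rightarrow> 'b measure \<Rightarrow> ('w \<Rightarrow> 'b) \<Rightarrow> 'c measure \<Rightarrow> ('w \<Rightarrow> 'c) \<Rightarrow> bool" where
  "independent_rv M N X N' Y \<longleftrightarrow> X \<in> measurable M N \<and> Y \<in> measurable M N' \<and>
     prob_space.indep_set M {X -` A \<inter> space M | A. A \<in> sets N} {Y -` B \<inter> space M | B. B \<in> sets N'}"

text \<open>
  This is the uniformised construction of the process with generator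
  \<open>L f x = (\<Sum>y. p x y * (f y - f x))\<close> started at \<open>x\<close> under \<open>P x\<close>: \<open>S\<close> are the waiting times of a
  rate-1 Poisson clock and \<open>Z\<close> is the chain of updates. For \<open>0 < l < \<infinity>\<close> the variable \<open>\<sigma> l\<close> has
  mean \<open>1 / l\<close> and is independent of the process together with its clock; no joint law of the
  variables \<open>\<sigma> l\<close> for different \<open>l\<close> is prescribed.
\<close>

locale rate_one_process =
  fixes P :: "'a::finite \<Rightarrow> 'w measure"
    and p :: "'a \<Rightarrow> 'a pmf"
    and S :: "nat \<Rightarrow> 'w \<Rightarrow> real"
    and Z :: "nat \<Rightarrow> 'w \<Rightarrow> 'a"
    and \<sigma> :: "real \<Rightarrow> 'w \<Rightarrow> real"
  assumes prob_space_P: "prob_space (P x)"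
    and clock_indep: "prob_space.indep_vars (P x) (\<lambda>_. borel) S UNIV"
    and clock_exponential: "distributed (P x) lborel (S n) (exponential_density 1)"
    and chain_measurable: "Z n \<in> measurable (P x) (count_space UNIV)"
    and chain_law: "\<P>(\<omega> in P x. \<forall>i\<le>n. Z i \<omega> = z i) =
          (if z 0 = x then 1 else 0) * (\<Prod>i<n. pmf (p (z i)) (z (Suc i)))"
    and clock_chain_indep:
      "independent_rv (P x)
         (Pi\<^sub>M UNIV (\<lambda>_. borel)) (\<lambda>\<omega> n. S n \<omega>)
         (Pi\<^sub>M UNIV (\<lambda>_. count_space UNIV)) (\<lambda>\<omega> n. Z n \<omega>)"
    and killing_exponential:
      "0 < l \<Longrightarrow> distributed (P x) lborel (\<sigma> l) (exponential_density l)"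
    and killing_indep:
      "0 < l \<Longrightarrow> independent_rv (P x)
         borel (\<sigma> l)
         (Pi\<^sub>M UNIV (\<lambda>_. borel) \<Otimes>\<^sub>M Pi\<^sub>M UNIV (\<lambda>_. count_space UNIV))
         (\<lambda>\<omega>. (\<lambda>n. S n \<omega>, \<lambda>n. Z n \<omega>))"

definition process :: "(nat \<Rightarrow> 'w \<Rightarrow> real) \<Rightarrow> (nat \<Rightarrow> 'w \<Rightarrow> 'a) \<Rightarrow> 'w \<Rightarrow> real \<Rightarrow> 'a" where
  "process S Z \<omega> = clock_path (\<lambda>n. S n \<omega>) (\<lambda>n. Z n \<omega>)"

definition killing_time :: "(real \<Rightarrow> 'w \<Rightarrow> real) \<Rightarrow> ennreal \<Rightarrow> 'w \<Rightarrow> ennreal" where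
  "killing_time \<sigma> lam \<omega> =
     (if lam = 0 then top else if lam = top then 0 else ennreal (\<sigma> (enn2real lam) \<omega>))"

text \<open>\<open>S 0\<close> is the time of the first ring of the clock, whether or not the update changes the state.\<close>

definition return_time ::
    "(nat \<Rightarrow> 'w \<Rightarrow> real) \<Rightarrow> (nat \<Rightarrow> 'w \<Rightarrow> 'a) \<Rightarrow> 'a set \<Rightarrow> 'w \<Rightarrow> ennreal" where
  "return_time S Z R \<omega> = first_time_from (S 0 \<omega>) R (process S Z \<omega>)"

definition soft_kernel ::
    "('a \<Rightarrow> 'w measure) \<Rightarrow> (nat \<Rightarrow> 'w \<Rightarrow> real) \<Rightarrow> (nat \<Rightarrow> 'w \<Rightarrow> 'a) \<Rightarrow> (real \<Rightarrow> 'w \<Rightarrow> real) \<Rightarrow>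
     'a set \<Rightarrow> ennreal \<Rightarrow> 'a \<Rightarrow> 'a \<Rightarrow> real" where
  "soft_kernel P S Z \<sigma> R lam x y =
     \<P>(\<omega> in P x. process S Z \<omega> (enn2real (return_time S Z R \<omega>)) = y \<and>
        local_time (-R) (process S Z \<omega>) (return_time S Z R \<omega>) \<le> killing_time \<sigma> lam \<omega>)"

definition soft_measure ::
    "('a \<Rightarrow> 'w measure) \<Rightarrow> (nat \<Rightarrow> 'w \<Rightarrow> real) \<Rightarrow> (nat \<Rightarrow> 'w \<Rightarrow> 'a) \<Rightarrow> (real \<Rightarrow> 'w \<Rightarrow> real) \<Rightarrow>
     'a set \<Rightarrow> ennreal \<Rightarrow> 'a pmf" where
  "soft_measure P S Z \<sigma> R lam = perron_measure R (soft_kernel P S Z \<sigma> R lam)"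

definition soft_exit_time ::
    "(nat \<Rightarrow> 'w \<Rightarrow> real) \<Rightarrow> (nat \<Rightarrow> 'w \<Rightarrow> 'a) \<Rightarrow> (real \<Rightarrow> 'w \<Rightarrow> real) \<Rightarrow>
     'a set \<Rightarrow> ennreal \<Rightarrow> 'w \<Rightarrow> ennreal" where
  "soft_exit_time S Z \<sigma> R lam \<omega> =
     local_time R (process S Z \<omega>)
       (inv_local_time (-R) (process S Z \<omega>) (killing_time \<sigma> lam \<omega>))"

definition conditioned_law ::
    "('a \<Rightarrow> 'w measure) \<Rightarrow> (nat \<Rightarrow> 'w \<Rightarrow> real) \<Rightarrow> (nat \<Rightarrow> 'w \<Rightarrow> 'a) \<Rightarrow> (real \<Rightarrow> 'w \<Rightarrow> real) \<Rightarrow>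
     'a set \<Rightarrow> ennreal \<Rightarrow> 'a \<Rightarrow> 'a \<Rightarrow> real \<Rightarrow> real" where
  "conditioned_law P S Z \<sigma> R lam x y t =
     \<P>(\<omega> in P x. process S Z \<omega> (enn2real (inv_local_time R (process S Z \<omega>) (ennreal t))) = y
        \<bar> soft_exit_time S Z \<sigma> R lam \<omega> > ennreal t)"

end

(*
  Decompose the trajectory at its visits to R. With theta = 1 / (1 + lambda), every step that starts
  outside R survives the killing with probability theta, so the soft kernel is the power series
  K_theta = (SUM m. theta^m * H_m), where H_m is the kernel of excursions with m steps outside R. It is
  continuous in theta on [0, 1], reversible and irreducible on R; it is the stochastic trace kernel
  for theta = 1 and p restricted to R for theta = 0. As the sojourns in R are exponential
  and independent of the excursions, X at the inverse local time t, before the killing, has the law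
  exp (t (K_theta - I)), i.e. the Poisson(t) mixture of the powers of K_theta.

  Perron-Frobenius theory for K_theta (a Brouwer fixed point, the uniqueness of positive
  eigenvectors and a closed graph argument) gives the continuity of the left eigenvector.
  For t to infinity, mixing with Poisson weights makes exp (t (K_theta - r)) asymptotically invariant
  under K_theta / r at rate 1 / sqrt t, without any aperiodicity, which forces convergence to the
  Perron projection. Both iterated limits are therefore the Perron measure at lambda_0.
*)

theory Submission
  imports Defs
begin

section \<open>Perron eigenvectors of reversible kernels\<close>

text \<open>For a holding time tau, exponential of rate 1, theta = E exp (- lambda tau) carries the
  whole influence of lambda: by memorylessness the survival of a sum of holding times factorises. It
  maps [0, infinity] continuously into [0, 1], so the endpoints of lambda need no separate limit,
  and the series for K_theta converges uniformly because it converges at theta = 1. Two obstacles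
  shape the linear algebra. A kernel may be periodic, for instance p on a two-point R with zero
  diagonal at theta = 0, and then its rescaled powers do not converge. And the spectral radius is
  defined through complex eigenvalues. Detailed balance turns the Perron left eigenvector nu into a
  positive right eigenvector nu / m; pairing with these two vectors bounds all complex eigenvalues,
  fixes the eigenvalue of every nonnegative left eigenvector, and keeps the rescaled powers bounded.
  On the probabilistic side, the return to R and the local time t are two instances of one scheme: a
  step of interest whose weight depends on the earlier steps only through their numbers inside and
  outside R. That such a step exists almost surely is read off from its total mass 1 without
  killing.\<close>

definition left_act :: "'a set \<Rightarrow> ('a \<Rightarrow> 'a \<Rightarrow> real) \<Rightarrow> ('a \<Rightarrow> real) \<Rightarrow> 'a \<Rightarrow> real" where
  "left_act A K v y = (\<Sum>x\<in>A. v x * K x y)"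

text \<open>Zeros spread backwards along positive entries: a vanishing sum of nonnegative terms
  \<open>w x * K x v\<close> forces \<open>w u = 0\<close> whenever \<open>K u v > 0\<close>, and
  irreducibility reaches every state.\<close>

lemma left_eigenvector_eq_0:
  fixes K :: "'a::finite \<Rightarrow> 'a \<Rightarrow> real"
  assumes irr: "irreducible_on A K" and K: "\<And>x y. x \<in> A \<Longrightarrow> y \<in> A \<Longrightarrow> 0 \<le> K x y"
    and w: "\<And>x. x \<in> A \<Longrightarrow> 0 \<le> w x" and eig: "\<And>y. y \<in> A \<Longrightarrow> left_act A K w y = r * w y"
    and x0: "x0 \<in> A" "w x0 = 0" and x: "x \<in> A"
  shows "w x = 0"
proof -
  have "(x, x0) \<in> {(u, v). u \<in> A \<and> v \<in> A \<and> K u v > 0}\<^sup>*"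
    using irr x x0 by (auto simp: irreducible_on_def)
  then show ?thesis
  proof (induction rule: converse_rtrancl_induct)
    case base
    show ?case by (fact x0)
  next
    case (step u v)
    then have uv: "u \<in> A" "v \<in> A" "K u v > 0" "w v = 0" by auto
    have "(\<Sum>x\<in>A. w x * K x v) = 0" using eig[of v] uv by (simp add: left_act_def)
    then have "w u * K u v = 0"
      using uv w K by (subst (asm) sum_nonneg_eq_0_iff) auto
    then show ?case using uv by simp
  qed
qed

text \<open>Subtracting from \<open>g\<close> the largest multiple of \<open>\<nu>\<close> that
  stays below it leaves a nonnegative eigenvector with a zero, which therefore vanishes on
  \<open>A\<close>.\<close>

lemma left_eigenvector_unique:
  fixes K :: "'a::finite \<Rightarrow> 'a \<Rightarrow> real"
  assumes irr: "irreducible_on A K" and K: "\<And>x y. x \<in> A \<Longrightarrow> y \<in> A \<Longrightarrow> 0 \<le> K x y"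
    and \<nu>: "\<And>x. x \<in> A \<Longrightarrow> 0 < \<nu> x" and eig\<nu>: "\<And>y. y \<in> A \<Longrightarrow> left_act A K \<nu> y = r * \<nu> y"
    and eig: "\<And>y. y \<in> A \<Longrightarrow> left_act A K g y = r * g y"
  obtains c where "\<And>x. x \<in> A \<Longrightarrow> g x = c * \<nu> x"
proof (cases "A = {}")
  case True
  then show ?thesis using that by auto
next
  case False
  obtain x0 where x0: "x0 \<in> A" "\<And>x. x \<in> A \<Longrightarrow> g x0 / \<nu> x0 \<le> g x / \<nu> x"
    using ex_is_arg_min_if_finite[of A "\<lambda>x. g x / \<nu> x"] False
    by (auto simp: is_arg_min_linorder)
  define c where "c = g x0 / \<nu> x0"
  have "g x - c * \<nu> x = 0" if "x \<in> A" for x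
  proof (rule left_eigenvector_eq_0[where A=A and K=K and r=r and w="\<lambda>x. g x - c * \<nu> x", OF irr K])
    show "0 \<le> g x - c * \<nu> x" if "x \<in> A" for x
      using x0(2)[OF that] \<nu>[OF that] by (simp add: c_def field_simps)
    show "left_act A K (\<lambda>x. g x - c * \<nu> x) y = r * (g y - c * \<nu> y)" if "y \<in> A" for y
    proof -
      have "left_act A K (\<lambda>x. g x - c * \<nu> x) y = left_act A K g y - c * left_act A K \<nu> y"
        by (simp add: left_act_def left_diff_distrib sum_subtractf mult.assoc sum_distrib_left)
      then show ?thesis using eig[OF that] eig\<nu>[OF that] by (simp add: algebra_simps)
    qed
    show "g x0 - c * \<nu> x0 = 0" using \<nu>[OF x0(1)] by (simp add: c_def)
  qed (use x0 that in auto)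
  then show ?thesis using that[of c] by simp
qed

text \<open>The probability measures on \<open>A\<close> as vectors of \<open>real^'a\<close>, so
  that compactness arguments and Brouwer's theorem apply to them.\<close>

definition simplex_on :: "'a set \<Rightarrow> (real^'a::finite) set" where
  "simplex_on A = {v. (\<forall>i. 0 \<le> v $ i) \<and> (\<forall>i\<in>-A. v $ i = 0) \<and> (\<Sum>i\<in>UNIV. v $ i) = 1}"

lemma closed_simplex_on: "closed (simplex_on A)"
proof -
  have "simplex_on A = (\<Inter>i. {v. 0 \<le> v $ i}) \<inter> (\<Inter>i\<in>-A. {v. v $ i = 0}) \<inter> {v. (\<Sum>i\<in>UNIV. v $ i) = 1}"
    by (auto simp: simplex_on_def)
  then show ?thesis
    by (auto intro!: closed_Int closed_INT closed_Collect_le closed_Collect_eq continuous_intros)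
qed

lemma compact_simplex_on: "compact (simplex_on A)"
proof -
  have "bounded (simplex_on A)"
    unfolding bounded_iff
  proof (intro exI ballI)
    fix v :: "real^'a" assume "v \<in> simplex_on A"
    then show "norm v \<le> 1"
      using norm_le_l1_cart[of v] by (auto simp: simplex_on_def)
  qed
  with closed_simplex_on show ?thesis by (simp add: compact_eq_bounded_closed)
qed

lemma convex_simplex_on: "convex (simplex_on A)"
  by (rule convexI) (auto simp: simplex_on_def sum.distrib simp flip: sum_distrib_left)

lemma sum_simplex_on: "v \<in> simplex_on A \<Longrightarrow> (\<Sum>i\<in>A. v $ i) = 1"
  by (subst sum.mono_neutral_left[of UNIV A]) (auto simp: simplex_on_def)

lemma perron_left_eigenvector:
  fixes K :: "'a::finite \<Rightarrow> 'a \<Rightarrow> real"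
  assumes irr: "irreducible_on A K" and K: "\<And>x y. x \<in> A \<Longrightarrow> y \<in> A \<Longrightarrow> 0 \<le> K x y"
    and ne: "A \<noteq> {}"
  obtains \<nu> r where "\<And>x. x \<in> A \<Longrightarrow> 0 < \<nu> x" "(\<Sum>x\<in>A. \<nu> x) = 1" "0 \<le> r"
    "\<And>y. y \<in> A \<Longrightarrow> left_act A K \<nu> y = r * \<nu> y"
proof -
  \<comment> \<open>The identity is added to \<open>K\<close> so that the normalising factor cannot vanish.\<close>
  define N where "N v = 1 + (\<Sum>y\<in>A. left_act A K (($) v) y)" for v :: "real^'a"
  define f where "f v = (\<chi> y. if y \<in> A then (v $ y + left_act A K (($) v) y) / N v else 0)" for v
  have act0: "0 \<le> left_act A K (($) v) y" if "v \<in> simplex_on A" "y \<in> A" for v y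
    using that K by (auto simp: left_act_def simplex_on_def intro!: sum_nonneg)
  have N: "1 \<le> N v" if "v \<in> simplex_on A" for v
    using act0[OF that] by (auto simp: N_def intro!: sum_nonneg)
  have cont: "continuous_on (simplex_on A) f"
    unfolding f_def
  proof (rule continuous_on_vec_lambda)
    fix y
    have "\<And>v. v \<in> simplex_on A \<Longrightarrow> N v \<noteq> 0" using N by fastforce
    then show "continuous_on (simplex_on A)
        (\<lambda>v. if y \<in> A then (v $ y + left_act A K (($) v) y) / N v else 0)"
      by (cases "y \<in> A") (auto simp: N_def left_act_def intro!: continuous_intros)
  qed
  have maps: "f v \<in> simplex_on A" if v: "v \<in> simplex_on A" for v
  proof -
    have "(\<Sum>y\<in>UNIV. f v $ y) = (\<Sum>y\<in>A. (v $ y + left_act A K (($) v) y) / N v)"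
      by (subst sum.mono_neutral_right[of UNIV A]) (auto simp: f_def)
    also have "\<dots> = 1"
      using N[OF v] sum_simplex_on[OF v]
      by (simp add: sum.distrib N_def flip: sum_divide_distrib)
    finally show ?thesis
      using act0[OF v] N[OF v] v by (auto simp: simplex_on_def f_def)
  qed
  obtain a where a: "a \<in> A" using ne by auto
  have "axis a 1 \<in> simplex_on A" using a by (auto simp: simplex_on_def axis_def)
  then have "simplex_on A \<noteq> {}" by auto
  then obtain v where v: "v \<in> simplex_on A" "f v = v"
    using brouwer[OF compact_simplex_on convex_simplex_on _ cont] maps by blast
  \<comment> \<open>On \<open>A\<close> a fixed point satisfies \<open>v + v K = N v * v\<close>;
    removing the identity leaves the eigenvalue \<open>N v - 1\<close>, which is nonnegative because
    \<open>N v\<close> is at least 1.\<close>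
  define r where "r = N v - 1"
  have eig: "left_act A K (($) v) y = r * v $ y" if "y \<in> A" for y
  proof -
    have "v $ y = (v $ y + left_act A K (($) v) y) / N v"
      using that arg_cong[OF v(2), of "\<lambda>w. w $ y"] by (simp add: f_def)
    then show ?thesis using N[OF v(1)] by (simp add: r_def field_simps)
  qed
  show ?thesis
  proof (rule that[of "($) v" r])
    show "0 < v $ x" if x: "x \<in> A" for x
    proof (rule ccontr)
      assume "\<not> 0 < v $ x"
      then have "v $ x = 0" using v by (auto simp: simplex_on_def intro: antisym)
      then have "v $ y = 0" if "y \<in> A" for y
        using left_eigenvector_eq_0[of A K "($) v" r x y] irr K eig x that v
        by (auto simp: simplex_on_def)
      then show False using sum_simplex_on[OF v(1)] by simp
    qed
  qed (use eig sum_simplex_on[OF v(1)] N[OF v(1)] in \<open>auto simp: r_def\<close>)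
qed

text \<open>Pairing with the positive right eigenvector \<open>f\<close>: the number
  \<open>w K f\<close> is both \<open>r'\<close> times and \<open>r\<close> times the pairing of
  \<open>w\<close> with \<open>f\<close>, which is positive.\<close>

lemma left_eigenvalue_unique:
  fixes K :: "'a::finite \<Rightarrow> 'a \<Rightarrow> real"
  assumes f: "\<And>x. x \<in> A \<Longrightarrow> 0 < f x" and eigf: "\<And>x. x \<in> A \<Longrightarrow> (\<Sum>y\<in>A. K x y * f y) = r * f x"
    and w: "\<And>x. x \<in> A \<Longrightarrow> 0 \<le> w x" "(\<Sum>x\<in>A. w x) = 1"
    and eig: "\<And>y. y \<in> A \<Longrightarrow> left_act A K w y = r' * w y"
  shows "r' = r"
proof -
  have "r' * (\<Sum>y\<in>A. w y * f y) = (\<Sum>y\<in>A. left_act A K w y * f y)"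
    using eig by (simp add: sum_distrib_left mult_ac)
  also have "\<dots> = (\<Sum>x\<in>A. w x * (\<Sum>y\<in>A. K x y * f y))"
    unfolding left_act_def sum_distrib_left sum_distrib_right
    by (subst sum.swap) (simp add: mult_ac)
  also have "\<dots> = r * (\<Sum>y\<in>A. w y * f y)"
    using eigf by (simp add: sum_distrib_left mult_ac)
  finally have "r' * (\<Sum>y\<in>A. w y * f y) = r * (\<Sum>y\<in>A. w y * f y)" .
  moreover have "(\<Sum>y\<in>A. w y * f y) > 0"
  proof -
    obtain a where "a \<in> A" "w a \<noteq> 0" using w(2) by (metis sum.neutral zero_neq_one)
    then show ?thesis
      using w(1) f by (intro sum_pos2[of A a]) (auto simp: less_le)
  qed
  ultimately show ?thesis by simp
qed

text \<open>The right eigenvector \<open>f\<close> shows that \<open>r\<close> is attained. For a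
  complex eigenpair, \<open>|z| |v| \<le> K |v|\<close> holds entrywise, and pairing with the
  positive left eigenvector \<open>\<nu>\<close> gives \<open>|z| \<le> r\<close>.\<close>

lemma kernel_spectral_radius_eqI:
  fixes K :: "'a::finite \<Rightarrow> 'a \<Rightarrow> real"
  assumes K: "\<And>x y. x \<in> A \<Longrightarrow> y \<in> A \<Longrightarrow> 0 \<le> K x y" and ne: "A \<noteq> {}"
    and \<nu>: "\<And>x. x \<in> A \<Longrightarrow> 0 < \<nu> x" and eig\<nu>: "\<And>y. y \<in> A \<Longrightarrow> left_act A K \<nu> y = r * \<nu> y"
    and r: "0 \<le> r"
    and f: "\<And>x. x \<in> A \<Longrightarrow> 0 < f x" and eigf: "\<And>x. x \<in> A \<Longrightarrow> (\<Sum>y\<in>A. K x y * f y) = r * f x"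
  shows "kernel_spectral_radius A K = r"
proof -
  have "of_real r \<in> kernel_spectrum A K"
    unfolding kernel_spectrum_def
  proof (intro CollectI exI conjI ballI)
    show "\<exists>x\<in>A. complex_of_real (f x) \<noteq> 0" using ne f by fastforce
    show "(\<Sum>y\<in>A. complex_of_real (K x y) * of_real (f y)) = of_real r * of_real (f x)"
      if "x \<in> A" for x using eigf[OF that] by (simp flip: of_real_mult of_real_sum)
  qed
  then have mem: "r \<in> cmod ` kernel_spectrum A K"
    using r by (intro image_eqI[of _ _ "of_real r"]) auto
  have "cmod z \<le> r" if "z \<in> kernel_spectrum A K" for z
  proof -
    from that obtain v where v: "\<exists>x\<in>A. v x \<noteq> 0"
        "\<And>x. x \<in> A \<Longrightarrow> (\<Sum>y\<in>A. complex_of_real (K x y) * v y) = z * v x"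
      by (auto simp: kernel_spectrum_def)
    have "cmod z * (\<Sum>x\<in>A. \<nu> x * cmod (v x)) = (\<Sum>x\<in>A. \<nu> x * cmod (z * v x))"
      by (simp add: sum_distrib_left norm_mult mult_ac)
    also have "\<dots> \<le> (\<Sum>x\<in>A. \<nu> x * (\<Sum>y\<in>A. K x y * cmod (v y)))"
    proof (intro sum_mono mult_left_mono)
      fix x assume x: "x \<in> A"
      show "cmod (z * v x) \<le> (\<Sum>y\<in>A. K x y * cmod (v y))"
        unfolding v(2)[OF x, symmetric] using K[OF x]
        by (intro order_trans[OF norm_sum] sum_mono) (simp add: norm_mult)
      show "0 \<le> \<nu> x" using \<nu>[OF x] by simp
    qed
    also have "\<dots> = (\<Sum>y\<in>A. left_act A K \<nu> y * cmod (v y))"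
      unfolding left_act_def sum_distrib_left sum_distrib_right
      by (subst sum.swap) (simp add: mult_ac)
    also have "\<dots> = r * (\<Sum>x\<in>A. \<nu> x * cmod (v x))"
      using eig\<nu> by (simp add: sum_distrib_left mult_ac)
    finally have "cmod z * (\<Sum>x\<in>A. \<nu> x * cmod (v x)) \<le> r * (\<Sum>x\<in>A. \<nu> x * cmod (v x))" .
    moreover have "(\<Sum>x\<in>A. \<nu> x * cmod (v x)) > 0"
    proof -
      obtain a where "a \<in> A" "v a \<noteq> 0" using v(1) by auto
      then show ?thesis using \<nu> by (intro sum_pos2[of A a]) (auto simp: less_imp_le)
    qed
    ultimately show ?thesis by simp
  qed
  then show ?thesis
    unfolding kernel_spectral_radius_def by (intro cSup_eq_maximum mem) auto
qed

lemma pmf_eqI_on: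
  assumes "set_pmf p \<subseteq> A" "set_pmf q \<subseteq> A" "\<And>x. x \<in> A \<Longrightarrow> pmf p x = pmf q x"
  shows "p = q"
proof (rule pmf_eqI)
  fix x
  show "pmf p x = pmf q x"
    using assms by (cases "x \<in> A") (metis, metis pmf_eq_0_set_pmf subset_iff)
qed

lemma sum_pmf_eq_1_on:
  fixes p :: "'a::finite pmf"
  shows "set_pmf p \<subseteq> A \<Longrightarrow> (\<Sum>x\<in>A. pmf p x) = 1"
  by (rule sum_pmf_eq_1) auto

locale reversible_kernel =
  fixes A :: "'a::finite set" and K :: "'a \<Rightarrow> 'a \<Rightarrow> real" and m :: "'a \<Rightarrow> real"
  assumes ne: "A \<noteq> {}" and nonneg: "\<And>x y. x \<in> A \<Longrightarrow> y \<in> A \<Longrightarrow> 0 \<le> K x y"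
    and irr: "irreducible_on A K" and m_pos: "\<And>x. x \<in> A \<Longrightarrow> 0 < m x"
    and rev: "\<And>x y. x \<in> A \<Longrightarrow> y \<in> A \<Longrightarrow> m x * K x y = m y * K y x"
begin

text \<open>By detailed balance, division by \<open>m\<close> intertwines the left and the right
  action of \<open>K\<close>.\<close>

lemma right_eigenvector:
  assumes "\<And>y. y \<in> A \<Longrightarrow> left_act A K \<nu> y = r * \<nu> y" "x \<in> A"
  shows "(\<Sum>y\<in>A. K x y * (\<nu> y / m y)) = r * (\<nu> x / m x)"
proof -
  have "(\<Sum>y\<in>A. K x y * (\<nu> y / m y)) = (\<Sum>y\<in>A. \<nu> y * K y x / m x)"
  proof (rule sum.cong)
    fix y assume "y \<in> A"
    then show "K x y * (\<nu> y / m y) = \<nu> y * K y x / m x"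
      using rev[of x y] m_pos[of x] m_pos[of y] assms(2) by (simp add: field_simps)
  qed simp
  also have "\<dots> = left_act A K \<nu> x / m x" by (simp add: left_act_def sum_divide_distrib)
  finally show ?thesis using assms by simp
qed

text \<open>The last clause admits an arbitrary eigenvalue \<open>r'\<close>: among the probability
  measures on \<open>A\<close> the eigenvector equation alone identifies \<open>\<nu>\<close>, so
  later identifications never compute a spectral radius.\<close>

lemma perron_measure_props:
  obtains \<nu> r where "set_pmf \<nu> = A" "0 \<le> r" "\<And>y. y \<in> A \<Longrightarrow> left_act A K (pmf \<nu>) y = r * pmf \<nu> y"
    "perron_measure A K = \<nu>"
    "\<And>\<nu>' r'. set_pmf \<nu>' \<subseteq> A \<Longrightarrow> (\<And>y. y \<in> A \<Longrightarrow> left_act A K (pmf \<nu>') y = r' * pmf \<nu>' y) \<Longrightarrow> \<nu>' = \<nu>"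
proof -
  obtain \<nu>0 r where \<nu>0: "\<And>x. x \<in> A \<Longrightarrow> 0 < \<nu>0 x" "(\<Sum>x\<in>A. \<nu>0 x) = 1" "0 \<le> r"
    "\<And>y. y \<in> A \<Longrightarrow> left_act A K \<nu>0 y = r * \<nu>0 y"
    using perron_left_eigenvector[OF irr nonneg ne] by blast
  define \<nu> where "\<nu> = embed_pmf (\<lambda>x. if x \<in> A then \<nu>0 x else 0)"
  have pmf\<nu>: "pmf \<nu> x = (if x \<in> A then \<nu>0 x else 0)" for x
    unfolding \<nu>_def
  proof (rule pmf_embed_pmf)
    have "(\<Sum>x\<in>UNIV. ennreal (if x \<in> A then \<nu>0 x else 0)) = ennreal (\<Sum>x\<in>A. \<nu>0 x)"
      using \<nu>0(1) by (subst sum_ennreal) (auto simp: less_imp_le if_distrib sum.If_cases)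
    then show "(\<integral>\<^sup>+ x. ennreal (if x \<in> A then \<nu>0 x else 0) \<partial>count_space UNIV) = 1"
      using \<nu>0(2) by (simp add: nn_integral_count_space_finite)
  qed (use \<nu>0(1) in \<open>auto simp: less_imp_le\<close>)
  have set: "set_pmf \<nu> = A"
    using \<nu>0(1) by (force simp: set_pmf_eq pmf\<nu>)
  have eig: "left_act A K (pmf \<nu>) y = r * pmf \<nu> y" if "y \<in> A" for y
    using \<nu>0(4)[OF that] that by (simp add: left_act_def pmf\<nu>)
  have pos: "\<And>x. x \<in> A \<Longrightarrow> 0 < pmf \<nu> x" using \<nu>0(1) by (simp add: pmf\<nu>)
  have f: "\<And>x. x \<in> A \<Longrightarrow> 0 < pmf \<nu> x / m x" using pos m_pos by auto
  have eigf: "\<And>x. x \<in> A \<Longrightarrow> (\<Sum>y\<in>A. K x y * (pmf \<nu> y / m y)) = r * (pmf \<nu> x / m x)"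
    using right_eigenvector eig by blast
  have rad: "kernel_spectral_radius A K = r"
    by (rule kernel_spectral_radius_eqI[OF nonneg ne pos eig \<nu>0(3) f eigf])
  have uniq: "\<nu>' = \<nu>" if \<nu>': "set_pmf \<nu>' \<subseteq> A"
    "\<And>y. y \<in> A \<Longrightarrow> left_act A K (pmf \<nu>') y = r' * pmf \<nu>' y" for \<nu>' r'
  proof -
    have "r' = r"
      by (rule left_eigenvalue_unique[OF f eigf, where w="pmf \<nu>'"])
        (use \<nu>' sum_pmf_eq_1_on in auto)
    then obtain c where c: "\<And>x. x \<in> A \<Longrightarrow> pmf \<nu>' x = c * pmf \<nu> x"
      using left_eigenvector_unique[OF irr nonneg pos eig] \<nu>'(2) by blast
    have "1 = c * 1"
      using sum_pmf_eq_1_on[OF \<nu>'(1)] sum_pmf_eq_1_on[of \<nu> A] set c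
      by (simp flip: sum_distrib_left)
    then show ?thesis using pmf_eqI_on[OF \<nu>'(1)] set c by auto
  qed
  have "perron_measure A K = \<nu>"
    unfolding perron_measure_def rad
  proof (rule the_equality)
    show "set_pmf \<nu> \<subseteq> A \<and> (\<forall>y\<in>A. (\<Sum>x\<in>A. pmf \<nu> x * K x y) = r * pmf \<nu> y)"
      using set eig by (auto simp: left_act_def)
    show "\<nu>' = \<nu>" if "set_pmf \<nu>' \<subseteq> A \<and> (\<forall>y\<in>A. (\<Sum>x\<in>A. pmf \<nu>' x * K x y) = r * pmf \<nu>' y)" for \<nu>'
      using that uniq[of \<nu>' r] by (auto simp: left_act_def)
  qed
  then show ?thesis using that[OF set \<nu>0(3) eig] uniq by blast
qed

lemma perron_measure_eqI:
  assumes "set_pmf \<nu> \<subseteq> A" "\<And>y. y \<in> A \<Longrightarrow> left_act A K (pmf \<nu>) y = r * pmf \<nu> y"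
  shows "perron_measure A K = \<nu>"
  using assms perron_measure_props by metis

end

lemma perron_measure_cong:
  assumes "\<And>x y. x \<in> A \<Longrightarrow> y \<in> A \<Longrightarrow> K x y = K' x y"
  shows "perron_measure A K = perron_measure A K'"
proof -
  have "kernel_spectrum A K = kernel_spectrum A K'"
    using assms by (simp add: kernel_spectrum_def)
  then show ?thesis
    using assms by (simp add: perron_measure_def kernel_spectral_radius_def)
qed

text \<open>Uniqueness of the eigenvector describes the graph of the Perron measure as a zero set of
  continuous functions on the product of \<open>T\<close> with the simplex; a map into a compact set
  with closed graph is continuous.\<close>

lemma continuous_on_perron_measure:
  fixes K :: "real \<Rightarrow> 'a::finite \<Rightarrow> 'a \<Rightarrow> real"
  assumes rk: "\<And>\<theta>. \<theta> \<in> T \<Longrightarrow> reversible_kernel A (K \<theta>) m"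
    and cont: "\<And>x y. x \<in> A \<Longrightarrow> y \<in> A \<Longrightarrow> continuous_on T (\<lambda>\<theta>. K \<theta> x y)"
  shows "continuous_on T (\<lambda>\<theta>. pmf (perron_measure A (K \<theta>)) y)"
proof -
  define F where "F \<theta> = (\<chi> i. pmf (perron_measure A (K \<theta>)) i)" for \<theta>
  have F: "F \<theta> \<in> simplex_on A"
    and eigF: "\<exists>r. \<forall>y\<in>A. left_act A (K \<theta>) (($) (F \<theta>)) y = r * F \<theta> $ y" if "\<theta> \<in> T" for \<theta>
  proof -
    interpret reversible_kernel A "K \<theta>" m by (rule rk[OF that])
    obtain \<nu> r where \<nu>: "set_pmf \<nu> = A" "\<And>y. y \<in> A \<Longrightarrow> left_act A (K \<theta>) (pmf \<nu>) y = r * pmf \<nu> y"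
      "perron_measure A (K \<theta>) = \<nu>"
      using perron_measure_props by metis
    show "F \<theta> \<in> simplex_on A"
      using \<nu> sum_pmf_eq_1_on[of \<nu> UNIV] by (auto simp: simplex_on_def F_def set_pmf_eq)
    show "\<exists>r. \<forall>y\<in>A. left_act A (K \<theta>) (($) (F \<theta>)) y = r * F \<theta> $ y"
      using \<nu>(2,3) by (auto simp: F_def left_act_def)
  qed
  \<comment> \<open>Summing the eigenvalue equation over \<open>A\<close> expresses the eigenvalue through the vector.\<close>
  define G where "G \<theta> v y = left_act A (K \<theta>) (($) v) y - (\<Sum>z\<in>A. left_act A (K \<theta>) (($) v) z) * v $ y"
    for \<theta> y and v :: "real^'a"
  have graph: "(\<lambda>\<theta>. (\<theta>, F \<theta>)) ` T
      = (T \<times> simplex_on A) \<inter> (\<Inter>y\<in>A. (T \<times> simplex_on A) \<inter> (\<lambda>z. G (fst z) (snd z) y) -` {0})"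
    (is "?L = ?R")
  proof (intro set_eqI iffI)
    fix z assume "z \<in> ?L"
    then obtain \<theta> where z: "z = (\<theta>, F \<theta>)" "\<theta> \<in> T" by auto
    obtain r where r: "\<forall>y\<in>A. left_act A (K \<theta>) (($) (F \<theta>)) y = r * F \<theta> $ y" using eigF z by blast
    have "(\<Sum>y\<in>A. left_act A (K \<theta>) (($) (F \<theta>)) y) = r"
      using r sum_simplex_on[OF F[OF z(2)]] by (simp flip: sum_distrib_left)
    then show "z \<in> ?R" using z F r by (auto simp: G_def)
  next
    fix z assume z: "z \<in> ?R"
    then obtain \<theta> v where zz: "z = (\<theta>, v)" "\<theta> \<in> T" "v \<in> simplex_on A" "\<And>y. y \<in> A \<Longrightarrow> G \<theta> v y = 0"
      by (auto split: if_splits)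
    interpret reversible_kernel A "K \<theta>" m by (rule rk[OF zz(2)])
    define \<nu> where "\<nu> = embed_pmf (($) v)"
    have pmf\<nu>: "pmf \<nu> x = v $ x" for x
      unfolding \<nu>_def using zz(3)
      by (intro pmf_embed_pmf) (auto simp: simplex_on_def nn_integral_count_space_finite)
    have "perron_measure A (K \<theta>) = \<nu>"
    proof (rule perron_measure_eqI)
      show "set_pmf \<nu> \<subseteq> A" using zz(3) by (auto simp: set_pmf_eq pmf\<nu> simplex_on_def)
      show "left_act A (K \<theta>) (pmf \<nu>) y = (\<Sum>y\<in>A. left_act A (K \<theta>) (($) v) y) * pmf \<nu> y" if "y \<in> A" for y
        using zz(4)[OF that] by (simp add: G_def pmf\<nu> left_act_def)
    qed
    then have "F \<theta> = v" by (simp add: F_def pmf\<nu> vec_eq_iff)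
    then show "z \<in> ?L" using zz by auto
  qed
  have cK: "continuous_on (T \<times> simplex_on A) (\<lambda>z. K (fst z) x y)" if "x \<in> A" "y \<in> A" for x y
    by (rule continuous_on_compose2[OF cont[OF that]]) (auto intro!: continuous_intros)
  have closed_eq: "closedin (top_of_set (T \<times> simplex_on A))
      ((T \<times> simplex_on A) \<inter> (\<lambda>z. G (fst z) (snd z) y) -` {0})" if "y \<in> A" for y
  proof (rule continuous_closedin_preimage)
    show "continuous_on (T \<times> simplex_on A) (\<lambda>z. G (fst z) (snd z) y)"
      unfolding G_def left_act_def using that by (intro continuous_intros cK) auto
  qed simp
  have "closedin (top_of_set (T \<times> simplex_on A)) ((\<lambda>\<theta>. (\<theta>, F \<theta>)) ` T)"
  \<comment> \<open>The intersection over \<open>A\<close> needs a nonempty index set, and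
    \<open>A\<close> is known to be nonempty as soon as \<open>T\<close> contains a
    parameter.\<close>
  proof (cases "T = {}")
    case False
    then have "A \<noteq> {}" using rk reversible_kernel.ne by fastforce
    then show ?thesis unfolding graph by (intro closedin_Int closedin_INT closed_eq) auto
  qed simp
  then have "continuous_on T F"
    using continuous_closed_graph_eq[OF compact_simplex_on[of A], of F T] F by auto
  then have "continuous_on T (\<lambda>\<theta>. F \<theta> $ y)" by (intro continuous_intros)
  then show ?thesis by (simp add: F_def)
qed

section \<open>Poisson mixtures of the powers of a kernel\<close>

definition poisson_weight :: "real \<Rightarrow> nat \<Rightarrow> real" where
  "poisson_weight s n = exp (- s) * s ^ n / fact n"

lemma poisson_weight_nonneg: "0 \<le> s \<Longrightarrow> 0 \<le> poisson_weight s n"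
  by (simp add: poisson_weight_def)

lemma poisson_weight_sums: "poisson_weight s sums 1"
proof -
  have "(\<lambda>n. exp (- s) * (s ^ n /\<^sub>R fact n)) sums (exp (- s) * exp s)"
    by (intro sums_mult exp_converges)
  then show ?thesis
    by (simp add: poisson_weight_def[abs_def] exp_minus scaleR_conv_of_real field_simps)
qed

lemma poisson_weight_Suc: "poisson_weight s (Suc n) * real (Suc n) = s * poisson_weight s n"
  by (simp add: poisson_weight_def field_simps del: of_nat_Suc)

text \<open>For N Poisson with mean s this is the Stein-Chen identity E (N a(N)) = s E a(N +
  1).\<close>

lemma poisson_weight_shift_sums:
  assumes "(\<lambda>n. poisson_weight s n * a (Suc n)) sums l"
  shows "(\<lambda>n. poisson_weight s n * (real n * a n)) sums (s * l)"
proof -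
  have "(\<lambda>n. poisson_weight s (Suc n) * (real (Suc n) * a (Suc n))) sums (s * l)"
    using sums_mult[OF assms, of s] by (simp only: mult.assoc[symmetric] poisson_weight_Suc)
  from sums_Suc[OF this] show ?thesis by simp
qed

lemma poisson_mean_sums: "(\<lambda>n. poisson_weight s n * real n) sums s"
  using poisson_weight_shift_sums[of s "\<lambda>_. 1" 1] poisson_weight_sums by simp

lemma poisson_variance_sums:
  assumes "s > 0"
  shows "(\<lambda>n. poisson_weight s n * (real n / s - 1)\<^sup>2) sums (1 / s)"
proof -
  \<comment> \<open>The identity with \<open>a n = real n\<close> gives E N^2 = s E (N + 1).\<close>
  have "(\<lambda>n. poisson_weight s n * (real n * real n)) sums (s * (s + 1))"
  proof (rule poisson_weight_shift_sums)
    show "(\<lambda>n. poisson_weight s n * real (Suc n)) sums (s + 1)"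
      using sums_add[OF poisson_mean_sums[of s] poisson_weight_sums[of s]] by (simp add: algebra_simps)
  qed
  then have "(\<lambda>n. poisson_weight s n * (real n * real n) / s\<^sup>2 - 2 * (poisson_weight s n * real n) / s
      + poisson_weight s n) sums (s * (s + 1) / s\<^sup>2 - 2 * s / s + 1)"
    by (intro sums_add sums_diff sums_divide sums_mult poisson_mean_sums poisson_weight_sums)
  moreover have "s * (s + 1) / s\<^sup>2 - 2 * s / s + 1 = 1 / s"
    using assms by (simp add: field_simps power2_eq_square)
  moreover have "poisson_weight s n * (real n * real n) / s\<^sup>2 - 2 * (poisson_weight s n * real n) / s
      + poisson_weight s n = poisson_weight s n * (real n / s - 1)\<^sup>2" for n
    using assms by (simp add: field_simps power2_eq_square)
  ultimately show ?thesis by simp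
qed

lemma summable_poisson_bounded:
  assumes "0 \<le> s" "\<And>n. \<bar>a n\<bar> \<le> C"
  shows "summable (\<lambda>n. poisson_weight s n * a n)"
proof (rule summable_comparison_test')
  show "summable (\<lambda>n. poisson_weight s n * C)"
    using poisson_weight_sums by (intro summable_mult2) (auto simp: sums_iff)
  show "norm (poisson_weight s n * a n) \<le> poisson_weight s n * C" for n
    using assms poisson_weight_nonneg by (auto simp: abs_mult intro!: mult_left_mono)
qed

text \<open>The Poisson weights are slowly varying in total variation, by Cauchy--Schwarz and the variance.\<close>

lemma poisson_shift_le:
  assumes s: "s > 0" and a: "\<And>n. \<bar>a n\<bar> \<le> C"
  shows "\<bar>(\<Sum>n. poisson_weight s n * a (Suc n)) - (\<Sum>n. poisson_weight s n * a n)\<bar> \<le> C / sqrt s"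
proof -
  have C: "0 \<le> C" using a[of 0] by linarith
  note w0 = poisson_weight_nonneg[OF less_imp_le[OF s]]
  have 1: "(\<lambda>n. poisson_weight s n * a (Suc n)) sums (\<Sum>n. poisson_weight s n * a (Suc n))"
    using s a by (intro summable_sums summable_poisson_bounded) auto
  have 2: "(\<lambda>n. poisson_weight s n * a n) sums (\<Sum>n. poisson_weight s n * a n)"
    using s a by (intro summable_sums summable_poisson_bounded) auto
  \<comment> \<open>The Stein-Chen identity turns the shift into a density: E a(N + 1) - E a(N) = E
    ((N / s - 1) a(N)).\<close>
  have "(\<lambda>n. poisson_weight s n * (real n * a n) / s - poisson_weight s n * a n) sums
     (s * (\<Sum>n. poisson_weight s n * a (Suc n)) / s - (\<Sum>n. poisson_weight s n * a n))"
    by (intro sums_diff sums_divide poisson_weight_shift_sums 1 2)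
  then have d: "(\<lambda>n. poisson_weight s n * (real n / s - 1) * a n) sums
     ((\<Sum>n. poisson_weight s n * a (Suc n)) - (\<Sum>n. poisson_weight s n * a n))"
    using s by (simp add: algebra_simps)
  define q where "q = sqrt s"
  have q: "q > 0" "s = q * q" using s by (auto simp: q_def)
  have b: "(\<lambda>n. C / 2 * (poisson_weight s n / q + q * (poisson_weight s n * (real n / s - 1)\<^sup>2)))
      sums (C / 2 * (1 / q + q * (1 / s)))"
    by (intro sums_mult sums_add sums_divide poisson_weight_sums poisson_variance_sums s)
  have le: "norm (poisson_weight s n * (real n / s - 1) * a n)
      \<le> C / 2 * (poisson_weight s n / q + q * (poisson_weight s n * (real n / s - 1)\<^sup>2))" for n
  proof -
    define x where "x = \<bar>real n / s - 1\<bar>"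
    \<comment> \<open>A termwise form of Cauchy-Schwarz: the choice \<open>q = sqrt s\<close>
      balances 1 / q against q times the variance 1 / s of N / s.\<close>
    have "0 \<le> (1 - q * x)\<^sup>2" by simp
    then have "x \<le> (1 / q + q * x\<^sup>2) / 2"
      using q by (simp add: field_simps power2_eq_square)
    then have "poisson_weight s n * x * \<bar>a n\<bar> \<le> poisson_weight s n * ((1 / q + q * x\<^sup>2) / 2) * C"
      using a w0 q(1) by (intro mult_mono mult_nonneg_nonneg) (auto simp: x_def)
    also have "\<dots> = C / 2 * (poisson_weight s n / q + q * (poisson_weight s n * (real n / s - 1)\<^sup>2))"
      by (simp add: x_def field_simps)
    finally show ?thesis using w0 by (simp add: abs_mult x_def)
  qed
  have "norm (\<Sum>n. poisson_weight s n * (real n / s - 1) * a n) \<le> C / 2 * (1 / q + q * (1 / s))"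
    using suminf_le[OF le] summable_comparison_test'[OF sums_summable[OF b] le]
    by (metis (no_types, lifting) b le norm_suminf_le sums_iff)
  also have "\<dots> = C / q" using q by (simp add: field_simps)
  finally show ?thesis using d by (simp add: sums_iff q_def)
qed

primrec kernel_power :: "'a set \<Rightarrow> ('a \<Rightarrow> 'a \<Rightarrow> real) \<Rightarrow> nat \<Rightarrow> 'a \<Rightarrow> 'a \<Rightarrow> real" where
  "kernel_power A K 0 x y = (if x = y then 1 else 0)"
| "kernel_power A K (Suc n) x y = (\<Sum>z\<in>A. K x z * kernel_power A K n z y)"

definition poisson_kernel :: "'a set \<Rightarrow> ('a \<Rightarrow> 'a \<Rightarrow> real) \<Rightarrow> real \<Rightarrow> 'a \<Rightarrow> 'a \<Rightarrow> real" where
  "poisson_kernel A K t x y = (\<Sum>n. poisson_weight t n * kernel_power A K n x y)"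

text \<open>\<open>kernel_power\<close> peels off the first step; this is the version that appends a
  last step.\<close>

lemma left_act_kernel_power:
  fixes A :: "'a::finite set"
  assumes "x \<in> A" "y \<in> A"
  shows "left_act A K (kernel_power A K n x) y = kernel_power A K (Suc n) x y"
  using assms(1)
proof (induction n arbitrary: x)
  case 0
  have "left_act A K (kernel_power A K 0 x) y = (\<Sum>z\<in>A. if x = z then K x y else 0)"
    unfolding left_act_def by (intro sum.cong) auto
  also have "\<dots> = K x y" using 0 by simp
  also have "\<dots> = (\<Sum>z\<in>A. if z = y then K x y else 0)" using assms by simp
  also have "\<dots> = kernel_power A K (Suc 0) x y"
    unfolding kernel_power.simps by (intro sum.cong) auto
  finally show ?case .
next
  case (Suc n)
  have "left_act A K (kernel_power A K (Suc n) x) y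
      = (\<Sum>z\<in>A. K x z * left_act A K (kernel_power A K n z) y)"
    unfolding left_act_def kernel_power.simps sum_distrib_left sum_distrib_right
    by (subst sum.swap) (simp add: mult_ac)
  also have "\<dots> = kernel_power A K (Suc (Suc n)) x y"
    unfolding kernel_power.simps(2)[of A K "Suc n"] using Suc by (intro sum.cong) auto
  finally show ?case .
qed

lemma kernel_power_nonneg:
  assumes "\<And>x y. x \<in> A \<Longrightarrow> y \<in> A \<Longrightarrow> 0 \<le> K x y" "x \<in> A" "y \<in> A"
  shows "0 \<le> kernel_power A K n x y"
  using assms by (induction n arbitrary: x) (auto intro!: sum_nonneg)

lemma kernel_power_right_eigenvector:
  assumes "\<And>x. x \<in> A \<Longrightarrow> (\<Sum>y\<in>A. K x y * f y) = r * f x" "x \<in> A" "finite A"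
  shows "(\<Sum>y\<in>A. kernel_power A K n x y * f y) = r ^ n * f x"
  using assms(2)
proof (induction n arbitrary: x)
  case 0
  have "(\<Sum>y\<in>A. kernel_power A K 0 x y * f y) = (\<Sum>y\<in>A. if x = y then f y else 0)"
    by (intro sum.cong) auto
  then show ?case using 0 assms(3) by simp
next
  case (Suc n)
  have "(\<Sum>y\<in>A. kernel_power A K (Suc n) x y * f y)
      = (\<Sum>z\<in>A. K x z * (\<Sum>y\<in>A. kernel_power A K n z y * f y))"
    unfolding kernel_power.simps sum_distrib_left sum_distrib_right
    by (subst sum.swap) (simp add: mult_ac)
  also have "\<dots> = r ^ n * (\<Sum>z\<in>A. K x z * f z)"
    using Suc by (simp add: sum_distrib_left mult_ac)
  finally show ?case using assms(1)[OF Suc.prems] by simp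
qed

lemma kernel_power_le_1:
  assumes "\<And>x y. x \<in> A \<Longrightarrow> y \<in> A \<Longrightarrow> 0 \<le> K x y" "\<And>x. x \<in> A \<Longrightarrow> (\<Sum>y\<in>A. K x y) \<le> 1"
    and "x \<in> A" "y \<in> A"
  shows "kernel_power A K n x y \<le> 1"
  using assms(3)
proof (induction n arbitrary: x)
  case (Suc n)
  have "kernel_power A K (Suc n) x y \<le> (\<Sum>z\<in>A. K x z * 1)"
    unfolding kernel_power.simps using Suc assms(1,2) by (intro sum_mono mult_left_mono) auto
  also have "\<dots> \<le> 1" using assms(2)[OF Suc.prems] by simp
  finally show ?case .
qed simp

text \<open>The second bound is the summand \<open>n = 0\<close>, no jump up to time
  \<open>t\<close>. It later keeps the normalising sum of the conditioned law away from 0.\<close>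

lemma poisson_kernel_ge:
  assumes "\<And>x y. x \<in> A \<Longrightarrow> y \<in> A \<Longrightarrow> 0 \<le> K x y" "\<And>x. x \<in> A \<Longrightarrow> (\<Sum>y\<in>A. K x y) \<le> 1"
    and "x \<in> A" "y \<in> A" "0 \<le> t"
  shows "0 \<le> poisson_kernel A K t x y" "exp (- t) \<le> poisson_kernel A K t x x"
proof -
  have sm: "summable (\<lambda>n. poisson_weight t n * kernel_power A K n x y)" if "y \<in> A" for y
    using kernel_power_le_1[OF assms(1,2,3) that] kernel_power_nonneg[OF assms(1,3) that] assms(5)
    by (intro summable_poisson_bounded[where C=1]) auto
  show "0 \<le> poisson_kernel A K t x y"
    unfolding poisson_kernel_def
    using kernel_power_nonneg[OF assms(1,3,4)] poisson_weight_nonneg[OF assms(5)]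
    by (intro suminf_nonneg sm assms) auto
  have "poisson_weight t 0 * kernel_power A K 0 x x \<le> poisson_kernel A K t x x"
    unfolding poisson_kernel_def
    using kernel_power_nonneg[OF assms(1,3,3)] poisson_weight_nonneg[OF assms(5)]
      sum_le_suminf[OF sm[OF assms(3)], of "{0}"] by auto
  then show "exp (- t) \<le> poisson_kernel A K t x x" by (simp add: poisson_weight_def)
qed

context reversible_kernel
begin

text \<open>Dividing the n-th power by \<open>r ^ n\<close> keeps its pairing with the right
  eigenvector \<open>f\<close> constant, hence its entries bounded. The Poisson average of these
  rescaled powers is invariant under \<open>K / r\<close> up to O(1 / sqrt t). An injective linear
  map converts this into closeness to the line spanned by \<open>\<nu>\<close>, and the pairing with
  \<open>f\<close> fixes the point on that line.\<close>

lemma poisson_kernel_limit: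
  assumes sub: "\<And>x. x \<in> A \<Longrightarrow> (\<Sum>y\<in>A. K x y) \<le> 1" and x: "x \<in> A" and y: "y \<in> A"
  shows "((\<lambda>t. poisson_kernel A K t x y / (\<Sum>z\<in>A. poisson_kernel A K t x z))
      \<longlongrightarrow> pmf (perron_measure A K) y) at_top"
proof -
  obtain \<nu> r where \<nu>: "set_pmf \<nu> = A" "0 \<le> r" "\<And>y. y \<in> A \<Longrightarrow> left_act A K (pmf \<nu>) y = r * pmf \<nu> y"
    and perron: "perron_measure A K = \<nu>"
    using perron_measure_props by metis
  have pos: "\<And>x. x \<in> A \<Longrightarrow> 0 < pmf \<nu> x" using \<nu>(1) by (metis pmf_positive)
  have sum1: "(\<Sum>x\<in>A. pmf \<nu> x) = 1" using sum_pmf_eq_1_on \<nu>(1) by blast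
  show ?thesis
  proof (cases "r = 0")
    \<comment> \<open>With \<open>r = 0\<close> the kernel vanishes, and irreducibility leaves only
      the singleton \<open>A = {x}\<close>, where the ratio is constantly 1.\<close>
    case True
    have K0: "K u v = 0" if "u \<in> A" "v \<in> A" for u v
    proof -
      have "(\<Sum>x\<in>A. pmf \<nu> x * K x v) = 0" using \<nu>(3)[OF that(2)] True by (simp add: left_act_def)
      then have "pmf \<nu> u * K u v = 0"
        using that nonneg by (subst (asm) sum_nonneg_eq_0_iff) auto
      then show ?thesis using pos[OF that(1)] by simp
    qed
    have E: "{(u, v). u \<in> A \<and> v \<in> A \<and> K u v > 0} = {}" using K0 by auto
    have A: "A = {x}" using irr x unfolding irreducible_on_def E by auto
    have kp: "kernel_power A K n x x = (if n = 0 then 1 else 0)" for n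
      using K0 x by (cases n) (auto simp: A)
    have "poisson_kernel A K t x x = (\<Sum>n\<in>{0}. poisson_weight t n * kernel_power A K n x x)" for t
      unfolding poisson_kernel_def by (rule suminf_finite) (auto simp: kp simp del: kernel_power.simps)
    then have "poisson_kernel A K t x x = exp (- t)" for t
      by (simp add: poisson_weight_def)
    then show ?thesis using y sum1 perron by (simp add: A)
  next
    case False
    then have r: "r > 0" using \<nu>(2) by simp
    define f where "f x = pmf \<nu> x / m x" for x
    have f: "0 < f x" if "x \<in> A" for x using pos m_pos that by (simp add: f_def)
    have eigf: "(\<Sum>y\<in>A. K x y * f y) = r * f x" if "x \<in> A" for x
      using right_eigenvector[OF \<nu>(3)] that by (simp add: f_def)
    define a where "a y n = kernel_power A K n x y / r ^ n" for y n
    have af: "(\<Sum>y\<in>A. a y n * f y) = f x" for n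
      using kernel_power_right_eigenvector[of A K f r x n, OF eigf x] r
      by (simp add: a_def sum_divide_distrib[symmetric])
    have a0: "0 \<le> a y n" if "y \<in> A" for y n
      using kernel_power_nonneg[of A K x y n, OF nonneg x that] r by (simp add: a_def)
    define C where "C = (\<Sum>y\<in>A. f x / f y)"
    have aC: "\<bar>a y n\<bar> \<le> C" if "y \<in> A" for y n
    proof -
      have "a y n * f y \<le> f x"
        unfolding af[of n, symmetric] using that a0 f by (intro member_le_sum) (auto simp: less_imp_le)
      then have "a y n \<le> f x / f y" using f[OF that] by (simp add: field_simps)
      also have "\<dots> \<le> C"
        unfolding C_def using that f x by (intro member_le_sum) (auto simp: less_imp_le)
      finally show ?thesis using a0[OF that] by simp
    qed
    define u where "u t y = (\<Sum>n. poisson_weight (r * t) n * a y n)" for t y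
    have sm: "summable (\<lambda>n. poisson_weight (r * t) n * a y n)"
      "summable (\<lambda>n. poisson_weight (r * t) n * a y (Suc n))" if "y \<in> A" "0 \<le> t" for y t
      using aC[OF that(1)] r that by (auto intro!: summable_poisson_bounded[where C=C])
    \<comment> \<open>The powers of \<open>r\<close> are absorbed into the weights: Poisson(t) times
      r^n is exp (r t - t) times Poisson(r t). The exponential factor cancels in the final
      ratio.\<close>
    have u_pk: "poisson_kernel A K t x y = exp (r * t - t) * u t y" if "y \<in> A" "0 \<le> t" for t y
    proof -
      have "poisson_kernel A K t x y = (\<Sum>n. exp (r * t - t) * (poisson_weight (r * t) n * a y n))"
        unfolding poisson_kernel_def using r
        by (intro suminf_cong) (simp add: poisson_weight_def a_def power_mult_distrib exp_diff exp_minus field_simps)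
      then show ?thesis using sm(1)[OF that] by (simp add: u_def suminf_mult)
    qed
    have uf: "(\<Sum>y\<in>A. u t y * f y) = f x" if "0 \<le> t" for t
    proof -
      have "(\<lambda>n. \<Sum>y\<in>A. poisson_weight (r * t) n * a y n * f y) sums (\<Sum>y\<in>A. u t y * f y)"
        unfolding u_def using sm that by (intro sums_sum sums_mult2 summable_sums) auto
      moreover have "(\<Sum>y\<in>A. poisson_weight (r * t) n * a y n * f y) = poisson_weight (r * t) n * f x" for n
        unfolding af[of n, symmetric] by (simp add: sum_distrib_left mult.assoc)
      ultimately have "(\<lambda>n. poisson_weight (r * t) n * f x) sums (\<Sum>y\<in>A. u t y * f y)" by simp
      moreover have "(\<lambda>n. poisson_weight (r * t) n * f x) sums (1 * f x)"
        by (intro sums_mult2 poisson_weight_sums)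
      ultimately show ?thesis using sums_unique2 by fastforce
    qed
    have uK: "left_act A K (u t) y / r = (\<Sum>n. poisson_weight (r * t) n * a y (Suc n))"
      if "y \<in> A" "0 \<le> t" for t y
    proof -
      have "(\<lambda>n. (\<Sum>z\<in>A. poisson_weight (r * t) n * a z n * K z y) / r) sums (left_act A K (u t) y / r)"
        unfolding u_def left_act_def using sm that
        by (intro sums_divide sums_sum sums_mult2 summable_sums) auto
      moreover have "(\<Sum>z\<in>A. poisson_weight (r * t) n * a z n * K z y) / r
          = poisson_weight (r * t) n * a y (Suc n)" for n
        using left_act_kernel_power[OF x that(1), of K n]
        by (simp add: a_def left_act_def sum_distrib_left sum_divide_distrib mult_ac del: kernel_power.simps
            flip: left_act_kernel_power[OF x that(1)])
      ultimately show ?thesis by (simp add: sums_iff)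
    qed
    \<comment> \<open>The kernel of \<open>I - K / r\<close> is spanned by \<open>\<nu>\<close>;
      adding the rank-one map that sends \<open>G\<close> to its pairing with \<open>f\<close> times
      \<open>\<nu>\<close> makes it injective, since \<open>f\<close> pairs positively with
      \<open>\<nu>\<close>. Off \<open>A\<close> the map is the identity, to be injective on all of
      \<open>real^'a\<close>.\<close>
    define T where "T G = (\<chi> y. if y \<in> A then G $ y - left_act A K (($) G) y / r + (\<Sum>z\<in>A. G $ z * f z) * pmf \<nu> y
        else G $ y)" for G :: "real^'a"
    have lin: "linear T"
      by (rule linearI)
        (auto simp: T_def vec_eq_iff left_act_def sum.distrib algebra_simps add_divide_distrib sum_distrib_left)
    have \<nu>f: "(\<Sum>z\<in>A. pmf \<nu> z * f z) > 0"
      using pos f ne by (intro sum_pos) auto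
    have inj: "inj T"
    proof (subst linear_injective_0[OF lin], intro allI impI)
      fix G :: "real^'a" assume T0: "T G = 0"
      define b where "b = (\<Sum>z\<in>A. G $ z * f z)"
      have out: "G $ y = 0" if "y \<notin> A" for y
        using arg_cong[OF T0, of "\<lambda>v. v $ y"] that by (simp add: T_def)
      have eq: "G $ y - left_act A K (($) G) y / r + b * pmf \<nu> y = 0" if "y \<in> A" for y
        using arg_cong[OF T0, of "\<lambda>v. v $ y"] that by (simp add: T_def b_def)
      have "(\<Sum>y\<in>A. left_act A K (($) G) y * f y) = (\<Sum>z\<in>A. G $ z * (\<Sum>y\<in>A. K z y * f y))"
        unfolding left_act_def sum_distrib_left sum_distrib_right
        by (subst sum.swap) (simp add: mult_ac)
      also have "\<dots> = r * b" using eigf by (simp add: b_def sum_distrib_left mult_ac)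
      finally have Kf: "(\<Sum>y\<in>A. left_act A K (($) G) y * f y) = r * b" .
      \<comment> \<open>Pairing with \<open>f\<close> annihilates \<open>I - K / r\<close> and
        leaves only the rank-one term.\<close>
      have "0 = (\<Sum>y\<in>A. (G $ y - left_act A K (($) G) y / r + b * pmf \<nu> y) * f y)"
        using eq by simp
      also have "\<dots> = b - (\<Sum>y\<in>A. left_act A K (($) G) y * f y) / r + b * (\<Sum>y\<in>A. pmf \<nu> y * f y)"
        by (simp add: b_def sum.distrib sum_subtractf sum_distrib_left sum_divide_distrib algebra_simps)
      finally have "b * (\<Sum>y\<in>A. pmf \<nu> y * f y) = 0" using Kf r by simp
      then have b0: "b = 0" using \<nu>f by simp
      then have eigG: "left_act A K (($) G) y = r * G $ y" if "y \<in> A" for y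
        using eq[OF that] r by (simp add: field_simps)
      then obtain c where c: "\<And>y. y \<in> A \<Longrightarrow> G $ y = c * pmf \<nu> y"
        using left_eigenvector_unique[OF irr nonneg pos \<nu>(3)] by metis
      have "b = c * (\<Sum>z\<in>A. pmf \<nu> z * f z)" using c by (simp add: b_def sum_distrib_left mult_ac)
      then have "c = 0" using b0 \<nu>f by simp
      then show "G = 0" using c out by (simp add: vec_eq_iff) (metis mult_zero_left)
    qed
    obtain B where B: "B > 0" "\<And>G. B * norm G \<le> norm (T G)"
      using linear_inj_bounded_below_pos[OF lin inj] by blast
    \<comment> \<open>This constant gives \<open>c * \<nu>\<close> the same pairing with
      \<open>f\<close> as \<open>u t\<close>. The rank-one part of \<open>T\<close> thus vanishes on
      \<open>D t\<close>, and the Poisson shift bound controls the rest.\<close>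
    define c where "c = f x / (\<Sum>z\<in>A. pmf \<nu> z * f z)"
    define D where "D t = (\<chi> y. if y \<in> A then u t y - c * pmf \<nu> y else 0)" for t
    have TD: "norm (T (D t)) \<le> card A * (C / sqrt (r * t))" if t: "t > 0" for t
    proof -
      have le: "\<bar>T (D t) $ y\<bar> \<le> C / sqrt (r * t)" if "y \<in> A" for y
      proof -
        have "(\<Sum>z\<in>A. D t $ z * f z) = (\<Sum>z\<in>A. u t z * f z) - c * (\<Sum>z\<in>A. pmf \<nu> z * f z)"
          by (simp add: D_def left_diff_distrib sum_subtractf sum_distrib_left mult.assoc)
        also have "\<dots> = 0" using uf[of t] t \<nu>f by (simp add: c_def)
        finally have s0: "(\<Sum>z\<in>A. D t $ z * f z) = 0" .
        have "left_act A K (($) (D t)) y = left_act A K (u t) y - c * left_act A K (pmf \<nu>) y"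
          by (simp add: D_def left_act_def left_diff_distrib sum_subtractf sum_distrib_left mult.assoc)
        then have "T (D t) $ y = u t y - left_act A K (u t) y / r"
          using that r s0 \<nu>(3)[OF that] by (simp add: T_def D_def field_simps)
        then have "T (D t) $ y = u t y - (\<Sum>n. poisson_weight (r * t) n * a y (Suc n))"
          using uK[OF that, of t] t by simp
        then show ?thesis
          using poisson_shift_le[of "r * t" "a y" C, OF _ aC[OF that]] r t
          by (simp add: u_def abs_minus_commute)
      qed
      have "norm (T (D t)) \<le> (\<Sum>y\<in>UNIV. \<bar>T (D t) $ y\<bar>)" by (rule norm_le_l1_cart)
      also have "\<dots> = (\<Sum>y\<in>A. \<bar>T (D t) $ y\<bar>)"
        by (rule sum.mono_neutral_right) (auto simp: T_def D_def)
      also have "\<dots> \<le> card A * (C / sqrt (r * t))" using sum_bounded_above[OF le] by simp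
      finally show ?thesis .
    qed
    have lim0: "((\<lambda>t. card A * (C / sqrt (r * t)) / B) \<longlongrightarrow> 0) at_top"
      using r B by real_asymp
    have "(D \<longlongrightarrow> 0) at_top"
    proof (rule Lim_null_comparison[OF _ lim0])
      show "\<forall>\<^sub>F t in at_top. norm (D t) \<le> card A * (C / sqrt (r * t)) / B"
        using eventually_gt_at_top[of 0]
      proof eventually_elim
        case (elim t)
        have "B * norm (D t) \<le> card A * (C / sqrt (r * t))" using TD[OF elim] B(2)[of "D t"] by linarith
        then show ?case using B(1) by (subst pos_le_divide_eq) (auto simp: mult.commute)
      qed
    qed
    then have Dy: "((\<lambda>t. D t $ y) \<longlongrightarrow> 0) at_top" for y
      using tendsto_vec_nth[of D 0 at_top y] by simp
    have u_lim: "((\<lambda>t. u t y) \<longlongrightarrow> c * pmf \<nu> y) at_top" if "y \<in> A" for y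
      using Dy[of y] that by (simp add: D_def LIM_zero_iff)
    have c0: "c > 0" using f x \<nu>f by (simp add: c_def)
    have "((\<lambda>t. u t y / (\<Sum>z\<in>A. u t z)) \<longlongrightarrow> c * pmf \<nu> y / (\<Sum>z\<in>A. c * pmf \<nu> z)) at_top"
      using u_lim y c0 sum1 by (intro tendsto_divide tendsto_sum) (auto simp flip: sum_distrib_left)
    moreover have "c * pmf \<nu> y / (\<Sum>z\<in>A. c * pmf \<nu> z) = pmf \<nu> y"
      using c0 sum1 by (simp flip: sum_distrib_left)
    moreover have "\<forall>\<^sub>F t in at_top. u t y / (\<Sum>z\<in>A. u t z)
        = poisson_kernel A K t x y / (\<Sum>z\<in>A. poisson_kernel A K t x z)"
      using eventually_ge_at_top[of 0]
      by eventually_elim (use u_pk y in \<open>simp flip: sum_distrib_left\<close>)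
    ultimately show ?thesis by (simp add: perron tendsto_cong)
  qed
qed

end

section \<open>Excursions and the trace on a subset\<close>

text \<open>\<open>m\<close> counts the intermediate states, all of them outside \<open>R\<close>;
  such a path has \<open>m + 1\<close> steps.\<close>

primrec excursion_weight :: "('a \<Rightarrow> 'a pmf) \<Rightarrow> 'a set \<Rightarrow> nat \<Rightarrow> 'a \<Rightarrow> 'a \<Rightarrow> real" where
  "excursion_weight p R 0 x y = pmf (p x) y"
| "excursion_weight p R (Suc m) x y = (\<Sum>z\<in>-R. pmf (p x) z * excursion_weight p R m z y)"

definition trace_kernel :: "('a \<Rightarrow> 'a pmf) \<Rightarrow> 'a set \<Rightarrow> real \<Rightarrow> 'a \<Rightarrow> 'a \<Rightarrow> real" where
  "trace_kernel p R \<theta> x y = (\<Sum>m. \<theta> ^ m * excursion_weight p R m x y)"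

text \<open>Weight of the paths with \<open>m\<close> steps from \<open>x\<close> to \<open>y\<close> that start \<open>i\<close> of these steps in \<open>R\<close>;
  every step that starts outside \<open>R\<close> costs a factor \<open>\<theta>\<close>.\<close>

primrec visit_weight ::
    "('a::finite \<Rightarrow> 'a pmf) \<Rightarrow> 'a set \<Rightarrow> real \<Rightarrow> nat \<Rightarrow> nat \<Rightarrow> 'a \<Rightarrow> 'a \<Rightarrow> real" where
  "visit_weight p R \<theta> 0 i x y = (if i = 0 \<and> x = y then 1 else 0)"
| "visit_weight p R \<theta> (Suc m) i x y =
     (if x \<in> R then (case i of 0 \<Rightarrow> 0 | Suc j \<Rightarrow> (\<Sum>z\<in>UNIV. pmf (p x) z * visit_weight p R \<theta> m j z y))
      else \<theta> * (\<Sum>z\<in>UNIV. pmf (p x) z * visit_weight p R \<theta> m i z y))"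

text \<open>For \<open>y \<in> R\<close> the length of a contributing path is the time of visit
  number \<open>i\<close> to \<open>R\<close>, counted from 0. The sum over all lengths is therefore
  the law of the place of that visit, discounted by \<open>\<theta>\<close> for each step that
  starts outside.\<close>

definition visit_sum ::
    "('a::finite \<Rightarrow> 'a pmf) \<Rightarrow> 'a set \<Rightarrow> real \<Rightarrow> nat \<Rightarrow> 'a \<Rightarrow> 'a \<Rightarrow> real" where
  "visit_sum p R \<theta> i x y = (\<Sum>m. visit_weight p R \<theta> m i x y)"

lemma sum_pmf_UNIV [simp]: "(\<Sum>z\<in>UNIV. pmf (q :: 'a::finite pmf) z) = 1"
  by (rule sum_pmf_eq_1) auto

lemma pmf_average_le:
  fixes q :: "'a::finite pmf"
  assumes "\<And>z. f z \<le> c"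
  shows "(\<Sum>z\<in>UNIV. pmf q z * f z) \<le> c"
proof -
  have "(\<Sum>z\<in>UNIV. pmf q z * f z) \<le> (\<Sum>z\<in>UNIV. pmf q z * c)"
    by (intro sum_mono mult_left_mono assms) auto
  then show ?thesis by (simp flip: sum_distrib_right)
qed

context
  fixes p :: "'a::finite \<Rightarrow> 'a pmf" and R :: "'a set" and \<theta> :: real
  assumes \<theta>: "0 \<le> \<theta>" "\<theta> \<le> 1"
begin

lemma visit_weight_nonneg: "0 \<le> visit_weight p R \<theta> m i x y"
  using \<theta> by (induction m arbitrary: i x) (auto split: nat.split intro!: sum_nonneg mult_nonneg_nonneg)

lemma visit_weight_eq_0: "m < i \<Longrightarrow> visit_weight p R \<theta> m i x y = 0"
  by (induction m arbitrary: i x) (auto split: nat.split intro!: sum.neutral)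

text \<open>Visit number \<open>i\<close> to \<open>R\<close> happens at one time at most, so the
  weights of different lengths add up to a probability, reduced further by the discount. The
  induction on the horizon \<open>N\<close> conditions on the first step.\<close>

lemma sum_visit_weight_le: "(\<Sum>m<N. \<Sum>y\<in>R. visit_weight p R \<theta> m i x y) \<le> 1"
proof (induction N arbitrary: i x)
  case (Suc N)
  have shift: "(\<Sum>m<N. \<Sum>y\<in>R. c * (\<Sum>z\<in>UNIV. pmf (p x) z * visit_weight p R \<theta> m j z y))
      = c * (\<Sum>z\<in>UNIV. pmf (p x) z * (\<Sum>m<N. \<Sum>y\<in>R. visit_weight p R \<theta> m j z y))" for j c
  proof -
    have "(\<Sum>m<N. \<Sum>y\<in>R. c * (\<Sum>z\<in>UNIV. pmf (p x) z * visit_weight p R \<theta> m j z y))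
        = (\<Sum>m<N. \<Sum>z\<in>UNIV. c * (pmf (p x) z * (\<Sum>y\<in>R. visit_weight p R \<theta> m j z y)))"
      unfolding sum_distrib_left by (subst sum.swap) simp
    then show ?thesis
      unfolding sum_distrib_left by (subst (asm) sum.swap) simp
  qed
  have IH: "(\<Sum>z\<in>UNIV. pmf (p x) z * (\<Sum>m<N. \<Sum>y\<in>R. visit_weight p R \<theta> m j z y)) \<le> 1" for j
    by (rule pmf_average_le) (rule Suc.IH)
  show ?case
  proof (cases "x \<in> R")
    case True
    show ?thesis
    proof (cases i)
      case 0
      have "(\<Sum>y\<in>R. visit_weight p R \<theta> 0 0 x y) = 1" using True by simp
      then show ?thesis
        unfolding sum.lessThan_Suc_shift using True 0 by simp
    next
      case (Suc j)
      then show ?thesis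
        unfolding sum.lessThan_Suc_shift using True shift[of 1 j] IH[of j] by simp
    qed
  next
    case False
    have "(\<Sum>y\<in>R. visit_weight p R \<theta> 0 i x y) = 0" using False by (auto intro!: sum.neutral)
    moreover have "\<theta> * (\<Sum>z\<in>UNIV. pmf (p x) z * (\<Sum>m<N. \<Sum>y\<in>R. visit_weight p R \<theta> m i z y)) \<le> 1 * 1"
      using IH[of i] \<theta> visit_weight_nonneg
      by (intro mult_mono) (auto intro!: sum_nonneg mult_nonneg_nonneg)
    ultimately show ?thesis
      unfolding sum.lessThan_Suc_shift using False shift[of \<theta> i] by simp
  qed
qed simp

lemma summable_visit_weight:
  assumes "y \<in> R"
  shows "summable (\<lambda>m. visit_weight p R \<theta> m i x y)"
proof (rule summableI_nonneg_bounded[where x=1])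
  show "(\<Sum>m<N. visit_weight p R \<theta> m i x y) \<le> 1" for N
    using assms visit_weight_nonneg
    by (intro order_trans[OF sum_mono sum_visit_weight_le[of i x N]] member_le_sum) auto
qed (rule visit_weight_nonneg)

lemma visit_sum_nonneg: "y \<in> R \<Longrightarrow> 0 \<le> visit_sum p R \<theta> i x y"
  unfolding visit_sum_def by (intro suminf_nonneg summable_visit_weight visit_weight_nonneg)

lemma sum_visit_sum_le: "(\<Sum>y\<in>R. visit_sum p R \<theta> i x y) \<le> 1"
proof -
  have "(\<lambda>m. \<Sum>y\<in>R. visit_weight p R \<theta> m i x y) sums (\<Sum>y\<in>R. visit_sum p R \<theta> i x y)"
    unfolding visit_sum_def by (intro sums_sum summable_sums summable_visit_weight)
  then show ?thesis
    using sum_visit_weight_le suminf_le_const[of "\<lambda>m. \<Sum>y\<in>R. visit_weight p R \<theta> m i x y" 1]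
    by (auto simp: sums_iff)
qed

text \<open>From \<open>x \<in> R\<close> the first visit happens at time 0, so only
  \<open>l = 0\<close> contributes.\<close>

lemma visit_weight_convolution_in:
  assumes "x \<in> R"
  shows "visit_weight p R \<theta> m i x y
    = (\<Sum>l\<le>m. \<Sum>w\<in>R. visit_weight p R \<theta> l 0 x w * visit_weight p R \<theta> (m - l) i w y)"
proof -
  have 0: "visit_weight p R \<theta> l 0 x w = 0" if "l \<noteq> 0" for l w
    using assms that by (cases l) auto
  have "(\<Sum>l\<le>m. \<Sum>w\<in>R. visit_weight p R \<theta> l 0 x w * visit_weight p R \<theta> (m - l) i w y)
      = (\<Sum>l\<in>{0}. \<Sum>w\<in>R. visit_weight p R \<theta> l 0 x w * visit_weight p R \<theta> (m - l) i w y)"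
    by (rule sum.mono_neutral_right) (auto simp: 0)
  also have "\<dots> = (\<Sum>w\<in>R. visit_weight p R \<theta> 0 0 x w * visit_weight p R \<theta> m i w y)"
    by simp
  also have "\<dots> = (\<Sum>w\<in>R. if x = w then visit_weight p R \<theta> m i x y else 0)"
    by (intro sum.cong) auto
  finally show ?thesis using assms by simp
qed

text \<open>Decomposition of a path at its first visit to \<open>R\<close>.\<close>

lemma visit_weight_convolution:
  assumes y: "y \<in> R"
  shows "visit_weight p R \<theta> m i x y
    = (\<Sum>l\<le>m. \<Sum>w\<in>R. visit_weight p R \<theta> l 0 x w * visit_weight p R \<theta> (m - l) i w y)"
proof (induction m arbitrary: x)
  case 0
  show ?case
  proof (cases "x \<in> R")
    case False
    then have "visit_weight p R \<theta> 0 0 x w = 0" if "w \<in> R" for w using that by auto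
    then show ?thesis using False y by auto
  qed (rule visit_weight_convolution_in)
next
  case (Suc m)
  show ?case
  proof (cases "x \<in> R")
    case False
    have 0: "(\<Sum>w\<in>R. visit_weight p R \<theta> 0 0 x w * visit_weight p R \<theta> (Suc m) i w y) = 0"
      using False by (intro sum.neutral) auto
    have "(\<Sum>l\<le>Suc m. \<Sum>w\<in>R. visit_weight p R \<theta> l 0 x w * visit_weight p R \<theta> (Suc m - l) i w y)
      = (\<Sum>l\<le>m. \<Sum>w\<in>R. \<Sum>u\<in>UNIV. \<theta> * (pmf (p x) u * (visit_weight p R \<theta> l 0 u w * visit_weight p R \<theta> (m - l) i w y)))"
      unfolding sum.atMost_Suc_shift diff_zero 0 using False
      by (simp add: sum_distrib_left sum_distrib_right mult_ac del: visit_weight.simps(1))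
    also have "\<dots> = (\<Sum>l\<le>m. \<Sum>u\<in>UNIV. \<Sum>w\<in>R. \<theta> * (pmf (p x) u * (visit_weight p R \<theta> l 0 u w * visit_weight p R \<theta> (m - l) i w y)))"
      by (intro sum.cong refl sum.swap)
    also have "\<dots> = (\<Sum>u\<in>UNIV. \<Sum>l\<le>m. \<Sum>w\<in>R. \<theta> * (pmf (p x) u * (visit_weight p R \<theta> l 0 u w * visit_weight p R \<theta> (m - l) i w y)))"
      by (rule sum.swap)
    also have "\<dots> = \<theta> * (\<Sum>u\<in>UNIV. pmf (p x) u * visit_weight p R \<theta> m i u y)"
      unfolding Suc.IH by (simp add: sum_distrib_left)
    finally show ?thesis using False by simp
  qed (rule visit_weight_convolution_in)
qed

text \<open>The strong Markov property at the first entrance to \<open>R\<close>; the convolution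
  over the entrance time becomes a Cauchy product of nonnegative series.\<close>

lemma visit_sum_first_entrance:
  assumes y: "y \<in> R"
  shows "visit_sum p R \<theta> i x y = (\<Sum>w\<in>R. visit_sum p R \<theta> 0 x w * visit_sum p R \<theta> i w y)"
proof -
  have "(\<lambda>m. \<Sum>w\<in>R. \<Sum>l\<le>m. visit_weight p R \<theta> l 0 x w * visit_weight p R \<theta> (m - l) i w y) sums
      (\<Sum>w\<in>R. visit_sum p R \<theta> 0 x w * visit_sum p R \<theta> i w y)"
    unfolding visit_sum_def using summable_visit_weight visit_weight_nonneg y
    by (intro sums_sum Cauchy_product_sums) auto
  moreover have "(\<Sum>w\<in>R. \<Sum>l\<le>m. visit_weight p R \<theta> l 0 x w * visit_weight p R \<theta> (m - l) i w y)
      = visit_weight p R \<theta> m i x y" for m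
    unfolding visit_weight_convolution[OF y, of m i x] by (rule sum.swap)
  ultimately show ?thesis by (simp add: visit_sum_def sums_iff)
qed

lemma visit_sum_step:
  assumes y: "y \<in> R"
  shows "x \<in> R \<Longrightarrow> visit_sum p R \<theta> (Suc i) x y = (\<Sum>z\<in>UNIV. pmf (p x) z * visit_sum p R \<theta> i z y)"
    and "x \<notin> R \<Longrightarrow> visit_sum p R \<theta> i x y = \<theta> * (\<Sum>z\<in>UNIV. pmf (p x) z * visit_sum p R \<theta> i z y)"
    and "x \<in> R \<Longrightarrow> visit_sum p R \<theta> 0 x y = (if x = y then 1 else 0)"
proof -
  have s: "(\<lambda>m. \<Sum>z\<in>UNIV. pmf (p x) z * visit_weight p R \<theta> m i z y) sums
      (\<Sum>z\<in>UNIV. pmf (p x) z * visit_sum p R \<theta> i z y)" for i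
    unfolding visit_sum_def by (intro sums_sum sums_mult summable_sums summable_visit_weight y)
  have split: "visit_sum p R \<theta> i x y = visit_weight p R \<theta> 0 i x y + (\<Sum>m. visit_weight p R \<theta> (Suc m) i x y)" for i
    unfolding visit_sum_def using suminf_split_head[OF summable_visit_weight[OF y, of i x]] by simp
  show "x \<in> R \<Longrightarrow> visit_sum p R \<theta> (Suc i) x y = (\<Sum>z\<in>UNIV. pmf (p x) z * visit_sum p R \<theta> i z y)"
    using s unfolding split[of "Suc i"] by (simp add: sums_iff)
  show "x \<notin> R \<Longrightarrow> visit_sum p R \<theta> i x y = \<theta> * (\<Sum>z\<in>UNIV. pmf (p x) z * visit_sum p R \<theta> i z y)"
    using sums_mult[OF s[of i], of \<theta>] y unfolding split[of i] by (auto simp: sums_iff)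
  show "x \<in> R \<Longrightarrow> visit_sum p R \<theta> 0 x y = (if x = y then 1 else 0)"
    unfolding split[of 0] by simp
qed

text \<open>After one free step from \<open>x\<close>, a path that first enters \<open>R\<close>
  after \<open>m\<close> further steps starts each of these outside \<open>R\<close> and pays
  \<open>\<theta>\<close> for it.\<close>

lemma excursion_weight_eq:
  assumes "y \<in> R"
  shows "(\<Sum>z\<in>UNIV. pmf (p x) z * visit_weight p R \<theta> m 0 z y) = \<theta> ^ m * excursion_weight p R m x y"
proof (induction m arbitrary: x)
  case 0
  have "(\<Sum>z\<in>UNIV. pmf (p x) z * visit_weight p R \<theta> 0 0 z y) = (\<Sum>z\<in>UNIV. if z = y then pmf (p x) z else 0)"
    by (intro sum.cong) auto
  then show ?case by simp
next
  case (Suc m)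
  have "(\<Sum>z\<in>UNIV. pmf (p x) z * visit_weight p R \<theta> (Suc m) 0 z y)
      = (\<Sum>z\<in>UNIV. if z \<in> -R then pmf (p x) z * (\<theta> * (\<theta> ^ m * excursion_weight p R m z y)) else 0)"
    using Suc by (intro sum.cong) auto
  also have "\<dots> = (\<Sum>z\<in>-R. pmf (p x) z * (\<theta> * (\<theta> ^ m * excursion_weight p R m z y)))"
    by (simp add: sum.If_cases Compl_eq)
  finally show ?case by (simp add: sum_distrib_left mult_ac)
qed

lemma trace_kernel_sums:
  assumes "y \<in> R"
  shows "(\<lambda>m. \<theta> ^ m * excursion_weight p R m x y) sums (\<Sum>z\<in>UNIV. pmf (p x) z * visit_sum p R \<theta> 0 z y)"
  unfolding excursion_weight_eq[OF assms, symmetric] visit_sum_def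
  by (intro sums_sum sums_mult summable_sums summable_visit_weight assms)

lemma trace_kernel_eq_visit_sum:
  assumes "x \<in> R" "y \<in> R"
  shows "trace_kernel p R \<theta> x y = visit_sum p R \<theta> 1 x y"
  using trace_kernel_sums[OF assms(2), of x] visit_sum_step(1)[OF assms(2,1), of 0]
  by (simp add: trace_kernel_def sums_iff)

text \<open>The successive visits to \<open>R\<close> form a chain: one step from \<open>R\<close>,
  followed by the Markov property at the next entrance, is one application of
  \<open>trace_kernel\<close>.\<close>

lemma visit_sum_eq_kernel_power:
  assumes "x \<in> R" "y \<in> R"
  shows "visit_sum p R \<theta> i x y = kernel_power R (trace_kernel p R \<theta>) i x y"
  using assms(1)
proof (induction i arbitrary: x)
  case 0
  then show ?case using visit_sum_step(3) assms(2) by simp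
next
  case (Suc i)
  have "visit_sum p R \<theta> (Suc i) x y
      = (\<Sum>z\<in>UNIV. pmf (p x) z * (\<Sum>w\<in>R. visit_sum p R \<theta> 0 z w * visit_sum p R \<theta> i w y))"
    unfolding visit_sum_step(1)[OF assms(2) Suc.prems]
    by (subst visit_sum_first_entrance[OF assms(2)]) simp
  also have "\<dots> = (\<Sum>w\<in>R. (\<Sum>z\<in>UNIV. pmf (p x) z * visit_sum p R \<theta> 0 z w) * visit_sum p R \<theta> i w y)"
    unfolding sum_distrib_left sum_distrib_right by (subst sum.swap) (simp add: mult_ac)
  also have "\<dots> = (\<Sum>w\<in>R. trace_kernel p R \<theta> x w * kernel_power R (trace_kernel p R \<theta>) i w y)"
  proof (rule sum.cong)
    fix w assume "w \<in> R"
    then show "(\<Sum>z\<in>UNIV. pmf (p x) z * visit_sum p R \<theta> 0 z w) * visit_sum p R \<theta> i w y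
        = trace_kernel p R \<theta> x w * kernel_power R (trace_kernel p R \<theta>) i w y"
      using Suc.IH visit_sum_step(1)[of w x 0] trace_kernel_eq_visit_sum Suc.prems by simp
  qed simp
  finally show ?case by simp
qed

lemma trace_kernel_nonneg: "x \<in> R \<Longrightarrow> y \<in> R \<Longrightarrow> 0 \<le> trace_kernel p R \<theta> x y"
  using trace_kernel_eq_visit_sum visit_sum_nonneg by simp

lemma sum_trace_kernel_le: "x \<in> R \<Longrightarrow> (\<Sum>y\<in>R. trace_kernel p R \<theta> x y) \<le> 1"
  using sum_visit_sum_le[of 1 x] by (simp add: trace_kernel_eq_visit_sum)

end

section \<open>Reversibility, continuity and recurrence of the trace kernel\<close>

lemma excursion_weight_nonneg: "0 \<le> excursion_weight p R m x (y :: 'a::finite)"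
  by (induction m arbitrary: x) (auto intro!: sum_nonneg)

text \<open>The definition peels off the first step; path reversal exchanges it with the last one,
  so both recursions are needed.\<close>

lemma excursion_weight_Suc_right:
  fixes p :: "'a::finite \<Rightarrow> 'a pmf"
  shows "excursion_weight p R (Suc m) x y = (\<Sum>z\<in>-R. excursion_weight p R m x z * pmf (p z) y)"
proof (induction m arbitrary: x)
  case (Suc m)
  have "excursion_weight p R (Suc (Suc m)) x y
      = (\<Sum>z\<in>-R. pmf (p x) z * (\<Sum>w\<in>-R. excursion_weight p R m z w * pmf (p w) y))"
    unfolding excursion_weight.simps(2)[of p R "Suc m"] Suc.IH by simp
  also have "\<dots> = (\<Sum>w\<in>-R. (\<Sum>z\<in>-R. pmf (p x) z * excursion_weight p R m z w) * pmf (p w) y)"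
    unfolding sum_distrib_left sum_distrib_right by (subst sum.swap) (simp add: mult_ac)
  finally show ?case by simp
qed simp

lemma excursion_weight_reversible:
  fixes p :: "'a::finite \<Rightarrow> 'a pmf"
  assumes "reversible p \<mu>"
  shows "pmf \<mu> x * excursion_weight p R m x y = pmf \<mu> y * excursion_weight p R m y x"
proof (induction m arbitrary: x y)
  case 0
  then show ?case using assms by (simp add: reversible_def)
next
  case (Suc m)
  have "pmf \<mu> x * excursion_weight p R (Suc m) x y
      = (\<Sum>z\<in>-R. (pmf \<mu> x * pmf (p x) z) * excursion_weight p R m z y)"
    by (simp add: sum_distrib_left mult_ac)
  also have "\<dots> = (\<Sum>z\<in>-R. pmf (p z) x * (pmf \<mu> z * excursion_weight p R m z y))"
    using assms by (intro sum.cong) (auto simp: reversible_def)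
  also have "\<dots> = pmf \<mu> y * (\<Sum>z\<in>-R. excursion_weight p R m y z * pmf (p z) x)"
    unfolding Suc.IH[of _ y] by (simp add: sum_distrib_left mult_ac)
  finally show ?case unfolding excursion_weight_Suc_right .
qed

lemma summable_excursion_weight:
  assumes "y \<in> R"
  shows "summable (\<lambda>m. excursion_weight p R m x (y :: 'a::finite))"
  using trace_kernel_sums[of 1 y R p x] assms by (auto simp: sums_iff)

text \<open>Weierstrass test with the series at \<open>\<theta> = 1\<close> as majorant, which gives
  continuity up to both endpoints.\<close>

lemma continuous_on_trace_kernel:
  assumes "y \<in> R"
  shows "continuous_on {0..1} (\<lambda>\<theta>. trace_kernel p R \<theta> x (y :: 'a::finite))"
proof -
  have "uniform_limit {0..1} (\<lambda>n \<theta>. \<Sum>m<n. \<theta> ^ m * excursion_weight p R m x y)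
      (\<lambda>\<theta>. trace_kernel p R \<theta> x y) sequentially"
    unfolding trace_kernel_def
  proof (rule Weierstrass_m_test)
    show "norm (\<theta> ^ m * excursion_weight p R m x y) \<le> excursion_weight p R m x y"
      if "\<theta> \<in> {0..1}" for m \<theta>
      using that excursion_weight_nonneg[of p R m x y]
      by (auto simp: abs_mult power_abs intro!: mult_left_le_one_le power_le_one)
  qed (rule summable_excursion_weight[OF assms])
  then show ?thesis
    by (rule uniform_limit_theorem[rotated]) (auto intro!: always_eventually continuous_intros)
qed

lemma trace_kernel_0: "trace_kernel p R 0 x y = pmf (p x) y"
proof -
  have "trace_kernel p R 0 x y = (\<Sum>m\<in>{0}. 0 ^ m * excursion_weight p R m x y)"
    unfolding trace_kernel_def by (rule suminf_finite) auto
  then show ?thesis by simp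
qed

text \<open>The direct step is the summand \<open>m = 0\<close>. Through this bound the trace kernel
  inherits irreducibility for every \<open>\<theta>\<close>.\<close>

lemma trace_kernel_ge:
  assumes "0 \<le> \<theta>" "\<theta> \<le> 1" "y \<in> R"
  shows "pmf (p x) y \<le> trace_kernel p R \<theta> x (y :: 'a::finite)"
proof -
  have "(\<Sum>m\<in>{0}. \<theta> ^ m * excursion_weight p R m x y) \<le> trace_kernel p R \<theta> x y"
    unfolding trace_kernel_def using trace_kernel_sums[OF assms] assms excursion_weight_nonneg
    by (intro sum_le_suminf) (auto simp: sums_iff intro!: mult_nonneg_nonneg)
  then show ?thesis by simp
qed

text \<open>\<open>restricted_kernel\<close> differs from \<open>p\<close> only on the diagonal, and
  loops do not matter for reachability.\<close>

lemma irreducible_on_restricted_kernel_mono: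
  assumes "irreducible_on A (restricted_kernel p A)"
    and "\<And>x y. x \<in> A \<Longrightarrow> y \<in> A \<Longrightarrow> pmf (p x) y \<le> K x y"
  shows "irreducible_on A K"
proof -
  have "{(u, v). u \<in> A \<and> v \<in> A \<and> restricted_kernel p A u v > 0} \<subseteq> {(u, v). u \<in> A \<and> v \<in> A \<and> K u v > 0}\<^sup>="
    using assms(2) by (force simp: restricted_kernel_def split: if_splits)
  from rtrancl_mono[OF this] show ?thesis
    using assms(1) unfolding irreducible_on_def rtrancl_reflcl by blast
qed

text \<open>Detailed balance carries the positivity of \<open>\<mu>\<close> along each edge.\<close>

lemma reversible_irreducible_pmf_pos:
  fixes p :: "'a::finite \<Rightarrow> 'a pmf"
  assumes rev: "reversible p \<mu>" and irr: "irreducible_on UNIV (\<lambda>x y. pmf (p x) y)"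
  shows "0 < pmf \<mu> x"
proof -
  obtain a where a: "a \<in> set_pmf \<mu>" using set_pmf_not_empty[of \<mu>] by blast
  have "(a, x) \<in> {(u, v). u \<in> UNIV \<and> v \<in> UNIV \<and> pmf (p u) v > 0}\<^sup>*"
    using irr by (auto simp: irreducible_on_def)
  then show ?thesis
  proof (induction rule: rtrancl_induct)
    case base
    show ?case using a by (simp add: pmf_positive)
  next
    case (step u v)
    then have "0 < pmf \<mu> u * pmf (p u) v" by simp
    also have "\<dots> = pmf \<mu> v * pmf (p v) u" using rev by (simp add: reversible_def)
    finally show ?case by (simp add: zero_less_mult_iff)
  qed
qed

lemma trace_kernel_reversible:
  fixes p :: "'a::finite \<Rightarrow> 'a pmf"
  assumes "reversible p \<mu>" "0 \<le> \<theta>" "\<theta> \<le> 1" "x \<in> R" "y \<in> R"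
  shows "pmf \<mu> x * trace_kernel p R \<theta> x y = pmf \<mu> y * trace_kernel p R \<theta> y x"
proof -
  have "pmf \<mu> x * trace_kernel p R \<theta> x y = (\<Sum>m. pmf \<mu> x * (\<theta> ^ m * excursion_weight p R m x y))"
    unfolding trace_kernel_def
    using trace_kernel_sums[OF assms(2,3,5)] by (intro suminf_mult[symmetric]) (auto simp: sums_iff)
  also have "\<dots> = (\<Sum>m. pmf \<mu> y * (\<theta> ^ m * excursion_weight p R m y x))"
    using excursion_weight_reversible[OF assms(1)] by (simp add: mult.left_commute)
  also have "\<dots> = pmf \<mu> y * trace_kernel p R \<theta> y x"
    unfolding trace_kernel_def
    using trace_kernel_sums[OF assms(2,3,4)] by (intro suminf_mult) (auto simp: sums_iff)
  finally show ?thesis .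
qed

lemma reversible_kernel_trace_kernel:
  fixes p :: "'a::finite \<Rightarrow> 'a pmf"
  assumes "reversible p \<mu>" "irreducible_on UNIV (\<lambda>x y. pmf (p x) y)" "R \<noteq> {}"
    and "irreducible_on R (restricted_kernel p R)" and \<theta>: "0 \<le> \<theta>" "\<theta> \<le> 1"
  shows "reversible_kernel R (trace_kernel p R \<theta>) (pmf \<mu>)"
proof
  show "irreducible_on R (trace_kernel p R \<theta>)"
    by (rule irreducible_on_restricted_kernel_mono[OF assms(4)]) (rule trace_kernel_ge[OF \<theta>])
  show "pmf \<mu> x * trace_kernel p R \<theta> x y = pmf \<mu> y * trace_kernel p R \<theta> y x"
    if "x \<in> R" "y \<in> R" for x y
    by (rule trace_kernel_reversible[OF assms(1) \<theta> that])
  show "0 \<le> trace_kernel p R \<theta> x y" if "x \<in> R" "y \<in> R" for x y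
    by (rule trace_kernel_nonneg[OF \<theta> that])
  show "0 < pmf \<mu> x" for x
    by (rule reversible_irreducible_pmf_pos[OF assms(1,2)])
qed (rule assms)

text \<open>Recurrence: the probability to hit \<open>R\<close> is harmonic outside \<open>R\<close>, so the minimum principle applies.\<close>

lemma sum_trace_kernel_1:
  fixes p :: "'a::finite \<Rightarrow> 'a pmf"
  assumes irr: "irreducible_on UNIV (\<lambda>x y. pmf (p x) y)" and "R \<noteq> {}"
  shows "(\<Sum>y\<in>R. trace_kernel p R 1 x y) = 1"
proof -
  define h where "h z = (\<Sum>y\<in>R. visit_sum p R 1 0 z y)" for z
  have hR: "h z = 1" if "z \<in> R" for z
    using that visit_sum_step(3)[of 1 _ R z p] by (simp add: h_def)
  have hharm: "h z = (\<Sum>u\<in>UNIV. pmf (p z) u * h u)" if "z \<notin> R" for z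
  proof -
    have "h z = (\<Sum>y\<in>R. \<Sum>u\<in>UNIV. pmf (p z) u * visit_sum p R 1 0 u y)"
      unfolding h_def using visit_sum_step(2)[of 1 _ R z p 0] that by (intro sum.cong) auto
    then show ?thesis unfolding h_def sum_distrib_left by (subst sum.swap)
  qed
  obtain z0 where z0: "\<And>z. h z0 \<le> h z"
    using ex_is_arg_min_if_finite[of UNIV h] by (auto simp: is_arg_min_linorder)
  have h1: "1 \<le> h z0"
  proof (rule ccontr)
    assume less: "\<not> 1 \<le> h z0"
    obtain a where a: "a \<in> R" using assms(2) by auto
    have "(z0, a) \<in> {(u, v). u \<in> UNIV \<and> v \<in> UNIV \<and> pmf (p u) v > 0}\<^sup>*"
      using irr by (auto simp: irreducible_on_def)
    then have "h a = h z0"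
    proof (induction rule: rtrancl_induct)
      case (step u v)
      then have uv: "h u = h z0" "pmf (p u) v > 0" by auto
      \<comment> \<open>A state outside \<open>R\<close> at the minimum averages \<open>h\<close>
        over its successors, so they are at the minimum too. Followed up to
        \<open>a \<in> R\<close>, where \<open>h\<close> is 1, this contradicts a minimum below
        1.\<close>
      then have "u \<notin> R" using hR less by auto
      then have "(\<Sum>w\<in>UNIV. pmf (p u) w * (h w - h z0)) = 0"
        using hharm[of u] uv by (simp add: right_diff_distrib sum_subtractf flip: sum_distrib_right)
      then have "pmf (p u) v * (h v - h z0) = 0"
        using z0 by (subst (asm) sum_nonneg_eq_0_iff) auto
      then show ?case using uv by simp
    qed simp
    then show False using hR[OF a] less by simp
  qed
  have h: "h z = 1" for z
    using h1 z0[of z] sum_visit_sum_le[of 1 p R 0 z] by (simp add: h_def)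
  have "(\<Sum>y\<in>R. trace_kernel p R 1 x y) = (\<Sum>y\<in>R. \<Sum>z\<in>UNIV. pmf (p x) z * visit_sum p R 1 0 z y)"
    using trace_kernel_sums[of 1 _ R p x] by (intro sum.cong) (auto simp: trace_kernel_def sums_iff)
  also have "\<dots> = (\<Sum>z\<in>UNIV. pmf (p x) z * h z)"
    unfolding h_def sum_distrib_left by (rule sum.swap)
  finally show ?thesis by (simp add: h)
qed

section \<open>Local times along a path\<close>

definition good_clock :: "(nat \<Rightarrow> real) \<Rightarrow> bool" where
  "good_clock s \<longleftrightarrow> (\<forall>n. 0 < s n) \<and> filterlim (\<lambda>n. \<Sum>k\<le>n. s k) at_top sequentially"

text \<open>Countably many conditions: this makes goodness of the clock measurable and reduces its
  almost sure validity to one level \<open>N\<close> at a time.\<close>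

lemma good_clock_iff: "good_clock s \<longleftrightarrow> (\<forall>n. 0 < s n) \<and> (\<forall>N::nat. \<exists>n. real N < (\<Sum>k\<le>n. s k))"
proof
  assume "good_clock s"
  then show "(\<forall>n. 0 < s n) \<and> (\<forall>N::nat. \<exists>n. real N < (\<Sum>k\<le>n. s k))"
    unfolding good_clock_def filterlim_at_top_dense eventually_sequentially by (meson le_refl)
next
  assume s: "(\<forall>n. 0 < s n) \<and> (\<forall>N::nat. \<exists>n. real N < (\<Sum>k\<le>n. s k))"
  have mono: "(\<Sum>k\<le>m. s k) \<le> (\<Sum>k\<le>n. s k)" if "m \<le> n" for m n
    using that s by (intro sum_mono2) (auto simp: less_imp_le)
  have "filterlim (\<lambda>n. \<Sum>k\<le>n. s k) at_top sequentially"
    unfolding filterlim_at_top_dense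
  proof
    fix c :: real
    obtain N :: nat where N: "c \<le> real N" using real_arch_simple by blast
    obtain m where m: "real N < (\<Sum>k\<le>m. s k)" using s by auto
    show "\<forall>\<^sub>F n in sequentially. c < (\<Sum>k\<le>n. s k)"
      using eventually_ge_at_top[of m]
    proof eventually_elim
      case (elim n)
      then show ?case using mono[OF elim] N m by linarith
    qed
  qed
  then show "good_clock s" using s by (simp add: good_clock_def)
qed

text \<open>The time spent in \<open>A\<close> up to ring number \<open>m\<close>;
  \<open>local_time_ring\<close> identifies it with the local time at that ring.\<close>

definition occupation :: "'a set \<Rightarrow> (nat \<Rightarrow> real) \<Rightarrow> (nat \<Rightarrow> 'a) \<Rightarrow> nat \<Rightarrow> real" where
  "occupation A s z m = (\<Sum>k<m. if z k \<in> A then s k else 0)"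

lemma occupation_Suc: "occupation A s z (Suc m) = occupation A s z m + (if z m \<in> A then s m else 0)"
  by (simp add: occupation_def)

lemma occupation_0 [simp]: "occupation A s z 0 = 0"
  by (simp add: occupation_def)

lemma local_time_mono: "t \<le> t' \<Longrightarrow> local_time A \<xi> t \<le> local_time A \<xi> t'"
  unfolding local_time_def
  by (intro nn_integral_mono mult_left_mono) (auto simp: indicator_def intro: order_trans)

lemma local_time_ennreal:
  assumes "0 \<le> b"
  shows "local_time A \<xi> (ennreal b) = (\<integral>\<^sup>+ s. indicator A (\<xi> s) * indicator {0..b} s \<partial>lborel)"
  unfolding local_time_def
  using assms by (intro nn_integral_cong) (auto simp: indicator_def)

lemma inv_local_time_le: "0 \<le> s \<Longrightarrow> t < local_time A \<xi> (ennreal s) \<Longrightarrow> inv_local_time A \<xi> t \<le> ennreal s"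
  unfolding inv_local_time_def by (intro Inf_lower) auto

lemma le_inv_local_time:
  assumes "local_time A \<xi> (ennreal b) \<le> t"
  shows "ennreal b \<le> inv_local_time A \<xi> t"
  unfolding inv_local_time_def
proof (rule Inf_greatest)
  fix u assume "u \<in> {ennreal s |s. 0 \<le> s \<and> t < local_time A \<xi> (ennreal s)}"
  then obtain s where s: "u = ennreal s" "0 \<le> s" "t < local_time A \<xi> (ennreal s)" by auto
  have "\<not> ennreal s \<le> ennreal b"
    using local_time_mono[of "ennreal s" "ennreal b" A \<xi>] s(3) assms by (auto dest: order.strict_trans2)
  then show "ennreal b \<le> u" using linear[of "ennreal b" "ennreal s"] s(1) by auto
qed

context
  fixes s :: "nat \<Rightarrow> real" and z :: "nat \<Rightarrow> 'a" and \<xi> :: "real \<Rightarrow> 'a" and T :: "nat \<Rightarrow> real"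
  assumes good: "good_clock s"
  defines "\<xi> \<equiv> clock_path s z" and "T \<equiv> \<lambda>n. \<Sum>k<n. s k"
begin

lemma clock_pos: "0 < s n"
  using good by (simp add: good_clock_def)

lemma ring_0: "T 0 = 0" and ring_Suc: "T (Suc n) = T n + s n"
  by (simp_all add: T_def)

lemma ring_strict_mono: "strict_mono T"
  by (rule strict_mono_Suc_iff[THEN iffD2]) (use clock_pos in \<open>simp add: ring_Suc\<close>)

lemma ring_nonneg: "0 \<le> T n"
  using ring_strict_mono by (metis ring_0 strict_mono_less_eq le0)

text \<open>Exactly the first \<open>n\<close> rings have occurred by time \<open>t\<close>. Ring
  number \<open>n\<close> is at \<open>T n\<close>, while \<open>T 0 = 0\<close> is the start and
  not a ring.\<close>

lemma path_cell:
  assumes "T n \<le> t" "t < T (Suc n)"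
  shows "\<xi> t = z n"
proof -
  have "(\<Sum>k\<le>j. s k) = T (Suc j)" for j by (simp add: T_def lessThan_Suc_atMost)
  then have "{j. (\<Sum>k\<le>j. s k) \<le> t} = {j. T (Suc j) \<le> t}" by simp
  also have "\<dots> = {..<n}"
  proof (intro set_eqI iffI)
    fix j assume "j \<in> {j. T (Suc j) \<le> t}"
    then have "T (Suc j) < T (Suc n)" using assms by simp
    then show "j \<in> {..<n}" using ring_strict_mono by (simp add: strict_mono_less)
  next
    fix j assume "j \<in> {..<n}"
    then have "T (Suc j) \<le> T n" using ring_strict_mono by (simp add: strict_mono_less_eq)
    then show "j \<in> {j. T (Suc j) \<le> t}" using assms by simp
  qed
  finally show ?thesis using good by (simp add: \<xi>_def clock_path_def good_clock_def)
qed

lemma cell_exists: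
  assumes "0 \<le> t"
  obtains n where "T n \<le> t" "t < T (Suc n)"
proof -
  have "filterlim (\<lambda>n. T (Suc n)) at_top sequentially"
    using good by (simp add: good_clock_def T_def lessThan_Suc_atMost)
  then have "\<exists>n. t < T (Suc n)"
    by (auto simp: filterlim_at_top_dense eventually_sequentially)
  then have ex: "\<exists>n. t < T n" by auto
  define n where "n = (LEAST n. t < T n)"
  have n: "t < T n" unfolding n_def using ex by (rule LeastI_ex)
  then obtain k where k: "n = Suc k" using assms by (cases n) (auto simp: ring_0)
  have "\<not> t < T k" using not_less_Least[of k "\<lambda>n. t < T n"] k by (simp add: n_def)
  then show ?thesis using that[of k] n k by simp
qed

lemma path_measurable: "\<xi> \<in> borel \<rightarrow>\<^sub>M count_space UNIV"
proof -
  have "\<xi> = (\<lambda>t. z (card {n. (\<Sum>k\<le>n. s k) \<le> t}))"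
    using good by (auto simp: \<xi>_def clock_path_def good_clock_def)
  also have "\<dots> \<in> borel \<rightarrow>\<^sub>M count_space UNIV"
    by (rule measurable_compose[of "\<lambda>t. card {n. (\<Sum>k\<le>n. s k) \<le> t}" _ "count_space UNIV"]) measurable
  finally show ?thesis .
qed

lemma local_time_cell:
  assumes r: "0 \<le> r" "r \<le> s n"
  shows "local_time A \<xi> (ennreal (T n + r)) = local_time A \<xi> (ennreal (T n)) + ennreal (if z n \<in> A then r else 0)"
proof -
  note path_measurable[measurable]
  have [measurable]: "A \<in> sets (count_space UNIV)" by simp
  have "local_time A \<xi> (ennreal (T n + r))
      = (\<integral>\<^sup>+ u. indicator A (\<xi> u) * indicator {0..T n + r} u \<partial>lborel)"
    using r ring_nonneg by (intro local_time_ennreal) auto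
  also have "\<dots> = (\<integral>\<^sup>+ u. indicator A (\<xi> u) * indicator {0..T n} u
      + indicator A (z n) * indicator {T n<..T n + r} u \<partial>lborel)"
  proof (rule nn_integral_cong_AE)
    \<comment> \<open>For \<open>r = s n\<close> the time \<open>T n + r\<close> already belongs to
      the next cell; this single time is a null set.\<close>
    have "AE u in lborel. u \<noteq> T n + r" by (rule AE_lborel_singleton)
    then show "AE u in lborel. (indicator A (\<xi> u) * indicator {0..T n + r} u :: ennreal)
        = indicator A (\<xi> u) * indicator {0..T n} u + indicator A (z n) * indicator {T n<..T n + r} u"
    proof eventually_elim
      case (elim u)
      show ?case
      proof (cases "T n < u \<and> u \<le> T n + r")
        case True
        then have "\<xi> u = z n" using elim r by (intro path_cell) (auto simp: ring_Suc)
        then show ?thesis using True ring_nonneg[of n] by (auto simp: indicator_def)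
      next
        case False
        then show ?thesis using r by (auto simp: indicator_def)
      qed
    qed
  qed
  also have "\<dots> = (\<integral>\<^sup>+ u. indicator A (\<xi> u) * indicator {0..T n} u \<partial>lborel)
      + (\<integral>\<^sup>+ u. indicator A (z n) * indicator {T n<..T n + r} u \<partial>lborel)"
    by (rule nn_integral_add) measurable
  also have "(\<integral>\<^sup>+ u. indicator A (\<xi> u) * indicator {0..T n} u \<partial>lborel) = local_time A \<xi> (ennreal (T n))"
    using ring_nonneg by (rule local_time_ennreal[symmetric])
  also have "(\<integral>\<^sup>+ u. indicator A (z n) * indicator {T n<..T n + r} u \<partial>lborel)
      = ennreal (if z n \<in> A then r else 0)"
    using r by (simp add: nn_integral_cmult)
  finally show ?thesis .
qed

lemma occupation_nonneg: "0 \<le> occupation A s z n"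
  using clock_pos by (auto simp: occupation_def less_imp_le intro!: sum_nonneg)

lemma local_time_ring: "local_time A \<xi> (ennreal (T n)) = ennreal (occupation A s z n)"
proof (induction n)
  case 0
  have "local_time A \<xi> (ennreal 0) \<le> (\<integral>\<^sup>+ u. indicator {0::real} u \<partial>lborel)"
    unfolding local_time_def by (intro nn_integral_mono) (auto simp: indicator_def ennreal_eq_0_iff)
  then show ?case by (simp add: ring_0)
next
  case (Suc n)
  then show ?case
    using local_time_cell[of "s n" n A] clock_pos[of n] occupation_nonneg
    by (simp add: ring_Suc occupation_Suc less_imp_le ennreal_plus[symmetric] del: ennreal_plus)
qed

lemma inv_local_time_cell:
  assumes m: "z m \<in> R" "occupation R s z m \<le> t" "t < occupation R s z m + s m"
  shows "\<xi> (enn2real (inv_local_time R \<xi> (ennreal t))) = z m"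
proof -
  \<comment> \<open>Halfway between the local time still missing and the length of the cell: the
    local time has then strictly passed \<open>t\<close>, while the cell is not over yet.\<close>
  define r where "r = ((t - occupation R s z m) + s m) / 2"
  have r: "0 \<le> r" "r < s m" "t < occupation R s z m + r"
    using m clock_pos[of m] by (auto simp: r_def field_simps)
  have "0 \<le> t" using m(2) occupation_nonneg[of R m] by simp
  have lo: "ennreal (T m) \<le> inv_local_time R \<xi> (ennreal t)"
    using m by (intro le_inv_local_time) (simp add: local_time_ring ennreal_leI)
  have "ennreal t < local_time R \<xi> (ennreal (T m + r))"
    using r m \<open>0 \<le> t\<close> occupation_nonneg[of R m]
    by (simp add: local_time_cell local_time_ring ennreal_plus[symmetric] ennreal_less_iff del: ennreal_plus)
  then have hi: "inv_local_time R \<xi> (ennreal t) \<le> ennreal (T m + r)"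
    using r ring_nonneg[of m] by (intro inv_local_time_le) auto
  obtain i where i: "inv_local_time R \<xi> (ennreal t) = ennreal i" "0 \<le> i"
    using hi by (cases "inv_local_time R \<xi> (ennreal t)") (auto simp: top_unique)
  have "T m \<le> i" "i \<le> T m + r"
    using lo hi i ring_nonneg[of m] r
    by (auto simp: ennreal_le_iff ennreal_plus[symmetric] simp del: ennreal_plus)
  then show ?thesis using i r by (simp add: path_cell ring_Suc)
qed

text \<open>During a cell in \<open>R\<close> the local time of \<open>-R\<close> stands still. The
  strict inequality in \<open>inv_local_time\<close> makes it the right-continuous inverse, so a
  level \<open>\<kappa>\<close> equal to the occupation of \<open>-R\<close> is not passed before
  the end of the cell: hence \<open>\<le>\<close>, as in the soft kernel.\<close>

lemma exit_time_cell:
  assumes m: "z m \<in> R" "occupation R s z m \<le> t" "t < occupation R s z m + s m"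
  shows "ennreal t < local_time R \<xi> (inv_local_time (-R) \<xi> \<kappa>) \<longleftrightarrow> ennreal (occupation (-R) s z m) \<le> \<kappa>"
proof
  assume D: "ennreal (occupation (-R) s z m) \<le> \<kappa>"
  have "0 \<le> t" using m(2) occupation_nonneg[of R m] by simp
  then have "ennreal t < local_time R \<xi> (ennreal (T (Suc m)))"
    using m by (simp add: local_time_ring occupation_Suc ennreal_less_iff)
  also have "\<dots> \<le> local_time R \<xi> (inv_local_time (-R) \<xi> \<kappa>)"
    using D m by (intro local_time_mono le_inv_local_time) (simp add: local_time_ring occupation_Suc)
  finally show "ennreal t < local_time R \<xi> (inv_local_time (-R) \<xi> \<kappa>)" .
next
  assume less: "ennreal t < local_time R \<xi> (inv_local_time (-R) \<xi> \<kappa>)"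
  show "ennreal (occupation (-R) s z m) \<le> \<kappa>"
  proof (rule ccontr)
    assume "\<not> ennreal (occupation (-R) s z m) \<le> \<kappa>"
    then have "\<kappa> < local_time (-R) \<xi> (ennreal (T m))" by (simp add: local_time_ring)
    then have "inv_local_time (-R) \<xi> \<kappa> \<le> ennreal (T m)"
      using ring_nonneg by (intro inv_local_time_le) auto
    then have "local_time R \<xi> (inv_local_time (-R) \<xi> \<kappa>) \<le> ennreal (occupation R s z m)"
      unfolding local_time_ring[symmetric] by (rule local_time_mono)
    also have "\<dots> \<le> ennreal t" using m by (intro ennreal_leI)
    finally show False using less by simp
  qed
qed

text \<open>\<open>s 0 = T 1\<close> is the first ring, so cell 0 is excluded even when the path
  starts in \<open>R\<close>.\<close>

lemma first_time_from_cell: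
  assumes m: "0 < m" "z m \<in> R" "\<And>k. 0 < k \<Longrightarrow> k < m \<Longrightarrow> z k \<notin> R"
  shows "first_time_from (s 0) R \<xi> = ennreal (T m)"
  unfolding first_time_from_def
proof (rule antisym)
  have s0: "s 0 = T 1" by (simp add: T_def)
  have "\<xi> (T m) = z m" using ring_strict_mono by (intro path_cell) (auto simp: strict_mono_less)
  moreover have "s 0 \<le> T m" unfolding s0 using ring_strict_mono m(1) by (simp add: strict_mono_less_eq)
  ultimately show "Inf {ennreal u |u. s 0 \<le> u \<and> \<xi> u \<in> R} \<le> ennreal (T m)"
    using m by (intro Inf_lower) auto
  show "ennreal (T m) \<le> Inf {ennreal u |u. s 0 \<le> u \<and> \<xi> u \<in> R}"
  proof (rule Inf_greatest)
    fix v assume "v \<in> {ennreal u |u. s 0 \<le> u \<and> \<xi> u \<in> R}"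
    then obtain u where u: "v = ennreal u" "s 0 \<le> u" "\<xi> u \<in> R" by auto
    have "0 \<le> u" using u clock_pos[of 0] by simp
    then obtain k where k: "T k \<le> u" "u < T (Suc k)" by (rule cell_exists)
    have "z k \<in> R" using path_cell[OF k] u by simp
    moreover have "0 < k"
    proof -
      have "T 1 < T (Suc k)" using k u by (simp add: s0)
      then show ?thesis using ring_strict_mono by (simp add: strict_mono_less)
    qed
    ultimately have "m \<le> k" using m(3)[of k] by fastforce
    then have "T m \<le> u" using k ring_strict_mono by (meson order_trans strict_mono_less_eq)
    then show "ennreal (T m) \<le> v" unfolding u by (rule ennreal_leI)
  qed
qed

lemma path_ring: "\<xi> (T m) = z m"
  using ring_strict_mono by (intro path_cell) (auto simp: strict_mono_less)

end

section \<open>Independence and exponential clocks\<close>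

text \<open>Fubini for a product law, written with an independent copy \<open>\<omega>'\<close> on
  the same space so that no image measure appears in later integrals.\<close>

lemma (in prob_space) nn_integral_pair_distr:
  assumes X: "X \<in> M \<rightarrow>\<^sub>M N" and Y: "Y \<in> M \<rightarrow>\<^sub>M N'"
    and prod: "distr M N X \<Otimes>\<^sub>M distr M N' Y = distr M (N \<Otimes>\<^sub>M N') (\<lambda>\<omega>. (X \<omega>, Y \<omega>))"
    and f: "case_prod f \<in> borel_measurable (N \<Otimes>\<^sub>M N')"
  shows "(\<integral>\<^sup>+\<omega>. f (X \<omega>) (Y \<omega>) \<partial>M) = (\<integral>\<^sup>+\<omega>'. (\<integral>\<^sup>+\<omega>. f (X \<omega>) (Y \<omega>') \<partial>M) \<partial>M)"
proof -
  interpret X: prob_space "distr M N X" by (rule prob_space_distr[OF X])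
  interpret Y: prob_space "distr M N' Y" by (rule prob_space_distr[OF Y])
  interpret pair_sigma_finite "distr M N X" "distr M N' Y" ..
  have f': "case_prod f \<in> borel_measurable (distr M N X \<Otimes>\<^sub>M distr M N' Y)"
    using f by (simp cong: measurable_cong_sets)
  have "(\<integral>\<^sup>+\<omega>. f (X \<omega>) (Y \<omega>) \<partial>M) = (\<integral>\<^sup>+z. case_prod f z \<partial>distr M (N \<Otimes>\<^sub>M N') (\<lambda>\<omega>. (X \<omega>, Y \<omega>)))"
    using X Y f by (subst nn_integral_distr) auto
  also have "\<dots> = (\<integral>\<^sup>+y. (\<integral>\<^sup>+x. f x y \<partial>distr M N X) \<partial>distr M N' Y)"
    unfolding prod[symmetric] using nn_integral_snd[OF f'] by simp
  also have "\<dots> = (\<integral>\<^sup>+\<omega>'. (\<integral>\<^sup>+x. f x (Y \<omega>') \<partial>distr M N X) \<partial>M)"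
    using f' by (intro nn_integral_distr[OF Y]) (auto intro!: X.borel_measurable_nn_integral measurable_pair_swap cong: measurable_cong_sets)
  also have "\<dots> = (\<integral>\<^sup>+\<omega>'. (\<integral>\<^sup>+\<omega>. f (X \<omega>) (Y \<omega>') \<partial>M) \<partial>M)"
  proof (intro nn_integral_cong nn_integral_distr[OF X])
    fix \<omega>' assume "\<omega>' \<in> space M"
    then have "Y \<omega>' \<in> space N'" using Y by (rule measurable_space[rotated])
    then show "(\<lambda>x. f x (Y \<omega>')) \<in> borel_measurable (distr M N X)"
      using f by (simp cong: measurable_cong_sets)
  qed
  finally show ?thesis .
qed

lemma (in prob_space) independent_rv_nn_integral:
  assumes ind: "independent_rv M N X N' Y" and f: "case_prod f \<in> borel_measurable (N \<Otimes>\<^sub>M N')"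
  shows "(\<integral>\<^sup>+\<omega>. f (X \<omega>) (Y \<omega>) \<partial>M) = (\<integral>\<^sup>+\<omega>'. (\<integral>\<^sup>+\<omega>. f (X \<omega>) (Y \<omega>') \<partial>M) \<partial>M)"
proof -
  have X: "X \<in> M \<rightarrow>\<^sub>M N" and Y: "Y \<in> M \<rightarrow>\<^sub>M N'"
    and I: "indep_set {X -` A \<inter> space M | A. A \<in> sets N} {Y -` B \<inter> space M | B. B \<in> sets N'}"
    using ind by (auto simp: independent_rv_def)
  interpret X: prob_space "distr M N X" by (rule prob_space_distr[OF X])
  interpret Y: prob_space "distr M N' Y" by (rule prob_space_distr[OF Y])
  have "distr M N X \<Otimes>\<^sub>M distr M N' Y = distr M (N \<Otimes>\<^sub>M N') (\<lambda>\<omega>. (X \<omega>, Y \<omega>))"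
  proof (rule pair_measure_eqI)
    fix A B assume A: "A \<in> sets (distr M N X)" and B: "B \<in> sets (distr M N' Y)"
    have eq: "(\<lambda>\<omega>. (X \<omega>, Y \<omega>)) -` (A \<times> B) \<inter> space M = (X -` A \<inter> space M) \<inter> (Y -` B \<inter> space M)"
      by auto
    have "prob ((X -` A \<inter> space M) \<inter> (Y -` B \<inter> space M)) = prob (X -` A \<inter> space M) * prob (Y -` B \<inter> space M)"
      using A B by (intro indep_setD[OF I]) auto
    then show "emeasure (distr M N X) A * emeasure (distr M N' Y) B
        = emeasure (distr M (N \<Otimes>\<^sub>M N') (\<lambda>\<omega>. (X \<omega>, Y \<omega>))) (A \<times> B)"
      using A B X Y by (simp add: emeasure_distr eq emeasure_eq_measure ennreal_mult)
  qed (simp_all add: X.sigma_finite_measure_axioms Y.sigma_finite_measure_axioms cong: sets_pair_measure_cong)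
  from nn_integral_pair_distr[OF X Y this f] show ?thesis .
qed

lemma (in prob_space) indep_var_nn_integral:
  assumes "indep_var borel X borel Y"
    and "f \<in> borel_measurable borel" "g \<in> borel_measurable borel"
  shows "(\<integral>\<^sup>+\<omega>. f (X \<omega>) * g (Y \<omega>) \<partial>M) = (\<integral>\<^sup>+\<omega>. f (X \<omega>) \<partial>M) * (\<integral>\<^sup>+\<omega>. g (Y \<omega>) \<partial>M)"
proof -
  have X: "random_variable borel X" and Y: "random_variable borel Y"
    and prod: "distr M borel X \<Otimes>\<^sub>M distr M borel Y = distr M (borel \<Otimes>\<^sub>M borel) (\<lambda>\<omega>. (X \<omega>, Y \<omega>))"
    using assms(1) by (auto simp: indep_var_distribution_eq)
  note [measurable] = X Y assms(2,3)
  have "(\<integral>\<^sup>+\<omega>. f (X \<omega>) * g (Y \<omega>) \<partial>M) = (\<integral>\<^sup>+\<omega>'. (\<integral>\<^sup>+\<omega>. f (X \<omega>) * g (Y \<omega>') \<partial>M) \<partial>M)"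
    by (rule nn_integral_pair_distr[OF X Y prod, where f="\<lambda>x y. f x * g y"]) measurable
  then show ?thesis by (simp add: nn_integral_multc nn_integral_cmult)
qed

text \<open>The absence of atoms lets \<open>\<le>\<close> replace \<open><\<close> in the law of
  the killing time.\<close>

lemma (in prob_space) exponential_neq_AE:
  assumes "distributed M lborel X (exponential_density l)"
  shows "AE \<omega> in M. X \<omega> \<noteq> d"
proof -
  have "emeasure M (X -` {d} \<inter> space M) = (\<integral>\<^sup>+x. ennreal (exponential_density l x) * indicator {d} x \<partial>lborel)"
    by (rule distributed_emeasure[OF assms]) simp
  also have "\<dots> = 0" by (rule nn_integral_null_set) (simp add: finite_imp_null_set_lborel)
  finally have "emeasure M (X -` {d} \<inter> space M) = 0" .
  moreover have "X \<in> borel_measurable M" using distributed_measurable[OF assms] by simp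
  ultimately show ?thesis
    by (intro AE_I[of _ _ "X -` {d} \<inter> space M"]) auto
qed

lemma (in prob_space) exponential_pos_AE:
  assumes "distributed M lborel X (exponential_density l)" "0 < l"
  shows "AE \<omega> in M. 0 < X \<omega>"
proof -
  have [measurable]: "X \<in> borel_measurable M" using distributed_measurable[OF assms(1)] by simp
  have "\<P>(\<omega> in M. 0 < X \<omega>) = 1"
    using exponential_distributedD_gt[OF assms(1) _ assms(2), of 0] by simp
  then show ?thesis by (subst (asm) prob_Collect_eq_1) auto
qed

text \<open>The probability that the killing time is at least \<open>d\<close>, with the degenerate
  laws at 0 and \<open>top\<close> included. For negative \<open>d\<close> it is 1, in accordance
  with the truncation by \<open>ennreal\<close>.\<close>

definition survival :: "ennreal \<Rightarrow> real \<Rightarrow> real" where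
  "survival lam d = (if lam = 0 then 1 else if lam = top then (if d \<le> 0 then 1 else 0)
     else exp (- enn2real lam * max 0 d))"

text \<open>The Laplace transform of a unit exponential variable at \<open>lam\<close>. Inversion in
  \<open>ennreal\<close> is continuous and sends \<open>top\<close> to 0, which covers both
  endpoints at once.\<close>

definition laplace :: "ennreal \<Rightarrow> real" where
  "laplace lam = enn2real (inverse (1 + lam))"

lemma laplace_simps: "laplace 0 = 1" "laplace top = 0"
    "lam \<noteq> top \<Longrightarrow> laplace lam = 1 / (1 + enn2real lam)"
proof -
  show "laplace lam = 1 / (1 + enn2real lam)" if lam: "lam \<noteq> top"
  proof -
    obtain l where l: "lam = ennreal l" "0 \<le> l" using lam by (cases lam) auto
    have "1 + lam = ennreal (1 + l)" using l by simp
    then have "inverse (1 + lam) = ennreal (inverse (1 + l))"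
      using l inverse_ennreal[of "1 + l"] by simp
    then show ?thesis using l by (simp add: laplace_def inverse_eq_divide)
  qed
qed (simp_all add: laplace_def)

lemma laplace_bounds: "0 \<le> laplace lam" "laplace lam \<le> 1"
proof -
  show "0 \<le> laplace lam" by (simp add: laplace_def)
  have "1 / (1 + enn2real lam) \<le> 1" by (subst divide_le_eq_1_pos) (auto intro!: add_pos_nonneg)
  then show "laplace lam \<le> 1" by (cases "lam = top") (simp_all add: laplace_simps)
qed

lemma laplace_tendsto: "(laplace \<longlongrightarrow> laplace lam0) (at lam0)"
proof -
  have "continuous_on UNIV (\<lambda>lam::ennreal. inverse (1 + lam))"
    by (intro continuous_intros)
  then have "((\<lambda>lam. inverse (1 + lam)) \<longlongrightarrow> inverse (1 + lam0)) (at lam0)"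
    by (auto simp: continuous_on_def)
  moreover have "inverse (1 + lam0) < top"
    by (simp add: less_top[symmetric])
  ultimately show ?thesis
    unfolding laplace_def[abs_def] by (intro tendsto_enn2real) auto
qed

lemma survival_measurable [measurable]: "survival lam \<in> borel_measurable borel"
  unfolding survival_def[abs_def] by measurable

lemma survival_nonneg: "0 \<le> survival lam d"
  by (simp add: survival_def)

text \<open>Memorylessness. It extends to \<open>lam = top\<close>, where a sum of nonnegative terms
  is 0 only if each of them is.\<close>

lemma survival_sum:
  assumes "finite J" "\<And>k. k \<in> J \<Longrightarrow> 0 \<le> s k"
  shows "survival lam (\<Sum>k\<in>J. s k) = (\<Prod>k\<in>J. survival lam (s k))"
  using assms
proof (induction J)
  case empty
  then show ?case by (simp add: survival_def)
next
  case (insert k J)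
  then have "0 \<le> (\<Sum>k\<in>J. s k)" "0 \<le> s k" by (auto intro!: sum_nonneg)
  moreover have "survival lam (a + b) = survival lam a * survival lam b" if "0 \<le> a" "0 \<le> b" for a b
    using that by (auto simp: survival_def algebra_simps simp flip: exp_add)
  ultimately show ?case using insert by simp
qed

lemma (in prob_space) nn_integral_survival:
  assumes D: "distributed M lborel X (exponential_density 1)"
  shows "(\<integral>\<^sup>+\<omega>. ennreal (survival lam (X \<omega>)) \<partial>M) = ennreal (laplace lam)"
proof -
  consider "lam = 0" | "lam = top" | "lam \<noteq> 0" "lam \<noteq> top" by auto
  then show ?thesis
  proof cases
    case 1
    then show ?thesis by (simp add: survival_def laplace_simps emeasure_space_1)
  next
    case 2
    have "(\<integral>\<^sup>+\<omega>. ennreal (survival lam (X \<omega>)) \<partial>M) = (\<integral>\<^sup>+\<omega>. 0 \<partial>M)"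
      using exponential_pos_AE[OF D]
      by (intro nn_integral_cong_AE) (auto simp: 2 survival_def elim!: eventually_mono)
    then show ?thesis by (simp add: 2 laplace_simps)
  next
    case 3
    define l where "l = enn2real lam"
    have l: "l > 0" using 3 by (auto simp: l_def enn2real_positive_iff less_top zero_less_iff_neq_zero)
    have "(\<integral>\<^sup>+\<omega>. ennreal (survival lam (X \<omega>)) \<partial>M)
        = (\<integral>\<^sup>+x. ennreal (exponential_density 1 x) * ennreal (survival lam x) \<partial>lborel)"
      by (rule distributed_nn_integral[OF D, symmetric]) measurable
    also have "\<dots> = (\<integral>\<^sup>+x. ennreal (1 / (1 + l)) * ennreal (exponential_density (1 + l) x) \<partial>lborel)"
    proof (rule nn_integral_cong)
      fix x
      \<comment> \<open>Exponential tilting: the product is a multiple of the density of rate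
        \<open>1 + l\<close>, whose mass is 1.\<close>
      have "exponential_density 1 x * survival lam x = 1 / (1 + l) * exponential_density (1 + l) x"
      proof (cases "x < 0")
        case False
        have "exp (- x) * exp (- l * x) = exp (- x * (1 + l))"
          unfolding exp_add[symmetric] by (simp add: algebra_simps)
        then show ?thesis
          using False 3 l by (simp add: survival_def exponential_density_def flip: l_def)
      qed (simp add: exponential_density_def)
      then show "ennreal (exponential_density 1 x) * ennreal (survival lam x)
          = ennreal (1 / (1 + l)) * ennreal (exponential_density (1 + l) x)"
        using l survival_nonneg by (simp add: ennreal_mult[symmetric] del: times_divide_eq_left)
    qed
    also have "\<dots> = ennreal (1 / (1 + l)) * (\<integral>\<^sup>+x. ennreal (exponential_density (1 + l) x) \<partial>lborel)"
      by (intro nn_integral_cmult) measurable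
    also have "(\<integral>\<^sup>+x. ennreal (exponential_density (1 + l) x) \<partial>lborel) = 1"
      using prob_space.emeasure_space_1[OF prob_space_exponential_density[of "1 + l"]] l
      by (simp add: emeasure_density)
    finally show ?thesis using 3 by (simp add: laplace_simps l_def)
  qed
qed

section \<open>Weights of finite trajectories\<close>

primrec path_weight :: "('a \<Rightarrow> 'a pmf) \<Rightarrow> 'a \<Rightarrow> 'a list \<Rightarrow> real" where
  "path_weight p x [] = 1"
| "path_weight p x (z # zs) = pmf (p x) z * path_weight p z zs"

lemma path_weight_eq_prod:
  "path_weight p x zs = (\<Prod>i<length zs. pmf (p ((x # zs) ! i)) ((x # zs) ! Suc i))"
proof (induction zs arbitrary: x)
  case (Cons z zs)
  show ?case
    unfolding path_weight.simps Cons.IH list.size(4) add_Suc_right add_0_right prod.lessThan_Suc_shift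
    by simp
qed simp

lemma path_weight_nonneg: "0 \<le> path_weight p x zs"
  by (induction zs arbitrary: x) auto

lemma sum_lists_Suc:
  fixes f :: "'a::finite list \<Rightarrow> real"
  shows "(\<Sum>zs | length zs = Suc m \<and> P zs. f zs) = (\<Sum>z\<in>UNIV. \<Sum>zs | length zs = m \<and> P (z # zs). f (z # zs))"
proof -
  have fin: "finite {zs :: 'a list. length zs = m \<and> Q zs}" for Q
    by (rule finite_subset[OF _ finite_lists_length_eq[of UNIV m]]) auto
  have "(\<Sum>z\<in>UNIV. \<Sum>zs | length zs = m \<and> P (z # zs). f (z # zs))
      = (\<Sum>(z, zs)\<in>(SIGMA z:UNIV. {zs. length zs = m \<and> P (z # zs)}). f (z # zs))"
    using fin by (intro sum.Sigma) auto
  also have "\<dots> = (\<Sum>zs | length zs = Suc m \<and> P zs. f zs)"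
    by (rule sum.reindex_bij_witness[where j="\<lambda>(z, zs). z # zs" and i="\<lambda>zs. (hd zs, tl zs)"])
      (auto simp: length_Suc_conv)
  finally show ?thesis by simp
qed

lemma card_positions_Cons:
  "card {k. k < Suc m \<and> Q ((x # xs) ! k)} = (if Q x then 1 else 0) + card {k. k < m \<and> Q (xs ! k)}"
proof -
  have "{k. k < Suc m \<and> Q ((x # xs) ! k)} = (if Q x then {0} else {}) \<union> Suc ` {k. k < m \<and> Q (xs ! k)}"
    (is "?L = ?R")
  proof (rule set_eqI)
    fix k
    show "k \<in> ?L \<longleftrightarrow> k \<in> ?R" by (cases k) auto
  qed
  then show ?thesis by (auto simp: card_image card_insert_if)
qed

text \<open>The trajectories are sorted by the number \<open>i\<close> of steps that start in
  \<open>R\<close>. The weight \<open>\<phi>\<close> is kept arbitrary because a first step from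
  \<open>R\<close> shifts its argument in the induction.\<close>

lemma sum_path_weight:
  fixes p :: "'a::finite \<Rightarrow> 'a pmf"
  assumes "0 \<le> \<theta>" "\<theta> \<le> 1"
  shows "(\<Sum>zs | length zs = m \<and> last (x # zs) = y. path_weight p x zs *
      (\<phi> (card {k. k < m \<and> (x # zs) ! k \<in> R}) * \<theta> ^ card {k. k < m \<and> (x # zs) ! k \<notin> R}))
    = (\<Sum>i\<le>m. \<phi> i * visit_weight p R \<theta> m i x y)"
proof (induction m arbitrary: x \<phi>)
  case 0
  have "{zs. length zs = 0 \<and> last (x # zs) = y} = (if x = y then {[]} else {})" by auto
  then show ?case by simp
next
  case (Suc m)
  note cR = card_positions_Cons[where Q="\<lambda>u. u \<in> R"] card_positions_Cons[where Q="\<lambda>u. u \<notin> R"]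
  have "(\<Sum>zs | length zs = Suc m \<and> last (x # zs) = y. path_weight p x zs *
      (\<phi> (card {k. k < Suc m \<and> (x # zs) ! k \<in> R}) * \<theta> ^ card {k. k < Suc m \<and> (x # zs) ! k \<notin> R}))
    = (\<Sum>z\<in>UNIV. pmf (p x) z * (\<Sum>zs | length zs = m \<and> last (z # zs) = y. path_weight p z zs *
      (\<phi> ((if x \<in> R then 1 else 0) + card {k. k < m \<and> (z # zs) ! k \<in> R}) *
        \<theta> ^ ((if x \<notin> R then 1 else 0) + card {k. k < m \<and> (z # zs) ! k \<notin> R}))))"
    unfolding sum_lists_Suc cR sum_distrib_left by (simp add: mult.assoc)
  also have "\<dots> = (\<Sum>i\<le>Suc m. \<phi> i * visit_weight p R \<theta> (Suc m) i x y)"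
  proof (cases "x \<in> R")
    case True
    then have "(\<Sum>i\<le>Suc m. \<phi> i * visit_weight p R \<theta> (Suc m) i x y)
        = (\<Sum>z\<in>UNIV. pmf (p x) z * (\<Sum>i\<le>m. \<phi> (Suc i) * visit_weight p R \<theta> m i z y))"
      unfolding sum.atMost_Suc_shift sum_distrib_left
      by (subst sum.swap) (simp add: sum_distrib_left mult_ac)
    then show ?thesis using True Suc.IH[of _ "\<lambda>i. \<phi> (Suc i)"] by simp
  next
    case False
    \<comment> \<open>This removes the summand \<open>i = Suc m\<close> of the longer sum:
      \<open>m\<close> steps cannot start \<open>Suc m\<close> times in \<open>R\<close>.\<close>
    have 0: "visit_weight p R \<theta> m (Suc m) z y = 0" for z
      by (rule visit_weight_eq_0[OF assms]) simp
    have "(\<Sum>i\<le>Suc m. \<phi> i * visit_weight p R \<theta> (Suc m) i x y)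
        = (\<Sum>z\<in>UNIV. pmf (p x) z * (\<theta> * (\<Sum>i\<le>m. \<phi> i * visit_weight p R \<theta> m i z y)))"
      using False unfolding sum_distrib_left
      by (subst sum.swap) (simp add: sum_distrib_left mult_ac 0)
    also have "\<dots> = (\<Sum>z\<in>UNIV. pmf (p x) z * (\<Sum>zs | length zs = m \<and> last (z # zs) = y. path_weight p z zs *
      (\<phi> (card {k. k < m \<and> (z # zs) ! k \<in> R}) * \<theta> ^ (Suc (card {k. k < m \<and> (z # zs) ! k \<notin> R})))))"
      unfolding Suc.IH[symmetric] sum_distrib_left[of \<theta>] by (simp add: mult.left_commute)
    finally show ?thesis using False by simp
  qed
  finally show ?case .
qed

section \<open>The joint law of the clock, the chain and the killing\<close>

context rate_one_process
begin

lemma S_measurable [measurable]: "S n \<in> borel_measurable (P x)"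
  using distributed_measurable[OF clock_exponential] by simp

lemmas Z_measurable [measurable] = chain_measurable

lemma clock_measurable [measurable]: "(\<lambda>\<omega> n. S n \<omega>) \<in> P x \<rightarrow>\<^sub>M Pi\<^sub>M UNIV (\<lambda>_. borel)"
  and trajectory_measurable [measurable]: "(\<lambda>\<omega> n. Z n \<omega>) \<in> P x \<rightarrow>\<^sub>M Pi\<^sub>M UNIV (\<lambda>_. count_space UNIV)"
  using clock_chain_indep by (auto simp: independent_rv_def)

lemma killing_measurable: "0 < l \<Longrightarrow> \<sigma> l \<in> borel_measurable (P x)"
  using killing_indep by (auto simp: independent_rv_def)

lemma killing_time_measurable [measurable]: "killing_time \<sigma> lam \<in> borel_measurable (P x)"
proof -
  consider "lam = 0" | "lam = top" | "lam \<noteq> 0" "lam \<noteq> top" by auto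
  then show ?thesis
  proof cases
    case 3
    then have "0 < enn2real lam" by (auto simp: enn2real_positive_iff less_top zero_less_iff_neq_zero)
    from killing_measurable[OF this] 3 show ?thesis
      unfolding killing_time_def[abs_def] by simp
  qed (simp_all add: killing_time_def[abs_def])
qed

lemma clock_pos_AE: "AE \<omega> in P x. \<forall>n. 0 < S n \<omega>"
proof -
  interpret prob_space "P x" by (rule prob_space_P)
  show ?thesis
    unfolding AE_all_countable using exponential_pos_AE[OF clock_exponential] by simp
qed

text \<open>The sum has an Erlang law, whose distribution function is a Poisson tail. The empty sum
  is treated apart because the Erlang index is \<open>card I - 1\<close>.\<close>

lemma ring_time_le:
  assumes "finite I" "0 \<le> t"
  shows "\<P>(\<omega> in P x. (\<Sum>i\<in>I. S i \<omega>) \<le> t) = 1 - (\<Sum>n<card I. poisson_weight t n)"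
proof (cases "I = {}")
  case True
  interpret prob_space "P x" by (rule prob_space_P)
  show ?thesis using True assms by (simp add: prob_space)
next
  case False
  interpret prob_space "P x" by (rule prob_space_P)
  have "distributed (P x) lborel (\<lambda>\<omega>. \<Sum>i\<in>I. S i \<omega>) (erlang_density (card I - 1) 1)"
    using assms False clock_exponential
    by (intro exponential_distributed_sum indep_vars_subset[OF clock_indep]) auto
  then have "\<P>(\<omega> in P x. (\<Sum>i\<in>I. S i \<omega>) \<le> t) = erlang_CDF (card I - 1) 1 t"
    by (rule erlang_distributed_le) (use assms in auto)
  also have "\<dots> = 1 - (\<Sum>n\<le>card I - 1. poisson_weight t n)"
    using assms by (simp add: erlang_CDF_def poisson_weight_def mult.commute)
  also have "{..card I - 1} = {..<card I}"
  proof -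
    have "card I \<noteq> 0" using False assms by simp
    then show ?thesis by auto
  qed
  finally show ?thesis .
qed

lemma good_clock_AE: "AE \<omega> in P x. good_clock (\<lambda>n. S n \<omega>)"
proof -
  interpret prob_space "P x" by (rule prob_space_P)
  have "AE \<omega> in P x. \<exists>n. real N < (\<Sum>k\<le>n. S k \<omega>)" for N
  proof -
    define B where "B = {\<omega> \<in> space (P x). \<not> (\<exists>n. real N < (\<Sum>k\<le>n. S k \<omega>))}"
    \<comment> \<open>A clock that never passes level \<open>N\<close> has its first
      \<open>Suc n\<close> rings below \<open>N\<close> for every \<open>n\<close>; the probability
      of this is a Poisson tail, which tends to 0.\<close>
    have "prob B \<le> 1 - (\<Sum>j<Suc n. poisson_weight (real N) j)" for n
    proof -
      have "prob B \<le> \<P>(\<omega> in P x. (\<Sum>i\<in>{..n}. S i \<omega>) \<le> real N)"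
        by (intro finite_measure_mono) (auto simp: B_def not_less)
      then show ?thesis by (subst (asm) ring_time_le) auto
    qed
    moreover have "(\<lambda>n. 1 - (\<Sum>j<Suc n. poisson_weight (real N) j)) \<longlonglongrightarrow> 1 - 1"
      using poisson_weight_sums[of "real N"] unfolding sums_def
      by (intro tendsto_intros) (rule LIMSEQ_Suc)
    ultimately have "prob B \<le> 1 - 1"
      by (intro LIMSEQ_le_const) auto
    then have "prob B = 0" using measure_nonneg[of "P x" B] by simp
    moreover have "B \<in> events" unfolding B_def by measurable
    ultimately show ?thesis
      by (intro AE_I[of _ _ B]) (auto simp: B_def emeasure_eq_measure)
  qed
  then have "AE \<omega> in P x. \<forall>N::nat. \<exists>n. real N < (\<Sum>k\<le>n. S k \<omega>)"
    by (simp add: AE_all_countable)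
  with clock_pos_AE show ?thesis
    by eventually_elim (simp add: good_clock_iff)
qed

lemma killing_survival:
  assumes "0 < l"
  shows "emeasure (P x) {\<omega> \<in> space (P x). ennreal d \<le> ennreal (\<sigma> l \<omega>)} = ennreal (exp (- l * max 0 d))"
proof -
  interpret prob_space "P x" by (rule prob_space_P)
  note [measurable] = killing_measurable[OF assms]
  show ?thesis
  proof (cases "d \<le> 0")
    case True
    then show ?thesis by (simp add: ennreal_neg emeasure_space_1)
  next
    case False
    then have "emeasure (P x) {\<omega> \<in> space (P x). ennreal d \<le> ennreal (\<sigma> l \<omega>)}
        = emeasure (P x) {\<omega> \<in> space (P x). d \<le> \<sigma> l \<omega>}"
      by (intro arg_cong[where f="emeasure (P x)"]) (auto simp: ennreal_le_iff2)
    also have "\<dots> = emeasure (P x) {\<omega> \<in> space (P x). d < \<sigma> l \<omega>}"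
      using exponential_neq_AE[OF killing_exponential[OF assms], of d]
      by (intro emeasure_eq_AE) (auto elim!: eventually_mono)
    also have "\<dots> = ennreal (exp (- d * l))"
      using exponential_distributedD_gt[OF killing_exponential[OF assms], of d] False assms
      by (simp add: emeasure_eq_measure)
    finally show ?thesis using False by (simp add: mult.commute)
  qed
qed

text \<open>The killing time is integrated out first, by its independence of clock and chain, and
  leaves the factor \<open>survival\<close>; then the chain separates from the clock.
  \<open>J\<close> stands for the steps outside \<open>R\<close>, which are determined once the
  trajectory is fixed.\<close>

lemma path_event_emeasure:
  assumes J: "finite J" and G [measurable]: "G \<in> sets (Pi\<^sub>M UNIV (\<lambda>_. borel))"
  shows "emeasure (P x) {\<omega> \<in> space (P x). (\<forall>i\<le>m. Z i \<omega> = z i) \<and> (\<lambda>n. S n \<omega>) \<in> G \<and>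
      ennreal (\<Sum>k\<in>J. S k \<omega>) \<le> killing_time \<sigma> lam \<omega>}
    = ennreal (\<P>(\<omega> in P x. \<forall>i\<le>m. Z i \<omega> = z i)) *
      (\<integral>\<^sup>+\<omega>. indicator G (\<lambda>n. S n \<omega>) * ennreal (survival lam (\<Sum>k\<in>J. S k \<omega>)) \<partial>P x)"
    (is "emeasure _ ?E = _")
proof -
  interpret prob_space "P x" by (rule prob_space_P)
  define A :: "(nat \<Rightarrow> 'a) set" where "A = {w. \<forall>i\<le>m. w i = z i}"
  define D :: "(nat \<Rightarrow> real) \<Rightarrow> real" where "D = (\<lambda>s. \<Sum>k\<in>J. s k)"
  define F :: "(nat \<Rightarrow> real) \<times> (nat \<Rightarrow> 'a) \<Rightarrow> ennreal" where "F = (\<lambda>(s, w). indicator A w * indicator G s)"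
  have A [measurable]: "A \<in> sets (Pi\<^sub>M UNIV (\<lambda>_. count_space UNIV))"
  proof -
    have "A = {w \<in> space (Pi\<^sub>M UNIV (\<lambda>_. count_space UNIV)). \<forall>i\<le>m. w i = z i}"
      by (simp add: A_def space_PiM)
    also have "\<dots> \<in> sets (Pi\<^sub>M UNIV (\<lambda>_. count_space UNIV))" by measurable
    finally show ?thesis .
  qed
  have D [measurable]: "D \<in> borel_measurable (Pi\<^sub>M UNIV (\<lambda>_. borel))"
    unfolding D_def by measurable
  have F [measurable]: "F \<in> borel_measurable (Pi\<^sub>M UNIV (\<lambda>_. borel) \<Otimes>\<^sub>M Pi\<^sub>M UNIV (\<lambda>_. count_space UNIV))"
    unfolding F_def by measurable
  let ?SZ = "\<lambda>\<omega>. (\<lambda>n. S n \<omega>, \<lambda>n. Z n \<omega>)"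
  have "emeasure (P x) ?E
      = (\<integral>\<^sup>+\<omega>. F (?SZ \<omega>) * indicator {\<omega>. ennreal (D (\<lambda>n. S n \<omega>)) \<le> killing_time \<sigma> lam \<omega>} \<omega> \<partial>P x)"
  proof (subst nn_integral_indicator[symmetric])
    show "?E \<in> events" by measurable
    show "(\<integral>\<^sup>+\<omega>. indicator ?E \<omega> \<partial>P x) = (\<integral>\<^sup>+\<omega>. F (?SZ \<omega>) *
        indicator {\<omega>. ennreal (D (\<lambda>n. S n \<omega>)) \<le> killing_time \<sigma> lam \<omega>} \<omega> \<partial>P x)"
      by (intro nn_integral_cong) (auto simp: F_def A_def D_def indicator_def)
  qed
  also have "\<dots> = (\<integral>\<^sup>+\<omega>. F (?SZ \<omega>) * ennreal (survival lam (D (\<lambda>n. S n \<omega>))) \<partial>P x)"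
  proof -
    consider "lam = 0" | "lam = top" | "lam \<noteq> 0" "lam \<noteq> top" by auto
    then show ?thesis
    proof cases
      case 1
      then show ?thesis by (simp add: killing_time_def survival_def)
    next
      case 2
      then show ?thesis
        by (intro nn_integral_cong) (auto simp: killing_time_def survival_def indicator_def ennreal_eq_0_iff)
    next
      case 3
      define l where "l = enn2real lam"
      have l: "0 < l" using 3 by (auto simp: l_def enn2real_positive_iff less_top zero_less_iff_neq_zero)
      note [measurable] = killing_measurable[OF l]
      let ?f = "\<lambda>a y. F y * indicator {(u, v). ennreal (D (fst v)) \<le> ennreal u} (a, y)"
      have "(\<integral>\<^sup>+\<omega>. F (?SZ \<omega>) * indicator {\<omega>. ennreal (D (\<lambda>n. S n \<omega>)) \<le> killing_time \<sigma> lam \<omega>} \<omega> \<partial>P x)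
          = (\<integral>\<^sup>+\<omega>. ?f (\<sigma> l \<omega>) (?SZ \<omega>) \<partial>P x)"
        using 3 by (intro nn_integral_cong) (auto simp: killing_time_def l_def indicator_def)
      also have "\<dots> = (\<integral>\<^sup>+\<omega>'. (\<integral>\<^sup>+\<omega>. ?f (\<sigma> l \<omega>) (?SZ \<omega>') \<partial>P x) \<partial>P x)"
        by (rule independent_rv_nn_integral[OF killing_indep[OF l]]) measurable
      also have "\<dots> = (\<integral>\<^sup>+\<omega>'. F (?SZ \<omega>') * ennreal (survival lam (D (\<lambda>n. S n \<omega>'))) \<partial>P x)"
      proof (rule nn_integral_cong)
        fix \<omega>'
        let ?d = "D (\<lambda>n. S n \<omega>')"
        have "(\<integral>\<^sup>+\<omega>. ?f (\<sigma> l \<omega>) (?SZ \<omega>') \<partial>P x)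
            = (\<integral>\<^sup>+\<omega>. F (?SZ \<omega>') * indicator {\<omega> \<in> space (P x). ennreal ?d \<le> ennreal (\<sigma> l \<omega>)} \<omega> \<partial>P x)"
          by (intro nn_integral_cong) (auto simp: indicator_def)
        also have "\<dots> = F (?SZ \<omega>') * emeasure (P x) {\<omega> \<in> space (P x). ennreal ?d \<le> ennreal (\<sigma> l \<omega>)}"
          by (rule nn_integral_cmult_indicator) measurable
        finally show "(\<integral>\<^sup>+\<omega>. ?f (\<sigma> l \<omega>) (?SZ \<omega>') \<partial>P x) = F (?SZ \<omega>') * ennreal (survival lam ?d)"
          unfolding killing_survival[OF l] using 3 by (simp add: survival_def l_def)
      qed
      finally show ?thesis .
    qed
  qed
  also have "\<dots> = (\<integral>\<^sup>+\<omega>. indicator A (\<lambda>n. Z n \<omega>) *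
      (indicator G (\<lambda>n. S n \<omega>) * ennreal (survival lam (D (\<lambda>n. S n \<omega>)))) \<partial>P x)"
    by (simp add: F_def mult.assoc)
  also have "\<dots> = (\<integral>\<^sup>+\<omega>'. (\<integral>\<^sup>+\<omega>. indicator A (\<lambda>n. Z n \<omega>') *
      (indicator G (\<lambda>n. S n \<omega>) * ennreal (survival lam (D (\<lambda>n. S n \<omega>)))) \<partial>P x) \<partial>P x)"
    by (rule independent_rv_nn_integral[OF clock_chain_indep,
          where f="\<lambda>s w. indicator A w * (indicator G s * ennreal (survival lam (D s)))"]) measurable
  also have "\<dots> = (\<integral>\<^sup>+\<omega>'. indicator A (\<lambda>n. Z n \<omega>') \<partial>P x) *
      (\<integral>\<^sup>+\<omega>. indicator G (\<lambda>n. S n \<omega>) * ennreal (survival lam (D (\<lambda>n. S n \<omega>))) \<partial>P x)"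
    by (subst nn_integral_cmult, measurable) (subst nn_integral_multc, measurable)
  also have "(\<integral>\<^sup>+\<omega>'. indicator A (\<lambda>n. Z n \<omega>') \<partial>P x) = emeasure (P x) {\<omega> \<in> space (P x). \<forall>i\<le>m. Z i \<omega> = z i}"
  proof (subst nn_integral_indicator[symmetric])
    show "(\<integral>\<^sup>+\<omega>'. indicator A (\<lambda>n. Z n \<omega>') \<partial>P x)
        = (\<integral>\<^sup>+\<omega>. indicator {\<omega> \<in> space (P x). \<forall>i\<le>m. Z i \<omega> = z i} \<omega> \<partial>P x)"
      by (intro nn_integral_cong) (auto simp: A_def indicator_def)
  qed measurable
  finally show ?thesis by (simp add: D_def emeasure_eq_measure)
qed

lemma nn_integral_survival_prod:
  assumes "finite J"
  shows "(\<integral>\<^sup>+\<omega>. ennreal (survival lam (\<Sum>k\<in>J. S k \<omega>)) \<partial>P x) = ennreal (laplace lam ^ card J)"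
proof -
  interpret prob_space "P x" by (rule prob_space_P)
  have "(\<integral>\<^sup>+\<omega>. ennreal (survival lam (\<Sum>k\<in>J. S k \<omega>)) \<partial>P x)
      = (\<integral>\<^sup>+\<omega>. (\<Prod>k\<in>J. ennreal (survival lam (S k \<omega>))) \<partial>P x)"
  proof (rule nn_integral_cong_AE)
    show "AE \<omega> in P x. ennreal (survival lam (\<Sum>k\<in>J. S k \<omega>)) = (\<Prod>k\<in>J. ennreal (survival lam (S k \<omega>)))"
      using clock_pos_AE
    proof eventually_elim
      case (elim \<omega>)
      then show ?case
        using survival_sum[OF assms, of "\<lambda>k. S k \<omega>" lam] survival_nonneg
        by (simp add: prod_ennreal less_imp_le)
    qed
  qed
  also have "\<dots> = (\<Prod>k\<in>J. \<integral>\<^sup>+\<omega>. ennreal (survival lam (S k \<omega>)) \<partial>P x)"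
  proof (rule indep_vars_nn_integral[OF assms])
    show "indep_vars (\<lambda>_. borel) (\<lambda>i x. ennreal (survival lam (S i x))) J"
      by (rule indep_vars_compose2[OF indep_vars_subset[OF clock_indep]]) auto
  qed simp
  also have "\<dots> = ennreal (laplace lam ^ card J)"
    by (simp add: nn_integral_survival[OF clock_exponential] ennreal_power laplace_bounds)
  finally show ?thesis .
qed

text \<open>The sum over \<open>I\<close> has been passed at \<open>t\<close>, that over
  \<open>insert m I\<close> has not: the difference of two consecutive Poisson tails is a single
  weight.\<close>

lemma clock_interval:
  assumes I: "finite I" "m \<notin> I" and t: "0 \<le> t"
  shows "\<P>(\<omega> in P x. (\<Sum>i\<in>I. S i \<omega>) \<le> t \<and> t < (\<Sum>i\<in>I. S i \<omega>) + S m \<omega>) = poisson_weight t (card I)"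
proof -
  interpret prob_space "P x" by (rule prob_space_P)
  let ?A = "{\<omega> \<in> space (P x). (\<Sum>i\<in>I. S i \<omega>) \<le> t}"
  let ?B = "{\<omega> \<in> space (P x). (\<Sum>i\<in>insert m I. S i \<omega>) \<le> t}"
  let ?E = "{\<omega> \<in> space (P x). (\<Sum>i\<in>I. S i \<omega>) \<le> t \<and> t < (\<Sum>i\<in>I. S i \<omega>) + S m \<omega>}"
  have "prob (?E \<union> (?A - ?E)) = prob ?E + prob (?A - ?E)"
    by (intro finite_measure_Union) auto
  moreover have "?E \<union> (?A - ?E) = ?A" by auto
  \<comment> \<open>\<open>?B\<close> lies in \<open>?A\<close> only up to a null set, because
    \<open>S m\<close> is positive almost surely.\<close>
  moreover have "prob (?A - ?E) = prob ?B"
  proof (rule finite_measure_eq_AE)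
    show "AE \<omega> in P x. (\<omega> \<in> ?A - ?E) = (\<omega> \<in> ?B)"
      using clock_pos_AE
    proof eventually_elim
      case (elim \<omega>)
      then have "0 < S m \<omega>" by simp
      then show ?case using I by (auto simp: not_less)
    qed
  qed measurable
  moreover have "prob ?B = 1 - (\<Sum>n<Suc (card I). poisson_weight t n)"
    using I t by (subst ring_time_le) auto
  ultimately show ?thesis
    using ring_time_le[OF I(1) t, of x] by simp
qed

text \<open>\<open>insert m I\<close> and \<open>J\<close> are disjoint blocks of the clock, so the
  time spent in \<open>R\<close> and the survival outside are independent.\<close>

lemma clock_interval_survival:
  assumes I: "finite I" "m \<notin> I" "finite J" "m \<notin> J" "I \<inter> J = {}" and t: "0 \<le> t"
  shows "(\<integral>\<^sup>+\<omega>. indicator {s. (\<Sum>i\<in>I. s i) \<le> t \<and> t < (\<Sum>i\<in>I. s i) + s m} (\<lambda>n. S n \<omega>) *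
      ennreal (survival lam (\<Sum>k\<in>J. S k \<omega>)) \<partial>P x)
    = ennreal (poisson_weight t (card I) * laplace lam ^ card J)"
proof -
  interpret prob_space "P x" by (rule prob_space_P)
  let ?h = "\<lambda>s. of_bool ((\<Sum>i\<in>I. s i) \<le> t \<and> t < (\<Sum>i\<in>I. s i) + s m) :: real"
  let ?g = "\<lambda>s. (\<Sum>k\<in>J. s k) :: real"
  have "indep_var borel (?h \<circ> (\<lambda>\<omega>. restrict (\<lambda>i. S i \<omega>) (insert m I)))
      borel (?g \<circ> (\<lambda>\<omega>. restrict (\<lambda>i. S i \<omega>) J))"
  proof (rule indep_var_compose[OF indep_var_restrict[OF clock_indep]])
    show "?h \<in> borel_measurable (Pi\<^sub>M (insert m I) (\<lambda>_. borel))"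
    proof -
      have [measurable]: "(\<lambda>s. s i) \<in> borel_measurable (Pi\<^sub>M (insert m I) (\<lambda>_. borel :: real measure))"
        if "i \<in> insert m I" for i
        using that by (rule measurable_component_singleton)
      show ?thesis by measurable
    qed
    show "?g \<in> borel_measurable (Pi\<^sub>M J (\<lambda>_. borel))"
      by (intro borel_measurable_sum measurable_component_singleton)
  qed (use I in auto)
  moreover have "?h \<circ> (\<lambda>\<omega>. restrict (\<lambda>i. S i \<omega>) (insert m I)) = (\<lambda>\<omega>. ?h (\<lambda>n. S n \<omega>))"
    using I by (auto simp: fun_eq_iff cong: sum.cong)
  moreover have "?g \<circ> (\<lambda>\<omega>. restrict (\<lambda>i. S i \<omega>) J) = (\<lambda>\<omega>. ?g (\<lambda>n. S n \<omega>))"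
    by (auto simp: fun_eq_iff)
  ultimately have "indep_var borel (\<lambda>\<omega>. ?h (\<lambda>n. S n \<omega>)) borel (\<lambda>\<omega>. ?g (\<lambda>n. S n \<omega>))" by simp
  from indep_var_nn_integral[OF this, of ennreal "\<lambda>d. ennreal (survival lam d)"]
  have "(\<integral>\<^sup>+\<omega>. ennreal (?h (\<lambda>n. S n \<omega>)) * ennreal (survival lam (?g (\<lambda>n. S n \<omega>))) \<partial>P x)
      = (\<integral>\<^sup>+\<omega>. ennreal (?h (\<lambda>n. S n \<omega>)) \<partial>P x) * ennreal (laplace lam ^ card J)"
    by (simp add: nn_integral_survival_prod[OF I(3)])
  also have "(\<integral>\<^sup>+\<omega>. ennreal (?h (\<lambda>n. S n \<omega>)) \<partial>P x)
      = (\<integral>\<^sup>+\<omega>. indicator {\<omega> \<in> space (P x). (\<Sum>i\<in>I. S i \<omega>) \<le> t \<and> t < (\<Sum>i\<in>I. S i \<omega>) + S m \<omega>} \<omega> \<partial>P x)"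
    by (intro nn_integral_cong) (auto simp: indicator_def)
  also have "\<dots> = ennreal (poisson_weight t (card I))"
    unfolding clock_interval[OF I(1,2) t, of x, symmetric]
    by (subst nn_integral_indicator) (measurable, simp add: emeasure_eq_measure)
  finally have "(\<integral>\<^sup>+\<omega>. ennreal (?h (\<lambda>n. S n \<omega>)) * ennreal (survival lam (?g (\<lambda>n. S n \<omega>))) \<partial>P x)
      = ennreal (poisson_weight t (card I) * laplace lam ^ card J)"
    using poisson_weight_nonneg[OF t] laplace_bounds(1)[of lam] by (simp add: ennreal_mult)
  moreover have "ennreal (?h (\<lambda>n. S n \<omega>)) =
      indicator {s. (\<Sum>i\<in>I. s i) \<le> t \<and> t < (\<Sum>i\<in>I. s i) + s m} (\<lambda>n. S n \<omega>)" for \<omega>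
    by (simp add: indicator_def)
  ultimately show ?thesis by simp
qed

end

section \<open>Measurability of the path functionals\<close>

lemma clock_path_good: "good_clock s \<Longrightarrow> clock_path s z t = z (card {n. (\<Sum>k\<le>n. s k) \<le> t})"
  by (simp add: clock_path_def good_clock_def)

lemma clock_path_bad: "\<not> good_clock s \<Longrightarrow> clock_path s z t = z 0"
  by (auto simp: clock_path_def good_clock_def)

text \<open>Right continuity lets rational times replace real ones in the infimum defining
  \<open>first_time_from\<close>. At negative times a path sits at \<open>z 0\<close>.\<close>

lemma clock_path_right_continuous:
  obtains e where "0 < e" "\<And>u. t \<le> u \<Longrightarrow> u < t + e \<Longrightarrow> clock_path s z u = clock_path s z t"
proof (cases "good_clock s")
  case False
  then show ?thesis using that[of 1] by (simp add: clock_path_bad)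
next
  case good: True
  show ?thesis
  proof (cases "0 \<le> t")
    case True
    obtain n where n: "(\<Sum>k<n. s k) \<le> t" "t < (\<Sum>k<Suc n. s k)"
      using cell_exists[OF good True] by metis
    show ?thesis
    proof (rule that[of "(\<Sum>k<Suc n. s k) - t"])
      show "clock_path s z u = clock_path s z t" if "t \<le> u" "u < t + ((\<Sum>k<Suc n. s k) - t)" for u
        using path_cell[OF good, of n u z] path_cell[OF good n, of z] n that by simp
    qed (use n in simp)
  next
    case False
    have 0: "clock_path s z u = z 0" if "u < 0" for u
    proof -
      have "0 < (\<Sum>k\<le>n. s k)" for n using good by (intro sum_pos) (auto simp: good_clock_def)
      then have "{n. (\<Sum>k\<le>n. s k) \<le> u} = {}" using that by (auto simp: not_le intro: less_trans)
      then show ?thesis using good by (simp add: clock_path_good)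
    qed
    show ?thesis by (rule that[of "- t"]) (use False 0 in auto)
  qed
qed

text \<open>Local time is monotone, so a rational slightly to the right of a witness is again a
  witness; the countable form yields measurability.\<close>

lemma inv_local_time_less_iff:
  "inv_local_time A \<xi> t < a \<longleftrightarrow>
    (\<exists>q::rat. 0 \<le> q \<and> ennreal (of_rat q) < a \<and> t < local_time A \<xi> (ennreal (of_rat q)))"
proof
  assume "inv_local_time A \<xi> t < a"
  then obtain s where s: "0 \<le> s" "t < local_time A \<xi> (ennreal s)" "ennreal s < a"
    by (auto simp: inv_local_time_def Inf_less_iff)
  obtain q :: rat where q: "s < of_rat q" "ennreal (of_rat q) < a"
  proof (cases a)
    case top
    then show ?thesis using that of_rat_dense[of s "s + 1"] by auto
  next
    case (real b)
    then have "s < b" using s by (simp add: ennreal_less_iff)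
    then obtain q :: rat where "s < of_rat q" "of_rat q < b" using of_rat_dense by blast
    moreover from this have "ennreal (of_rat q) < a"
      using real s(1) \<open>s < b\<close> by (simp add: ennreal_lessI)
    ultimately show ?thesis using that[of q] by blast
  qed
  have "t < local_time A \<xi> (ennreal (of_rat q))"
    using s(2) q(1) by (intro order.strict_trans2[OF s(2)] local_time_mono) (simp add: ennreal_leI)
  moreover have "0 \<le> q" using s(1) q(1) by (metis order.trans less_imp_le zero_le_of_rat_iff)
  ultimately show "\<exists>q::rat. 0 \<le> q \<and> ennreal (of_rat q) < a \<and> t < local_time A \<xi> (ennreal (of_rat q))"
    using q by blast
next
  assume "\<exists>q::rat. 0 \<le> q \<and> ennreal (of_rat q) < a \<and> t < local_time A \<xi> (ennreal (of_rat q))"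
  then obtain q :: rat where q: "0 \<le> q" "ennreal (of_rat q) < a" "t < local_time A \<xi> (ennreal (of_rat q))"
    by auto
  then have "inv_local_time A \<xi> t \<le> ennreal (of_rat q)" by (intro inv_local_time_le) auto
  then show "inv_local_time A \<xi> t < a" using q(2) by simp
qed

lemma first_time_from_less_iff:
  "first_time_from r A (clock_path s z) < a \<longleftrightarrow>
    (\<exists>q::rat. r \<le> of_rat q \<and> ennreal (of_rat q) < a \<and> clock_path s z (of_rat q) \<in> A)"
proof
  assume "first_time_from r A (clock_path s z) < a"
  then obtain u where u: "r \<le> u" "clock_path s z u \<in> A" "ennreal u < a"
    by (auto simp: first_time_from_def Inf_less_iff)
  obtain e where e: "0 < e" "\<And>v. u \<le> v \<Longrightarrow> v < u + e \<Longrightarrow> clock_path s z v = clock_path s z u"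
    using clock_path_right_continuous by metis
  obtain q :: rat where q: "u < of_rat q" "of_rat q < u + e" "ennreal (of_rat q) < a"
  proof (cases a)
    case top
    then show ?thesis using that of_rat_dense[of u "u + e"] e by auto
  next
    case (real b)
    then have b: "u < b" "0 < b"
      using u(3) real ennreal_leI[of b u] by (auto simp: not_le[symmetric] ennreal_neg)
    then obtain q :: rat where "u < of_rat q" "of_rat q < min b (u + e)"
      using of_rat_dense[of u "min b (u + e)"] e by auto
    then show ?thesis using that[of q] real b by (auto intro: ennreal_lessI)
  qed
  then show "\<exists>q::rat. r \<le> of_rat q \<and> ennreal (of_rat q) < a \<and> clock_path s z (of_rat q) \<in> A"
    using e(2)[of "of_rat q"] u by (intro exI[of _ q]) auto
next
  assume "\<exists>q::rat. r \<le> of_rat q \<and> ennreal (of_rat q) < a \<and> clock_path s z (of_rat q) \<in> A"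
  then obtain q :: rat where q: "r \<le> of_rat q" "ennreal (of_rat q) < a" "clock_path s z (of_rat q) \<in> A"
    by auto
  then have "first_time_from r A (clock_path s z) \<le> ennreal (of_rat q)"
    unfolding first_time_from_def by (intro Inf_lower) auto
  then show "first_time_from r A (clock_path s z) < a" using q(2) by simp
qed

context rate_one_process
begin

text \<open>Joint measurability in time and \<open>\<omega>\<close> is what the local time, an
  integral over time, and the values at random times require.\<close>

lemma process_measurable: "(\<lambda>(t, \<omega>). process S Z \<omega> t) \<in> borel \<Otimes>\<^sub>M P x \<rightarrow>\<^sub>M count_space UNIV"
proof -
  have good [measurable]: "Measurable.pred (P x) (\<lambda>\<omega>. good_clock (\<lambda>n. S n \<omega>))"
    unfolding good_clock_iff by measurable
  have *: "(\<lambda>(t, \<omega>). process S Z \<omega> t) =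
      (\<lambda>w. if good_clock (\<lambda>n. S n (snd w))
        then Z (card {n. (\<Sum>k\<le>n. S k (snd w)) \<le> fst w}) (snd w) else Z 0 (snd w))"
    by (auto simp: fun_eq_iff process_def clock_path_good clock_path_bad)
  have "(\<lambda>w. Z (card {n. (\<Sum>k\<le>n. S k (snd w)) \<le> fst w}) (snd w))
      \<in> borel \<Otimes>\<^sub>M P x \<rightarrow>\<^sub>M count_space UNIV"
    by (rule measurable_compose_countable[where f="\<lambda>i w. Z i (snd w)"]) measurable
  then show ?thesis unfolding * by measurable
qed

lemma process_at_measurable:
  assumes "\<tau> \<in> borel_measurable (P x)"
  shows "(\<lambda>\<omega>. process S Z \<omega> (\<tau> \<omega>)) \<in> P x \<rightarrow>\<^sub>M count_space UNIV"
proof -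
  have "(\<lambda>\<omega>. (\<tau> \<omega>, \<omega>)) \<in> P x \<rightarrow>\<^sub>M borel \<Otimes>\<^sub>M P x" using assms by measurable
  from measurable_compose[OF this process_measurable] show ?thesis by simp
qed

lemma local_time_measurable:
  assumes [measurable]: "\<tau> \<in> borel_measurable (P x)"
  shows "(\<lambda>\<omega>. local_time A (process S Z \<omega>) (\<tau> \<omega>)) \<in> borel_measurable (P x)"
proof -
  have "(\<lambda>w. (snd w, fst w)) \<in> P x \<Otimes>\<^sub>M lborel \<rightarrow>\<^sub>M borel \<Otimes>\<^sub>M P x" by measurable
  from measurable_compose[OF this process_measurable]
  have [measurable]: "(\<lambda>w. process S Z (fst w) (snd w)) \<in> P x \<Otimes>\<^sub>M lborel \<rightarrow>\<^sub>M count_space UNIV"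
    by (simp add: case_prod_unfold)
  have [measurable]: "A \<in> sets (count_space UNIV)" by simp
  have "(\<lambda>w. indicator A (process S Z (fst w) (snd w)) * indicator {s. 0 \<le> s \<and> ennreal s \<le> \<tau> (fst w)} (snd w) :: ennreal)
      \<in> borel_measurable (P x \<Otimes>\<^sub>M lborel)"
    unfolding indicator_def[of "{s. 0 \<le> s \<and> ennreal s \<le> _ s}"]
    by (simp add: indicator_def[of "{s. _ s}"] cong: measurable_cong) measurable
  then show ?thesis
    unfolding local_time_def by (intro lborel.borel_measurable_nn_integral) (simp add: case_prod_unfold)
qed

lemma inv_local_time_measurable:
  assumes [measurable]: "\<kappa> \<in> borel_measurable (P x)"
  shows "(\<lambda>\<omega>. inv_local_time A (process S Z \<omega>) (\<kappa> \<omega>)) \<in> borel_measurable (P x)"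
proof (rule borel_measurableI_less)
  fix a
  have [measurable]: "(\<lambda>\<omega>. local_time A (process S Z \<omega>) (ennreal (of_rat q))) \<in> borel_measurable (P x)" for q
    by (rule local_time_measurable) simp
  show "{\<omega> \<in> space (P x). inv_local_time A (process S Z \<omega>) (\<kappa> \<omega>) < a} \<in> sets (P x)"
    unfolding inv_local_time_less_iff by measurable
qed

lemma return_time_measurable: "return_time S Z R \<in> borel_measurable (P x)"
proof (rule borel_measurableI_less)
  fix a
  have [measurable]: "(\<lambda>\<omega>. process S Z \<omega> (of_rat q)) \<in> P x \<rightarrow>\<^sub>M count_space UNIV" for q
    by (rule process_at_measurable) simp
  have [measurable]: "R \<in> sets (count_space UNIV)" by simp
  have "{\<omega> \<in> space (P x). return_time S Z R \<omega> < a} =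
      {\<omega> \<in> space (P x). \<exists>q::rat. S 0 \<omega> \<le> of_rat q \<and> ennreal (of_rat q) < a \<and> process S Z \<omega> (of_rat q) \<in> R}"
    by (simp add: return_time_def process_def first_time_from_less_iff)
  also have "\<dots> \<in> sets (P x)" by measurable
  finally show "{\<omega> \<in> space (P x). return_time S Z R \<omega> < a} \<in> sets (P x)" .
qed

lemma soft_exit_time_measurable: "soft_exit_time S Z \<sigma> R lam \<in> borel_measurable (P x)"
  unfolding soft_exit_time_def[abs_def]
  by (intro local_time_measurable inv_local_time_measurable killing_time_measurable)

lemma soft_kernel_event_measurable:
  "{\<omega> \<in> space (P x). process S Z \<omega> (enn2real (return_time S Z R \<omega>)) = y \<and>
     local_time (-R) (process S Z \<omega>) (return_time S Z R \<omega>) \<le> killing_time \<sigma> lam \<omega>} \<in> sets (P x)"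
proof -
  note [measurable] = return_time_measurable[of R x]
  have [measurable]: "(\<lambda>\<omega>. process S Z \<omega> (enn2real (return_time S Z R \<omega>))) \<in> P x \<rightarrow>\<^sub>M count_space UNIV"
    by (rule process_at_measurable) measurable
  have [measurable]: "(\<lambda>\<omega>. local_time (-R) (process S Z \<omega>) (return_time S Z R \<omega>)) \<in> borel_measurable (P x)"
    by (rule local_time_measurable) measurable
  show ?thesis by measurable
qed

lemma exit_event_measurable:
  "{\<omega> \<in> space (P x). process S Z \<omega> (enn2real (inv_local_time R (process S Z \<omega>) (ennreal t))) = y \<and>
     soft_exit_time S Z \<sigma> R lam \<omega> > ennreal t} \<in> sets (P x)"
  "{\<omega> \<in> space (P x). soft_exit_time S Z \<sigma> R lam \<omega> > ennreal t} \<in> sets (P x)"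
proof -
  note [measurable] = soft_exit_time_measurable[of R lam x]
  have [measurable]: "(\<lambda>\<omega>. inv_local_time R (process S Z \<omega>) (ennreal t)) \<in> borel_measurable (P x)"
    by (rule inv_local_time_measurable) simp
  have [measurable]: "(\<lambda>\<omega>. process S Z \<omega> (enn2real (inv_local_time R (process S Z \<omega>) (ennreal t)))) \<in> P x \<rightarrow>\<^sub>M count_space UNIV"
    by (rule process_at_measurable) measurable
  show "{\<omega> \<in> space (P x). process S Z \<omega> (enn2real (inv_local_time R (process S Z \<omega>) (ennreal t))) = y \<and>
     soft_exit_time S Z \<sigma> R lam \<omega> > ennreal t} \<in> sets (P x)" by measurable
  show "{\<omega> \<in> space (P x). soft_exit_time S Z \<sigma> R lam \<omega> > ennreal t} \<in> sets (P x)" by measurable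
qed

end

section \<open>Laws of the killed trace\<close>

lemma occupation_eq: "occupation A s z m = (\<Sum>k | k < m \<and> z k \<in> A. s k)"
proof -
  have "{k. k < m \<and> z k \<in> A} = {k \<in> {..<m}. z k \<in> A}" by auto
  then show ?thesis by (simp only: occupation_def sum.inter_filter finite_lessThan)
qed

lemma kernel_power_trace_kernel_le:
  fixes p :: "'a::finite \<Rightarrow> 'a pmf"
  assumes "0 \<le> \<theta>" "\<theta> \<le> 1" "x \<in> R" "y \<in> R"
  shows "\<bar>kernel_power R (trace_kernel p R \<theta>) n x y\<bar> \<le> 1"
proof -
  have "kernel_power R (trace_kernel p R \<theta>) n x y \<le> 1"
    by (rule kernel_power_le_1) (use assms in \<open>auto intro: trace_kernel_nonneg sum_trace_kernel_le\<close>)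
  moreover have "0 \<le> kernel_power R (trace_kernel p R \<theta>) n x y"
    by (rule kernel_power_nonneg) (use assms in \<open>auto intro: trace_kernel_nonneg\<close>)
  ultimately show ?thesis by simp
qed

lemma poisson_kernel_trace_kernel_sums:
  fixes p :: "'a::finite \<Rightarrow> 'a pmf"
  assumes "0 \<le> \<theta>" "\<theta> \<le> 1" "x \<in> R" "y \<in> R" "0 \<le> t"
  shows "(\<lambda>n. poisson_weight t n * kernel_power R (trace_kernel p R \<theta>) n x y)
    sums poisson_kernel R (trace_kernel p R \<theta>) t x y"
  unfolding poisson_kernel_def
  by (intro summable_sums summable_poisson_bounded[where C=1] kernel_power_trace_kernel_le assms)

text \<open>Tonelli for a double series, carried out in \<open>ennreal\<close>; \<open>zero\<close>
  makes the finite inner sums full series.\<close>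

lemma sums_swap_nonneg:
  fixes a :: "nat \<Rightarrow> nat \<Rightarrow> real"
  assumes a: "\<And>m i. 0 \<le> a m i" and zero: "\<And>m i. m < i \<Longrightarrow> a m i = 0"
    and b: "\<And>i. (\<lambda>m. a m i) sums b i" and c: "b sums c"
    and s: "(\<lambda>m. \<Sum>i\<le>m. a m i) sums s"
  shows "s = c"
proof -
  have b0: "0 \<le> b i" for i using sums_le[OF _ sums_zero b] a by blast
  have "ennreal s = (\<Sum>m. ennreal (\<Sum>i\<le>m. a m i))"
    using s a by (intro suminf_ennreal_eq[symmetric]) (auto intro: sum_nonneg)
  also have "\<dots> = (\<Sum>m. \<Sum>i. ennreal (a m i))"
  proof (rule suminf_cong)
    fix m
    have "(\<Sum>i. ennreal (a m i)) = (\<Sum>i\<le>m. ennreal (a m i))"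
      by (rule suminf_finite) (auto simp: zero not_le)
    then show "ennreal (\<Sum>i\<le>m. a m i) = (\<Sum>i. ennreal (a m i))"
      using a by (simp add: sum_ennreal)
  qed
  also have "\<dots> = (\<Sum>i. \<Sum>m. ennreal (a m i))"
    using nn_integral_suminf[of "\<lambda>i m. ennreal (a m i)" "count_space UNIV"]
    by (simp add: nn_integral_count_space_nat)
  also have "\<dots> = (\<Sum>i. ennreal (b i))"
    using a b by (intro suminf_cong suminf_ennreal_eq) auto
  also have "\<dots> = ennreal c"
    using b0 c by (rule suminf_ennreal_eq)
  finally show ?thesis
    using sums_le[OF _ sums_zero c] sums_le[OF _ sums_zero s] b0 a by (simp add: sum_nonneg)
qed

context rate_one_process
begin

text \<open>The killing enters only through the last conjunct, which is void for
  \<open>lam = 0\<close>.\<close>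

definition visit_event ::
    "(nat \<Rightarrow> nat set \<Rightarrow> (nat \<Rightarrow> real) set) \<Rightarrow> 'a set \<Rightarrow> ennreal \<Rightarrow> 'a \<Rightarrow> 'a \<Rightarrow> nat \<Rightarrow> 'w set" where
  "visit_event G R lam x y m = {\<omega> \<in> space (P x). Z 0 \<omega> = x \<and> Z m \<omega> = y \<and>
     (\<lambda>n. S n \<omega>) \<in> G m {k. k < m \<and> Z k \<omega> \<in> R} \<and>
     ennreal (occupation (-R) (\<lambda>n. S n \<omega>) (\<lambda>n. Z n \<omega>) m) \<le> killing_time \<sigma> lam \<omega>}"

end

text \<open>\<open>G m I\<close> is the condition on the clock under which step \<open>m\<close> is the step of interest when \<open>I\<close> is
  the set of earlier steps in \<open>R\<close>; the return to \<open>R\<close> and the local time \<open>t\<close> are both of this form.\<close>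

locale visit_scheme = rate_one_process P p S Z \<sigma>
  for P :: "'a::finite \<Rightarrow> 'w measure" and p S Z \<sigma> +
  fixes G :: "nat \<Rightarrow> nat set \<Rightarrow> (nat \<Rightarrow> real) set" and \<phi> :: "nat \<Rightarrow> real" and R :: "'a set"
  assumes G: "\<And>m I. G m I \<in> sets (Pi\<^sub>M UNIV (\<lambda>_. borel))"
    and \<phi>: "\<And>i. 0 \<le> \<phi> i"
    and expect: "\<And>x lam m I J. I \<union> J = {..<m} \<Longrightarrow> I \<inter> J = {} \<Longrightarrow>
      (\<integral>\<^sup>+\<omega>. indicator (G m I) (\<lambda>n. S n \<omega>) * ennreal (survival lam (\<Sum>k\<in>J. S k \<omega>)) \<partial>P x)
        = ennreal (\<phi> (card I) * laplace lam ^ card J)"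
    and disj: "\<And>m m' (z :: nat \<Rightarrow> 'a) s. m < m' \<Longrightarrow> z m \<in> R \<Longrightarrow> s \<in> G m {k. k < m \<and> z k \<in> R} \<Longrightarrow>
      s \<in> G m' {k. k < m' \<and> z k \<in> R} \<Longrightarrow> False"
begin

text \<open>The event is split according to the first \<open>m\<close> updates. On each trajectory
  the steps inside and outside \<open>R\<close> are fixed sets, for which \<open>expect\<close>
  evaluates the clock; \<open>sum_path_weight\<close> then collects the trajectories.\<close>

lemma visit_event_prob:
  "visit_event G R lam x y m \<in> sets (P x) \<and>
   measure (P x) (visit_event G R lam x y m) = (\<Sum>i\<le>m. \<phi> i * visit_weight p R (laplace lam) m i x y)"
proof -
  interpret prob_space "P x" by (rule prob_space_P)
  define L where "L = {zs :: 'a list. length zs = m \<and> last (x # zs) = y}"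
  have finL: "finite L"
    unfolding L_def by (rule finite_subset[OF _ finite_lists_length_eq[of UNIV m]]) auto
  define I where "I zs = {k. k < m \<and> (x # zs) ! k \<in> R}" for zs
  define J where "J zs = {k. k < m \<and> (x # zs) ! k \<notin> R}" for zs
  define E where "E zs = {\<omega> \<in> space (P x). (\<forall>i\<le>m. Z i \<omega> = (x # zs) ! i) \<and>
      (\<lambda>n. S n \<omega>) \<in> G m (I zs) \<and> ennreal (\<Sum>k\<in>J zs. S k \<omega>) \<le> killing_time \<sigma> lam \<omega>}" for zs
  have E_sets: "E zs \<in> events" for zs
  proof -
    note [measurable] = G[of m "I zs"]
    show ?thesis unfolding E_def by measurable
  qed
  have E_prob: "prob (E zs) = path_weight p x zs * (\<phi> (card (I zs)) * laplace lam ^ card (J zs))"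
    if "zs \<in> L" for zs
  proof -
    have len: "length zs = m" using that by (simp add: L_def)
    have "\<P>(\<omega> in P x. \<forall>i\<le>m. Z i \<omega> = (x # zs) ! i) = path_weight p x zs"
      unfolding chain_law[where z="\<lambda>i. (x # zs) ! i"] path_weight_eq_prod len by simp
    then have "emeasure (P x) (E zs) = ennreal (path_weight p x zs) * ennreal (\<phi> (card (I zs)) * laplace lam ^ card (J zs))"
      unfolding E_def by (subst path_event_emeasure) (auto simp: G J_def I_def intro!: arg_cong2[where f="(*)"] expect)
    also have "\<dots> = ennreal (path_weight p x zs * (\<phi> (card (I zs)) * laplace lam ^ card (J zs)))"
      by (intro ennreal_mult[symmetric] path_weight_nonneg mult_nonneg_nonneg \<phi> zero_le_power laplace_bounds)
    finally have "emeasure (P x) (E zs) = ennreal (path_weight p x zs * (\<phi> (card (I zs)) * laplace lam ^ card (J zs)))" .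
    then show ?thesis
      by (intro measure_eq_emeasure_eq_ennreal path_weight_nonneg mult_nonneg_nonneg \<phi> zero_le_power laplace_bounds)
  qed
  have eq: "visit_event G R lam x y m = (\<Union>zs\<in>L. E zs)"
  proof (intro set_eqI iffI)
    fix \<omega> assume \<omega>: "\<omega> \<in> visit_event G R lam x y m"
    define zs where "zs = map (\<lambda>i. Z (Suc i) \<omega>) [0..<m]"
    have nth: "(x # zs) ! i = Z i \<omega>" if "i \<le> m" for i
      using that \<omega> by (cases i) (auto simp: zs_def visit_event_def)
    have len: "length zs = m" by (simp add: zs_def)
    have "last (x # zs) = (x # zs) ! m" using len last_conv_nth[of "x # zs"] by (simp del: last.simps)
    then have "zs \<in> L" using nth[of m] len \<omega> by (simp add: L_def visit_event_def)
    moreover have IJ: "I zs = {k. k < m \<and> Z k \<omega> \<in> R}" "J zs = {k. k < m \<and> Z k \<omega> \<in> -R}"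
      using nth by (auto simp: I_def J_def)
    have "\<omega> \<in> E zs"
      unfolding E_def IJ
    proof (intro CollectI conjI allI impI)
      show "Z i \<omega> = (x # zs) ! i" if "i \<le> m" for i by (rule nth[OF that, symmetric])
    qed (use \<omega> in \<open>auto simp: visit_event_def occupation_eq\<close>)
    ultimately show "\<omega> \<in> (\<Union>zs\<in>L. E zs)" by blast
  next
    fix \<omega> assume "\<omega> \<in> (\<Union>zs\<in>L. E zs)"
    then obtain zs where zs: "zs \<in> L" "\<omega> \<in> E zs" by auto
    have nth: "Z i \<omega> = (x # zs) ! i" if "i \<le> m" for i using zs(2) that by (simp add: E_def)
    have len: "length zs = m" using zs by (simp add: L_def)
    have "last (x # zs) = (x # zs) ! m" using len last_conv_nth[of "x # zs"] by (simp del: last.simps)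
    then have "Z m \<omega> = y" using nth[of m] zs by (simp add: L_def)
    moreover have "I zs = {k. k < m \<and> Z k \<omega> \<in> R}" "J zs = {k. k < m \<and> Z k \<omega> \<in> -R}"
      using nth by (auto simp: I_def J_def)
    ultimately show "\<omega> \<in> visit_event G R lam x y m"
      using zs(2) nth[of 0] by (simp add: E_def visit_event_def occupation_eq)
  qed
  have "disjoint_family_on E L"
    unfolding disjoint_family_on_def
  proof (intro ballI impI)
    fix zs ws assume *: "zs \<in> L" "ws \<in> L" "zs \<noteq> ws"
    then have "length zs = m" "length ws = m" by (simp_all add: L_def)
    then obtain i where "i < m" "zs ! i \<noteq> ws ! i"
      using *(3) nth_equalityI[of zs ws] by metis
    then have i: "Suc i \<le> m" "(x # zs) ! Suc i \<noteq> (x # ws) ! Suc i" by auto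
    have "Z (Suc i) \<omega> = (x # vs) ! Suc i" if "\<omega> \<in> E vs" for \<omega> vs
      using that i(1) unfolding E_def by blast
    then have False if "\<omega> \<in> E zs" "\<omega> \<in> E ws" for \<omega> using i(2) that by metis
    then show "E zs \<inter> E ws = {}" by blast
  qed
  then have "prob (visit_event G R lam x y m) = (\<Sum>zs\<in>L. prob (E zs))"
    unfolding eq using E_sets by (intro finite_measure_finite_Union finL) auto
  also have "\<dots> = (\<Sum>zs\<in>L. path_weight p x zs * (\<phi> (card (I zs)) * laplace lam ^ card (J zs)))"
    using E_prob by simp
  also have "\<dots> = (\<Sum>i\<le>m. \<phi> i * visit_weight p R (laplace lam) m i x y)"
    unfolding L_def I_def J_def by (rule sum_path_weight[OF laplace_bounds])
  finally show ?thesis using E_sets finL by (auto simp: eq)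
qed

text \<open>\<open>disj\<close> involves neither the killing nor the starting point, so events with
  different \<open>lam\<close> can be compared.\<close>

lemma visit_event_unique:
  assumes "\<omega> \<in> visit_event G R lam x y m" "\<omega> \<in> visit_event G R lam' x' y' m'" "y \<in> R" "y' \<in> R"
  shows "m = m'"
  using disj[of m m' "\<lambda>n. Z n \<omega>"] disj[of m' m "\<lambda>n. Z n \<omega>"] assms
  by (cases m m' rule: linorder_cases) (auto simp: visit_event_def)

text \<open>As \<open>m\<close> is unique, the probabilities add up; exchanging the sums over
  \<open>m\<close> and \<open>i\<close> turns a sum over steps into one over visits.\<close>

lemma visit_event_total:
  assumes y: "y \<in> R" and c: "(\<lambda>i. \<phi> i * visit_sum p R (laplace lam) i x y) sums c"
  shows "measure (P x) (\<Union>m. visit_event G R lam x y m) = c"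
proof -
  interpret prob_space "P x" by (rule prob_space_P)
  have "disjoint_family (visit_event G R lam x y)"
    using visit_event_unique y by (auto simp: disjoint_family_on_def)
  then have "(\<lambda>m. prob (visit_event G R lam x y m)) sums prob (\<Union>m. visit_event G R lam x y m)"
    using visit_event_prob by (intro finite_measure_UNION) auto
  then have s: "(\<lambda>m. \<Sum>i\<le>m. \<phi> i * visit_weight p R (laplace lam) m i x y)
      sums prob (\<Union>m. visit_event G R lam x y m)"
    using visit_event_prob by simp
  show ?thesis
  proof (rule sums_swap_nonneg[OF _ _ _ c s])
    show "0 \<le> \<phi> i * visit_weight p R (laplace lam) m i x y" for m i
      by (intro mult_nonneg_nonneg \<phi> visit_weight_nonneg laplace_bounds)
    show "\<phi> i * visit_weight p R (laplace lam) m i x y = 0" if "m < i" for m i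
      by (simp add: visit_weight_eq_0[OF laplace_bounds that])
    show "(\<lambda>m. \<phi> i * visit_weight p R (laplace lam) m i x y) sums (\<phi> i * visit_sum p R (laplace lam) i x y)" for i
      unfolding visit_sum_def by (intro sums_mult summable_sums summable_visit_weight laplace_bounds y)
  qed
qed

lemma visit_event_sum:
  shows "(\<Union>y\<in>R. \<Union>m. visit_event G R lam x y m) \<in> sets (P x)"
    and "measure (P x) (\<Union>y\<in>R. \<Union>m. visit_event G R lam x y m)
      = (\<Sum>y\<in>R. measure (P x) (\<Union>m. visit_event G R lam x y m))"
proof -
  interpret prob_space "P x" by (rule prob_space_P)
  have ev: "(\<Union>m. visit_event G R lam x y m) \<in> events" for y
    using visit_event_prob by (intro sets.countable_UN) auto
  then show "(\<Union>y\<in>R. \<Union>m. visit_event G R lam x y m) \<in> sets (P x)"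
    by (intro sets.finite_UN ev) simp
  have "disjoint_family_on (\<lambda>y. \<Union>m. visit_event G R lam x y m) R"
    unfolding disjoint_family_on_def
  proof (intro ballI impI)
    fix y y' assume *: "y \<in> R" "y' \<in> R" "y \<noteq> y'"
    show "(\<Union>m. visit_event G R lam x y m) \<inter> (\<Union>m. visit_event G R lam x y' m) = {}"
    proof (rule ccontr)
      assume "\<not> ?thesis"
      then obtain \<omega> m m' where \<omega>: "\<omega> \<in> visit_event G R lam x y m" "\<omega> \<in> visit_event G R lam x y' m'"
        by auto
      then have "m = m'" using visit_event_unique * by blast
      then show False using \<omega> * by (auto simp: visit_event_def)
    qed
  qed
  then show "prob (\<Union>y\<in>R. \<Union>m. visit_event G R lam x y m)
      = (\<Sum>y\<in>R. prob (\<Union>m. visit_event G R lam x y m))"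
    using ev by (intro finite_measure_finite_Union) auto
qed

text \<open>Nothing is killed at \<open>lam = 0\<close>: total mass 1 means that almost every path
  has a step of interest in \<open>R\<close>, from which the path functionals can be
  computed.\<close>

lemma visit_event_AE:
  assumes "(\<Sum>y\<in>R. measure (P x) (\<Union>m. visit_event G R 0 x y m)) = 1"
  shows "AE \<omega> in P x. \<exists>y\<in>R. \<exists>m. \<omega> \<in> visit_event G R 0 x y m"
proof -
  interpret prob_space "P x" by (rule prob_space_P)
  have "AE \<omega> in P x. \<omega> \<in> (\<Union>y\<in>R. \<Union>m. visit_event G R 0 x y m)"
    using visit_event_sum[where x=x and lam=0] assms by (simp add: prob_eq_1)
  then show ?thesis by simp
qed

lemma visit_event_iff:
  assumes "\<omega> \<in> visit_event G R 0 x y m" "y \<in> R" "y' \<in> R"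
  shows "(\<exists>m'. \<omega> \<in> visit_event G R lam x y' m') \<longleftrightarrow>
    y' = y \<and> ennreal (occupation (-R) (\<lambda>n. S n \<omega>) (\<lambda>n. Z n \<omega>) m) \<le> killing_time \<sigma> lam \<omega>"
proof
  assume "\<exists>m'. \<omega> \<in> visit_event G R lam x y' m'"
  then obtain m' where m': "\<omega> \<in> visit_event G R lam x y' m'" by auto
  then have "m' = m" using visit_event_unique assms by blast
  then show "y' = y \<and> ennreal (occupation (-R) (\<lambda>n. S n \<omega>) (\<lambda>n. Z n \<omega>) m) \<le> killing_time \<sigma> lam \<omega>"
    using m' assms(1) by (auto simp: visit_event_def)
next
  assume "y' = y \<and> ennreal (occupation (-R) (\<lambda>n. S n \<omega>) (\<lambda>n. Z n \<omega>) m) \<le> killing_time \<sigma> lam \<omega>"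
  then have "\<omega> \<in> visit_event G R lam x y' m" using assms(1) by (simp add: visit_event_def)
  then show "\<exists>m'. \<omega> \<in> visit_event G R lam x y' m'" ..
qed

end

context rate_one_process
begin

text \<open>The step of interest is the return to \<open>R\<close>, preceded by exactly one step in
  \<open>R\<close>, namely the start. It exists almost surely because the trace kernel at
  \<open>\<theta> = 1\<close> is stochastic, and its ring is the return time.\<close>

lemma soft_kernel_eq:
  assumes irr: "irreducible_on UNIV (\<lambda>x y. pmf (p x) y)" and x: "x \<in> R" and y: "y \<in> R"
  shows "soft_kernel P S Z \<sigma> R lam x y = trace_kernel p R (laplace lam) x y"
proof -
  interpret prob_space "P x" by (rule prob_space_P)
  define G :: "nat \<Rightarrow> nat set \<Rightarrow> (nat \<Rightarrow> real) set" where "G m I = (if card I = 1 then UNIV else {})" for m I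
  define \<phi> :: "nat \<Rightarrow> real" where "\<phi> i = (if i = 1 then 1 else 0)" for i
  have G: "G m I \<in> sets (Pi\<^sub>M UNIV (\<lambda>_. borel))" for m I
    using sets.top[of "Pi\<^sub>M UNIV (\<lambda>_. borel) :: (nat \<Rightarrow> real) measure"] by (simp add: G_def space_PiM)
  have \<phi>: "0 \<le> \<phi> i" for i by (simp add: \<phi>_def)
  have expect: "(\<integral>\<^sup>+\<omega>. indicator (G m I) (\<lambda>n. S n \<omega>) * ennreal (survival lam (\<Sum>k\<in>J. S k \<omega>)) \<partial>P x)
      = ennreal (\<phi> (card I) * laplace lam ^ card J)" if "I \<union> J = {..<m}" "I \<inter> J = {}" for x lam m I J
  proof -
    have "finite J" using that(1) by (metis finite_Un finite_lessThan)
    then show ?thesis by (simp add: G_def \<phi>_def nn_integral_survival_prod)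
  qed
  have disj: False if "m < m'" "z m \<in> R" "s \<in> G m {k. k < m \<and> z k \<in> R}" "s \<in> G m' {k. k < m' \<and> z k \<in> R}"
    for m m' s and z :: "nat \<Rightarrow> 'a"
  proof -
    have "{k. k < m \<and> z k \<in> R} \<subset> {k. k < m' \<and> z k \<in> R}" using that(1,2) by auto
    then have "card {k. k < m \<and> z k \<in> R} < card {k. k < m' \<and> z k \<in> R}" by (intro psubset_card_mono) auto
    then show False using that(3,4) by (simp add: G_def split: if_splits)
  qed
  interpret visit_scheme P p S Z \<sigma> G \<phi> R
    by unfold_locales (fact G, fact \<phi>, fact expect, fact disj)
  have total: "prob (\<Union>m. visit_event G R lam x y m) = trace_kernel p R (laplace lam) x y" if "y \<in> R" for lam y
  proof (rule visit_event_total[OF that])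
    have "(\<lambda>i. \<phi> i * visit_sum p R (laplace lam) i x y) = (\<lambda>i. if i = 1 then visit_sum p R (laplace lam) i x y else 0)"
      by (auto simp: \<phi>_def)
    then show "(\<lambda>i. \<phi> i * visit_sum p R (laplace lam) i x y) sums trace_kernel p R (laplace lam) x y"
      using sums_single[of 1 "\<lambda>i. visit_sum p R (laplace lam) i x y"]
      by (simp add: trace_kernel_eq_visit_sum[OF laplace_bounds x that])
  qed
  have "(\<Sum>y\<in>R. prob (\<Union>m. visit_event G R 0 x y m)) = 1"
    using total sum_trace_kernel_1[OF irr, of R x] x by (auto simp: laplace_simps)
  note ae = visit_event_AE[OF this]
  have "soft_kernel P S Z \<sigma> R lam x y = prob (\<Union>m. visit_event G R lam x y m)"
    unfolding soft_kernel_def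
  proof (rule finite_measure_eq_AE)
    show "AE \<omega> in P x. (\<omega> \<in> {\<omega> \<in> space (P x). process S Z \<omega> (enn2real (return_time S Z R \<omega>)) = y \<and>
        local_time (-R) (process S Z \<omega>) (return_time S Z R \<omega>) \<le> killing_time \<sigma> lam \<omega>})
      \<longleftrightarrow> (\<omega> \<in> (\<Union>m. visit_event G R lam x y m))"
      using good_clock_AE ae AE_space
    proof eventually_elim
      case (elim \<omega>)
      from elim(2) obtain y' m where m: "y' \<in> R" "\<omega> \<in> visit_event G R 0 x y' m" by auto
      then have Z: "Z 0 \<omega> = x" "Z m \<omega> = y'" and card: "card {k. k < m \<and> Z k \<omega> \<in> R} = 1"
        by (auto simp: visit_event_def G_def split: if_splits)
      have m0: "0 < m" using card by (cases m) auto
      have out: "Z k \<omega> \<notin> R" if "0 < k" "k < m" for k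
      proof
        assume "Z k \<omega> \<in> R"
        then have "{0, k} \<subseteq> {k. k < m \<and> Z k \<omega> \<in> R}" using that Z x by auto
        then have "card {0, k} \<le> card {k. k < m \<and> Z k \<omega> \<in> R}" by (intro card_mono) auto
        then show False using card that by simp
      qed
      have ret: "return_time S Z R \<omega> = ennreal (\<Sum>k<m. S k \<omega>)"
        unfolding return_time_def process_def using Z m
        by (intro first_time_from_cell[OF elim(1) m0] out) auto
      have T: "0 \<le> (\<Sum>k<m. S k \<omega>)" by (rule ring_nonneg[OF elim(1)])
      have "process S Z \<omega> (\<Sum>k<m. S k \<omega>) = y'"
        unfolding process_def Z(2)[symmetric] by (rule path_ring[OF elim(1)])
      moreover have "local_time (-R) (process S Z \<omega>) (ennreal (\<Sum>k<m. S k \<omega>))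
          = ennreal (occupation (-R) (\<lambda>n. S n \<omega>) (\<lambda>n. Z n \<omega>) m)"
        unfolding process_def by (rule local_time_ring[OF elim(1)])
      ultimately show ?case
        using visit_event_iff[OF m(2) m(1) y, of lam] elim(3) T by (auto simp: ret)
    qed
    show "(\<Union>m. visit_event G R lam x y m) \<in> events"
      using visit_event_prob by (intro sets.countable_UN) auto
  qed (rule soft_kernel_event_measurable)
  then show ?thesis using total[OF y] by simp
qed

text \<open>The step of interest is the one in whose holding time the local time of \<open>R\<close>
  passes \<open>t\<close>. The number of sojourn steps in \<open>R\<close> completed before it has
  Poisson(t) weights, which mix the powers of the trace kernel.\<close>

lemma exit_law:
  assumes irr: "irreducible_on UNIV (\<lambda>x y. pmf (p x) y)" and x: "x \<in> R" and t: "0 \<le> t"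
  shows "y \<in> R \<Longrightarrow> \<P>(\<omega> in P x. process S Z \<omega> (enn2real (inv_local_time R (process S Z \<omega>) (ennreal t))) = y \<and>
        soft_exit_time S Z \<sigma> R lam \<omega> > ennreal t)
      = poisson_kernel R (trace_kernel p R (laplace lam)) t x y"
    and "\<P>(\<omega> in P x. soft_exit_time S Z \<sigma> R lam \<omega> > ennreal t)
      = (\<Sum>y\<in>R. poisson_kernel R (trace_kernel p R (laplace lam)) t x y)"
proof -
  interpret prob_space "P x" by (rule prob_space_P)
  \<comment> \<open>Positivity of all holding times is built into \<open>G\<close> so that two
    different steps exclude each other for every clock, not just almost surely.\<close>
  define G :: "nat \<Rightarrow> nat set \<Rightarrow> (nat \<Rightarrow> real) set" where
    "G m I = {s. (\<forall>n. 0 < s n) \<and> (\<Sum>i\<in>I. s i) \<le> t \<and> t < (\<Sum>i\<in>I. s i) + s m}" for m I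
  have G: "G m I \<in> sets (Pi\<^sub>M UNIV (\<lambda>_. borel))" for m I
  proof -
    have "G m I = {s \<in> space (Pi\<^sub>M UNIV (\<lambda>_. borel)). (\<forall>n. 0 < s n) \<and> (\<Sum>i\<in>I. s i) \<le> t \<and> t < (\<Sum>i\<in>I. s i) + s m}"
      by (simp add: G_def space_PiM)
    also have "\<dots> \<in> sets (Pi\<^sub>M UNIV (\<lambda>_. borel))" by measurable
    finally show ?thesis .
  qed
  have \<phi>: "0 \<le> poisson_weight t i" for i by (rule poisson_weight_nonneg[OF t])
  have expect: "(\<integral>\<^sup>+\<omega>. indicator (G m I) (\<lambda>n. S n \<omega>) * ennreal (survival lam (\<Sum>k\<in>J. S k \<omega>)) \<partial>P x)
      = ennreal (poisson_weight t (card I) * laplace lam ^ card J)" if "I \<union> J = {..<m}" "I \<inter> J = {}" for x lam m I J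
  proof -
    have fin: "finite I" "finite J" "m \<notin> I" "m \<notin> J" using that(1) by (metis finite_Un finite_lessThan, metis finite_Un finite_lessThan, auto)
    have "(\<integral>\<^sup>+\<omega>. indicator (G m I) (\<lambda>n. S n \<omega>) * ennreal (survival lam (\<Sum>k\<in>J. S k \<omega>)) \<partial>P x)
        = (\<integral>\<^sup>+\<omega>. indicator {s. (\<Sum>i\<in>I. s i) \<le> t \<and> t < (\<Sum>i\<in>I. s i) + s m} (\<lambda>n. S n \<omega>) *
            ennreal (survival lam (\<Sum>k\<in>J. S k \<omega>)) \<partial>P x)"
      using clock_pos_AE[of x] by (intro nn_integral_cong_AE) (auto simp: G_def indicator_def elim!: eventually_mono)
    also have "\<dots> = ennreal (poisson_weight t (card I) * laplace lam ^ card J)"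
      using fin that(2) t by (intro clock_interval_survival) auto
    finally show ?thesis .
  qed
  have disj: False if "m < m'" "z m \<in> R" "s \<in> G m {k. k < m \<and> z k \<in> R}" "s \<in> G m' {k. k < m' \<and> z k \<in> R}"
    for m m' s and z :: "nat \<Rightarrow> 'a"
  proof -
    have "t < (\<Sum>k | k < m \<and> z k \<in> R. s k) + s m" using that(3) by (simp add: G_def)
    also have "\<dots> = (\<Sum>k\<in>insert m {k. k < m \<and> z k \<in> R}. s k)" by simp
    also have "\<dots> \<le> (\<Sum>k | k < m' \<and> z k \<in> R. s k)"
      using that by (intro sum_mono2) (auto simp: G_def less_imp_le)
    also have "\<dots> \<le> t" using that(4) by (simp add: G_def)
    finally show False by simp
  qed
  interpret visit_scheme P p S Z \<sigma> G "poisson_weight t" R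
    by unfold_locales (fact G, fact \<phi>, fact expect, fact disj)
  have total: "prob (\<Union>m. visit_event G R lam x y m) = poisson_kernel R (trace_kernel p R (laplace lam)) t x y"
    if "y \<in> R" for lam y
  proof (rule visit_event_total[OF that])
    show "(\<lambda>i. poisson_weight t i * visit_sum p R (laplace lam) i x y)
        sums poisson_kernel R (trace_kernel p R (laplace lam)) t x y"
      using poisson_kernel_trace_kernel_sums[OF laplace_bounds x that t]
      by (simp add: visit_sum_eq_kernel_power[OF laplace_bounds x that])
  qed
  \<comment> \<open>Constants are right eigenvectors of the stochastic kernel at
    \<open>\<theta> = 1\<close>, so all its powers, and their Poisson mixture, have row sums
    1.\<close>
  have "(\<Sum>y\<in>R. prob (\<Union>m. visit_event G R 0 x y m)) = 1"
  proof -
    let ?K = "trace_kernel p R 1"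
    have "(\<lambda>i. \<Sum>y\<in>R. poisson_weight t i * kernel_power R ?K i x y) sums (\<Sum>y\<in>R. poisson_kernel R ?K t x y)"
      using x t by (intro sums_sum poisson_kernel_trace_kernel_sums) auto
    moreover have "(\<Sum>y\<in>R. poisson_weight t i * kernel_power R ?K i x y) = poisson_weight t i" for i
      using kernel_power_right_eigenvector[of R ?K "\<lambda>_. 1" 1 x i] sum_trace_kernel_1[OF irr, of R] x
      by (auto simp flip: sum_distrib_left)
    ultimately have "poisson_weight t sums (\<Sum>y\<in>R. poisson_kernel R ?K t x y)" by simp
    then have "(\<Sum>y\<in>R. poisson_kernel R ?K t x y) = 1" using poisson_weight_sums sums_unique2 by blast
    then show ?thesis using total by (simp add: laplace_simps)
  qed
  note ae = visit_event_AE[OF this]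
  have path: "AE \<omega> in P x. \<omega> \<in> space (P x) \<and> (\<exists>y'\<in>R. process S Z \<omega> (enn2real (inv_local_time R (process S Z \<omega>) (ennreal t))) = y' \<and>
      (\<forall>y\<in>R. (\<exists>m. \<omega> \<in> visit_event G R lam x y m) \<longleftrightarrow> y = y' \<and> soft_exit_time S Z \<sigma> R lam \<omega> > ennreal t))"
    using good_clock_AE ae AE_space
  proof eventually_elim
    case (elim \<omega>)
    from elim(2) obtain y' m where m: "y' \<in> R" "\<omega> \<in> visit_event G R 0 x y' m" by auto
    then have Z: "Z m \<omega> = y'" and S: "(\<lambda>n. S n \<omega>) \<in> G m {k. k < m \<and> Z k \<omega> \<in> R}"
      by (auto simp: visit_event_def)
    have cell: "Z m \<omega> \<in> R" "occupation R (\<lambda>n. S n \<omega>) (\<lambda>n. Z n \<omega>) m \<le> t"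
      "t < occupation R (\<lambda>n. S n \<omega>) (\<lambda>n. Z n \<omega>) m + S m \<omega>"
      using Z m S by (auto simp: G_def occupation_eq)
    show ?case
      using visit_event_iff[OF m(2) m(1)] elim(3) m(1) Z
        inv_local_time_cell[OF elim(1), of "\<lambda>n. Z n \<omega>", OF cell]
        exit_time_cell[OF elim(1), of "\<lambda>n. Z n \<omega>", OF cell]
      by (auto simp: process_def soft_exit_time_def)
  qed
  show "\<P>(\<omega> in P x. process S Z \<omega> (enn2real (inv_local_time R (process S Z \<omega>) (ennreal t))) = y \<and>
        soft_exit_time S Z \<sigma> R lam \<omega> > ennreal t)
      = poisson_kernel R (trace_kernel p R (laplace lam)) t x y" if y: "y \<in> R"
    unfolding total[OF y, symmetric]
  proof (rule finite_measure_eq_AE)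
    show "AE \<omega> in P x. (\<omega> \<in> {\<omega> \<in> space (P x). process S Z \<omega> (enn2real (inv_local_time R (process S Z \<omega>) (ennreal t))) = y \<and>
        soft_exit_time S Z \<sigma> R lam \<omega> > ennreal t}) \<longleftrightarrow> (\<omega> \<in> (\<Union>m. visit_event G R lam x y m))"
      using path by eventually_elim (use y in auto)
    show "(\<Union>m. visit_event G R lam x y m) \<in> events"
      using visit_event_prob by (intro sets.countable_UN) auto
  qed (rule exit_event_measurable)
  have "\<P>(\<omega> in P x. soft_exit_time S Z \<sigma> R lam \<omega> > ennreal t) = prob (\<Union>y\<in>R. \<Union>m. visit_event G R lam x y m)"
  proof (rule finite_measure_eq_AE)
    show "AE \<omega> in P x. (\<omega> \<in> {\<omega> \<in> space (P x). soft_exit_time S Z \<sigma> R lam \<omega> > ennreal t})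
        \<longleftrightarrow> (\<omega> \<in> (\<Union>y\<in>R. \<Union>m. visit_event G R lam x y m))"
      using path by eventually_elim auto
  qed (rule exit_event_measurable visit_event_sum(1))+
  then show "\<P>(\<omega> in P x. soft_exit_time S Z \<sigma> R lam \<omega> > ennreal t)
      = (\<Sum>y\<in>R. poisson_kernel R (trace_kernel p R (laplace lam)) t x y)"
    using visit_event_sum(2) total by simp
qed

lemma conditioned_law_eq:
  assumes "irreducible_on UNIV (\<lambda>x y. pmf (p x) y)" "x \<in> R" "y \<in> R" "0 \<le> t"
  shows "conditioned_law P S Z \<sigma> R lam x y t =
    poisson_kernel R (trace_kernel p R (laplace lam)) t x y /
    (\<Sum>z\<in>R. poisson_kernel R (trace_kernel p R (laplace lam)) t x z)"
  unfolding conditioned_law_def cond_prob_def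
  using exit_law[OF assms(1,2,4)] assms(3) by simp

end

section \<open>Continuity in the killing parameter and the iterated limits\<close>

lemma continuous_on_kernel_power:
  fixes p :: "'a::finite \<Rightarrow> 'a pmf"
  assumes "x \<in> R" "y \<in> R"
  shows "continuous_on {0..1} (\<lambda>\<theta>. kernel_power R (trace_kernel p R \<theta>) n x y)"
  using assms(1)
proof (induction n arbitrary: x)
  case (Suc n)
  then show ?case
    unfolding kernel_power.simps by (intro continuous_intros continuous_on_trace_kernel) auto
qed simp

text \<open>Weierstrass test with the Poisson weights as majorant, since the powers are bounded by
  1.\<close>

lemma continuous_on_poisson_kernel:
  fixes p :: "'a::finite \<Rightarrow> 'a pmf"
  assumes "x \<in> R" "y \<in> R" "0 \<le> t"
  shows "continuous_on {0..1} (\<lambda>\<theta>. poisson_kernel R (trace_kernel p R \<theta>) t x y)"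
proof -
  have "uniform_limit {0..1} (\<lambda>n \<theta>. \<Sum>i<n. poisson_weight t i * kernel_power R (trace_kernel p R \<theta>) i x y)
      (\<lambda>\<theta>. poisson_kernel R (trace_kernel p R \<theta>) t x y) sequentially"
    unfolding poisson_kernel_def
  proof (rule Weierstrass_m_test)
    show "norm (poisson_weight t i * kernel_power R (trace_kernel p R \<theta>) i x y) \<le> poisson_weight t i"
      if "\<theta> \<in> {0..1}" for i \<theta>
      using that assms kernel_power_trace_kernel_le[of \<theta> x R y p i] poisson_weight_nonneg[OF assms(3), of i]
      by (auto simp: abs_mult intro!: mult_left_le)
    show "summable (poisson_weight t)" using poisson_weight_sums by (rule sums_summable)
  qed
  then show ?thesis
    using assms
    by (intro uniform_limit_theorem[rotated])
      (auto intro!: always_eventually continuous_intros continuous_on_kernel_power)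
qed

text \<open>Detailed balance turns the weighted column sum into a row sum of the stochastic kernel
  at \<open>\<theta> = 1\<close>.\<close>

lemma left_act_trace_kernel_cond_pmf:
  fixes p :: "'a::finite \<Rightarrow> 'a pmf"
  assumes rev: "reversible p \<mu>" and irr: "irreducible_on UNIV (\<lambda>x y. pmf (p x) y)"
    and ne: "set_pmf \<mu> \<inter> R \<noteq> {}" and y: "y \<in> R"
  shows "left_act R (trace_kernel p R 1) (pmf (cond_pmf \<mu> R)) y = pmf (cond_pmf \<mu> R) y"
proof -
  have "left_act R (trace_kernel p R 1) (pmf (cond_pmf \<mu> R)) y
      = (\<Sum>x\<in>R. pmf \<mu> x * trace_kernel p R 1 x y / measure (measure_pmf \<mu>) R)"
    unfolding left_act_def by (intro sum.cong) (auto simp: pmf_cond[OF ne])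
  also have "\<dots> = (\<Sum>x\<in>R. pmf \<mu> y * trace_kernel p R 1 y x / measure (measure_pmf \<mu>) R)"
    using trace_kernel_reversible[OF rev, of 1 _ R y] y by (intro sum.cong) auto
  also have "\<dots> = pmf \<mu> y * (\<Sum>x\<in>R. trace_kernel p R 1 y x) / measure (measure_pmf \<mu>) R"
    by (simp add: sum_distrib_left sum_divide_distrib)
  also have "\<dots> = pmf (cond_pmf \<mu> R) y"
    using y sum_trace_kernel_1[OF irr, of R y] by (auto simp: pmf_cond[OF ne])
  finally show ?thesis .
qed

theorem lemma2p13:
  fixes P :: "'a::finite \<Rightarrow> 'w measure"
    and p :: "'a \<Rightarrow> 'a pmf"
    and S :: "nat \<Rightarrow> 'w \<Rightarrow> real"
    and Z :: "nat \<Rightarrow> 'w \<Rightarrow> 'a"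
    and \<sigma> :: "real \<Rightarrow> 'w \<Rightarrow> real"
    and \<mu> :: "'a pmf"
    and R :: "'a set"
  assumes "rate_one_process P p S Z \<sigma>"
    and "reversible p \<mu>"
    and "irreducible_on UNIV (\<lambda>x y. pmf (p x) y)"
    and "R \<noteq> {}" and "R \<noteq> UNIV"
    and "irreducible_on R (restricted_kernel p R)"
    and "irreducible_on (-R) (restricted_kernel p (-R))"
  shows
    "soft_measure P S Z \<sigma> R 0 = cond_pmf \<mu> R \<and>
     soft_measure P S Z \<sigma> R top = quasi_stationary p R \<and>
     (\<forall>lam0. ((\<lambda>lam. l2_norm (quasi_stationary p R)
                (\<lambda>y. pmf (soft_measure P S Z \<sigma> R lam) y - pmf (soft_measure P S Z \<sigma> R lam0) y))
              \<longlongrightarrow> 0) (at lam0)) \<and>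
     (\<forall>lam0. \<forall>y\<in>R. ((\<lambda>lam. pmf (soft_measure P S Z \<sigma> R lam) y)
              \<longlongrightarrow> pmf (soft_measure P S Z \<sigma> R lam0) y) (at lam0)) \<and>
     (\<forall>lam0. \<forall>x\<in>R. \<forall>y\<in>R. \<exists>g h L.
        (\<forall>lam. ((\<lambda>t. conditioned_law P S Z \<sigma> R lam x y t) \<longlongrightarrow> g lam) at_top) \<and>
        (g \<longlongrightarrow> L) (at lam0) \<and>
        (\<forall>t\<ge>0. ((\<lambda>lam. conditioned_law P S Z \<sigma> R lam x y t) \<longlongrightarrow> h t) (at lam0)) \<and>
        (h \<longlongrightarrow> L) at_top)"
proof -
  interpret rate_one_process P p S Z \<sigma> by fact
  note irr = assms(3)
  define K where "K \<theta> = trace_kernel p R \<theta>" for \<theta>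
  have rk: "reversible_kernel R (K \<theta>) (pmf \<mu>)" if "\<theta> \<in> {0..1}" for \<theta>
    unfolding K_def using that by (intro reversible_kernel_trace_kernel assms) auto
  have lap: "laplace lam \<in> {0..1}" for lam using laplace_bounds by simp
  \<comment> \<open>The Perron measure sees only the entries in \<open>R\<close>, where the soft
    kernel has been identified.\<close>
  have SM: "soft_measure P S Z \<sigma> R lam = perron_measure R (K (laplace lam))" for lam
    unfolding soft_measure_def K_def by (intro perron_measure_cong soft_kernel_eq[OF irr])
  have ne: "set_pmf \<mu> \<inter> R \<noteq> {}"
  proof -
    have "x \<in> set_pmf \<mu>" for x
      using reversible_irreducible_pmf_pos[OF assms(2,3), of x] by (simp add: set_pmf_iff)
    then show ?thesis using assms(4) by blast
  qed
  have at_0: "soft_measure P S Z \<sigma> R 0 = cond_pmf \<mu> R"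
    unfolding SM laplace_simps
  proof (rule reversible_kernel.perron_measure_eqI[OF rk, where r=1])
    show "left_act R (K 1) (pmf (cond_pmf \<mu> R)) y = 1 * pmf (cond_pmf \<mu> R) y" if "y \<in> R" for y
      using left_act_trace_kernel_cond_pmf[OF assms(2,3) ne that] by (simp add: K_def)
  qed (use set_cond_pmf[OF ne] in auto)
  have at_top: "soft_measure P S Z \<sigma> R top = quasi_stationary p R"
    unfolding SM laplace_simps quasi_stationary_def K_def
    by (intro perron_measure_cong trace_kernel_0)
  \<comment> \<open>Every limit in \<open>lam\<close>, endpoints included, is continuity in
    \<open>\<theta>\<close> composed with \<open>laplace\<close>.\<close>
  have lim: "((\<lambda>lam. f (laplace lam)) \<longlongrightarrow> f (laplace lam0)) (at lam0)"
    if "continuous_on {0..1} f" for f :: "real \<Rightarrow> real" and lam0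
    by (rule continuous_on_tendsto_compose[OF that laplace_tendsto lap]) (simp add: lap del: atLeastAtMost_iff)
  have SM_lim: "((\<lambda>lam. pmf (soft_measure P S Z \<sigma> R lam) y) \<longlongrightarrow> pmf (soft_measure P S Z \<sigma> R lam0) y) (at lam0)"
    for lam0 y
    unfolding SM
    by (intro lim continuous_on_perron_measure[OF rk])
      (simp_all add: K_def continuous_on_trace_kernel)
  have l2_lim: "((\<lambda>lam. l2_norm (quasi_stationary p R)
      (\<lambda>y. pmf (soft_measure P S Z \<sigma> R lam) y - pmf (soft_measure P S Z \<sigma> R lam0) y)) \<longlongrightarrow> 0) (at lam0)" for lam0
  proof -
    have "((\<lambda>lam. sqrt (\<Sum>y\<in>UNIV. pmf (quasi_stationary p R) y *
        (pmf (soft_measure P S Z \<sigma> R lam) y - pmf (soft_measure P S Z \<sigma> R lam0) y)\<^sup>2)) \<longlongrightarrow>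
        sqrt (\<Sum>y\<in>UNIV. pmf (quasi_stationary p R) y *
        (pmf (soft_measure P S Z \<sigma> R lam0) y - pmf (soft_measure P S Z \<sigma> R lam0) y)\<^sup>2)) (at lam0)"
      by (intro tendsto_intros SM_lim)
    then show ?thesis by (simp add: l2_norm_def integral_measure_pmf[of UNIV])
  qed
  have law_lim: "((\<lambda>t. conditioned_law P S Z \<sigma> R lam x y t) \<longlongrightarrow> pmf (soft_measure P S Z \<sigma> R lam) y) at_top"
    if "x \<in> R" "y \<in> R" for lam x y
  proof -
    have "((\<lambda>t. poisson_kernel R (K (laplace lam)) t x y / (\<Sum>z\<in>R. poisson_kernel R (K (laplace lam)) t x z))
        \<longlongrightarrow> pmf (soft_measure P S Z \<sigma> R lam) y) at_top"
      unfolding SM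
      by (rule reversible_kernel.poisson_kernel_limit[OF rk[OF lap] _ that])
        (simp add: K_def sum_trace_kernel_le laplace_bounds)
    moreover have "\<forall>\<^sub>F t in at_top. poisson_kernel R (K (laplace lam)) t x y /
        (\<Sum>z\<in>R. poisson_kernel R (K (laplace lam)) t x z) = conditioned_law P S Z \<sigma> R lam x y t"
      using eventually_ge_at_top[of 0]
      by eventually_elim (simp add: K_def conditioned_law_eq[OF irr that])
    ultimately show ?thesis by (rule Lim_transform_eventually)
  qed
  have law_cont: "((\<lambda>lam. conditioned_law P S Z \<sigma> R lam x y t) \<longlongrightarrow> conditioned_law P S Z \<sigma> R lam0 x y t) (at lam0)"
    if "x \<in> R" "y \<in> R" "0 \<le> t" for x y t lam0
  proof -
    \<comment> \<open>The summand \<open>z = x\<close> is at least \<open>exp (- t)\<close>,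
      whatever \<open>\<theta>\<close> is.\<close>
    have "(\<Sum>z\<in>R. poisson_kernel R (K \<theta>) t x z) \<noteq> 0" if "\<theta> \<in> {0..1}" for \<theta>
    proof -
      have "0 < exp (- t)" by simp
      also have "\<dots> \<le> poisson_kernel R (K \<theta>) t x x"
        unfolding K_def using that \<open>x \<in> R\<close> \<open>0 \<le> t\<close>
        by (intro poisson_kernel_ge(2)[where y=x] trace_kernel_nonneg sum_trace_kernel_le) auto
      also have "\<dots> \<le> (\<Sum>z\<in>R. poisson_kernel R (K \<theta>) t x z)"
        unfolding K_def using that \<open>x \<in> R\<close> \<open>0 \<le> t\<close>
        by (intro member_le_sum poisson_kernel_ge(1) trace_kernel_nonneg sum_trace_kernel_le) auto
      finally show ?thesis by simp
    qed
    then have "continuous_on {0..1} (\<lambda>\<theta>. poisson_kernel R (K \<theta>) t x y / (\<Sum>z\<in>R. poisson_kernel R (K \<theta>) t x z))"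
      unfolding K_def using that by (intro continuous_intros continuous_on_poisson_kernel) auto
    from lim[OF this] show ?thesis by (simp add: K_def conditioned_law_eq[OF irr that])
  qed
  show ?thesis
  proof (intro conjI allI ballI)
    fix lam0 x y assume xy: "x \<in> R" "y \<in> R"
    show "\<exists>g h L. (\<forall>lam. ((\<lambda>t. conditioned_law P S Z \<sigma> R lam x y t) \<longlongrightarrow> g lam) at_top) \<and>
        (g \<longlongrightarrow> L) (at lam0) \<and>
        (\<forall>t\<ge>0. ((\<lambda>lam. conditioned_law P S Z \<sigma> R lam x y t) \<longlongrightarrow> h t) (at lam0)) \<and>
        (h \<longlongrightarrow> L) at_top"
    \<comment> \<open>The witnesses arise by unification: \<open>g\<close> is the soft measure at
      \<open>y\<close> as a function of \<open>lam\<close>, \<open>h\<close> is the conditioned law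
      at \<open>lam0\<close>, and \<open>L\<close> is the soft measure of \<open>lam0\<close> at
      \<open>y\<close>.\<close>
    proof (intro exI conjI allI impI)
      show "((\<lambda>t. conditioned_law P S Z \<sigma> R lam x y t) \<longlongrightarrow> pmf (soft_measure P S Z \<sigma> R lam) y) at_top" for lam
        by (rule law_lim[OF xy])
      show "((\<lambda>lam. conditioned_law P S Z \<sigma> R lam x y t) \<longlongrightarrow> conditioned_law P S Z \<sigma> R lam0 x y t) (at lam0)"
        if "0 \<le> t" for t by (rule law_cont[OF xy that])
    qed (fact SM_lim law_lim[OF xy])+
  qed (rule at_0 at_top l2_lim SM_lim)+
qed

end
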